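(* For all integers $d\ge 0$, $m\ge 1$, $h\ge 0$ and $k\ge 0$, the linear system $\mathcal{L}_d(m^{4^h9^k})$ of plane curves of degree $d$ with multiplicity at least $m$ at each of $4^h9^k$ points in general position is non-special.
   Context: Work over $\mathbb{C}$. For points $q_1,\dots,q_n$ of the projective plane $\mathbb{P}^2$, consider the linear system of plane curves of degree $d$ having multiplicity at least $m$ at each $q_i$. It is the projectivization of the vector space of homogeneous polynomials of degree $d$ in three variables (including $0$) that vanish to order at least $m$ at each $q_i$, i.e. whose Taylor expansion at each $q_i$ in local affine coordinates has no terms of degree less than $m$. Its dimension is the dimension of this vector space minus $1$, so the dimension is $-1$ exactly when the system is empty. The notation $\mathcal{L}_d(m^n)$ denotes this system for $n$ points $q_1,\dots,q_n$ in general position (so in $\mathcal{L}_d(m^{4^h9^k})$ the number of points is $n=4^h9^k$). Its dimension $l$ is the minimum value over all $n$-tuples of distinct points, which is attained on a nonempty Zariski open set of $n$-tuples. The virtual dimension is $v(d,m,n)=\frac{d(d+3)}{2}-n\,\frac{m(m+1)}{2}$, and the expected dimension is $e(d,m,n)=\max\{-1,\,v(d,m,n)\}$. One always has $l\ge e$. The system $\mathcal{L}_d(m^n)$ is called non-special if $l=e(d,m,n)$, and special otherwise. *)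

theory Defs
  imports "HOL-Analysis.Analysis" "HOL-Library.Poly_Mapping"
begin

text \<open>Polynomials over the complex numbers in three variables indexed by the type \<open>3\<close>:
  finitely supported maps from exponent vectors to coefficients.
  The library's convolution product makes this type the polynomial ring.\<close>

type_synonym mpoly3 = "(nat ^ 3) \<Rightarrow>\<^sub>0 complex"

definition const3 :: "complex \<Rightarrow> mpoly3" where
  "const3 c = Poly_Mapping.single 0 c"

definition var3 :: "3 \<Rightarrow> mpoly3" where
  "var3 i = Poly_Mapping.single (\<chi> j. if j = i then 1 else 0) 1"

definition mdeg :: "nat ^ 3 \<Rightarrow> nat" where
  "mdeg a = (\<Sum>i\<in>UNIV. a $ i)"

definition homogeneous :: "nat \<Rightarrow> mpoly3 \<Rightarrow> bool" where
  "homogeneous d F \<longleftrightarrow> (\<forall>a\<in>Poly_Mapping.keys F. mdeg a = d)"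

definition mscale :: "complex \<Rightarrow> mpoly3 \<Rightarrow> mpoly3" where
  "mscale c F = Poly_Mapping.map ((*) c) F"

lemma lookup_mscale: "Poly_Mapping.lookup (mscale c F) a = c * Poly_Mapping.lookup F a"
  by (simp add: mscale_def Poly_Mapping.map.rep_eq when_def)

global_interpretation mpoly3: vector_space mscale
  defines mpoly3_dim = mpoly3.dim
  by unfold_locales
    (rule poly_mapping_eqI, simp add: lookup_mscale lookup_add algebra_simps)+

definition msubst :: "(3 \<Rightarrow> mpoly3) \<Rightarrow> mpoly3 \<Rightarrow> mpoly3" where
  "msubst g F = (\<Sum>a\<in>Poly_Mapping.keys F. const3 (Poly_Mapping.lookup F a) * (\<Prod>i\<in>UNIV. g i ^ (a $ i)))"

lemma msubst_superset:
  assumes "finite A" "Poly_Mapping.keys F \<subseteq> A"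
  shows "msubst g F = (\<Sum>a\<in>A. const3 (Poly_Mapping.lookup F a) * (\<Prod>i\<in>UNIV. g i ^ (a $ i)))"
  unfolding msubst_def using assms
  by (intro sum.mono_neutral_left) (auto simp: in_keys_iff const3_def)

lemma msubst_add: "msubst g (F + G) = msubst g F + msubst g G"
proof -
  let ?A = "Poly_Mapping.keys F \<union> Poly_Mapping.keys G"
  have "Poly_Mapping.keys (F + G) \<subseteq> ?A"
    by (rule Poly_Mapping.keys_add)
  then show ?thesis
    by (simp add: msubst_superset[of ?A] const3_def lookup_add single_add distrib_right sum.distrib)
qed

lemma const3_mult: "const3 c * F = mscale c F"
  by (simp add: mscale_def const3_def mult_map_scale_conv_mult)

lemma msubst_mscale: "msubst g (mscale c F) = mscale c (msubst g F)"
proof -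
  have "Poly_Mapping.keys (mscale c F) \<subseteq> Poly_Mapping.keys F"
    by (auto simp: in_keys_iff lookup_mscale)
  then have "msubst g (mscale c F) = (\<Sum>a\<in>Poly_Mapping.keys F.
      const3 (c * Poly_Mapping.lookup F a) * (\<Prod>i\<in>UNIV. g i ^ (a $ i)))"
    by (simp add: msubst_superset[of "Poly_Mapping.keys F"] lookup_mscale)
  also have "\<dots> = const3 c * msubst g F"
    by (simp add: msubst_def const3_def sum_distrib_left mult.assoc[symmetric] mult_single)
  finally show ?thesis by (simp add: const3_mult)
qed

text \<open>A point of the projective plane is given by a nonzero vector \<open>q\<close> of homogeneous
  coordinates. If \<open>q $ i \<noteq> 0\<close>, the affine coordinates of the point in the chart
  \<open>x\<^sub>i = 1\<close> are \<open>q $ j / q $ i\<close> for \<open>j \<noteq> i\<close>. The following is the Taylor expansion at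
  the point of the dehomogenization of \<open>F\<close> in this chart; the local coordinates centred
  at the point are the variables \<open>var3 j\<close> with \<open>j \<noteq> i\<close> (\<open>var3 i\<close> does not occur).\<close>

definition local_expansion :: "3 \<Rightarrow> complex ^ 3 \<Rightarrow> mpoly3 \<Rightarrow> mpoly3" where
  "local_expansion i q F =
     msubst (\<lambda>j. if j = i then 1 else var3 j + const3 (q $ j / q $ i)) F"

text \<open>For homogeneous \<open>F\<close> the condition does not depend on the affine chart containing the
  point, so it is imposed in every such chart.\<close>

definition vanishes_to_order :: "nat \<Rightarrow> complex ^ 3 \<Rightarrow> mpoly3 \<Rightarrow> bool" where
  "vanishes_to_order m q F \<longleftrightarrow>
     (\<forall>i. q $ i \<noteq> 0 \<longrightarrow> (\<forall>a\<in>Poly_Mapping.keys (local_expansion i q F). m \<le> mdeg a))"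

text \<open>Homogeneous coordinates of \<open>n\<close>-tuples of distinct points of the projective plane
  (only the values at indices below \<open>n\<close> matter).\<close>

definition distinct_points :: "nat \<Rightarrow> (nat \<Rightarrow> complex ^ 3) set" where
  "distinct_points n = {q. (\<forall>i<n. q i \<noteq> 0) \<and>
     (\<forall>i<n. \<forall>j<n. i \<noteq> j \<longrightarrow> (\<nexists>c. q i = c *s q j))}"

lemma distinct_points_nonempty: "distinct_points n \<noteq> {}"
proof -
  define q :: "nat \<Rightarrow> complex ^ 3" where "q i = vector [1, of_nat i, 0]" for i
  have "q \<in> distinct_points n"
    by (auto simp: distinct_points_def q_def vec_eq_iff forall_3)
  then show ?thesis by blast
qed

definition curve_space :: "nat \<Rightarrow> nat \<Rightarrow> nat \<Rightarrow> (nat \<Rightarrow> complex ^ 3) \<Rightarrow> mpoly3 set" where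
  "curve_space d m n q = {F. homogeneous d F \<and> (\<forall>i<n. vanishes_to_order m (q i) F)}"

lemma subspace_curve_space: "mpoly3.subspace (curve_space d m n q)"
proof -
  have keys_mscale: "Poly_Mapping.keys (mscale c F) \<subseteq> Poly_Mapping.keys F" for c F
    by (auto simp: in_keys_iff lookup_mscale)
  have "homogeneous d 0" "vanishes_to_order m p 0" for p
    by (auto simp: homogeneous_def vanishes_to_order_def local_expansion_def msubst_def)
  moreover have "homogeneous d (F + G)" if "homogeneous d F" "homogeneous d G" for F G
    using that Poly_Mapping.keys_add[of F G] by (auto simp: homogeneous_def)
  moreover have "vanishes_to_order m p (F + G)"
    if "vanishes_to_order m p F" "vanishes_to_order m p G" for p F G
    using that Poly_Mapping.keys_add
    by (fastforce simp: vanishes_to_order_def local_expansion_def msubst_add)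
  moreover have "homogeneous d (mscale c F)" if "homogeneous d F" for c F
    using that keys_mscale by (auto simp: homogeneous_def)
  moreover have "vanishes_to_order m p (mscale c F)" if "vanishes_to_order m p F" for p c F
    using that keys_mscale
    by (fastforce simp: vanishes_to_order_def local_expansion_def msubst_mscale)
  ultimately show ?thesis
    by (auto simp: mpoly3.subspace_def curve_space_def)
qed

definition system_dim :: "nat \<Rightarrow> nat \<Rightarrow> nat \<Rightarrow> (nat \<Rightarrow> complex ^ 3) \<Rightarrow> int" where
  "system_dim d m n q = int (mpoly3_dim (curve_space d m n q)) - 1"

text \<open>The dimension for points in general position is the minimum over all tuples of
  distinct points (attained on a nonempty Zariski open set of tuples). The infimum is a minimum, because the set of values is nonempty and
  bounded below by \<open>-1\<close>.\<close>

definition general_dim :: "nat \<Rightarrow> nat \<Rightarrow> nat \<Rightarrow> int" where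
  "general_dim d m n = (INF q\<in>distinct_points n. system_dim d m n q)"

text \<open>Both divisions by 2 are exact.\<close>

definition virtual_dim :: "nat \<Rightarrow> nat \<Rightarrow> nat \<Rightarrow> int" where
  "virtual_dim d m n = int d * (int d + 3) div 2 - int n * (int m * (int m + 1) div 2)"

definition expected_dim :: "nat \<Rightarrow> nat \<Rightarrow> nat \<Rightarrow> int" where
  "expected_dim d m n = max (- 1) (virtual_dim d m n)"

definition non_special :: "nat \<Rightarrow> nat \<Rightarrow> nat \<Rightarrow> bool" where
  "non_special d m n \<longleftrightarrow> general_dim d m n = expected_dim d m n"

end

theory Submission
  imports Defs
begin

text \<open>A curve of degree \<open>d\<close> is given by the coefficients of its equation in an affine chart, a vector indexed
by the \<open>N = (d + 1)(d + 2)/2\<close> monomials of degree at most \<open>d\<close>. Multiplicity \<open>m\<close> at \<open>n\<close> points is given by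
\<open>n m (m + 1)/2\<close> linear conditions, so the dimension is at least the expected one for every tuple
(\<open>curve_space_dim_ge\<close>). It has to be shown that some points impose as many independent conditions as
possible, in all degrees and multiplicities; this property of \<open>n\<close> is called \<open>max_rank n\<close> below. One point has it, and the
theorem follows because it passes from \<open>n\<close> to \<open>4 n\<close> and to \<open>9 n\<close>.

For \<open>s = 2\<close> or \<open>s = 3\<close>, let \<open>s\<^sup>2\<close> points of multiplicity \<open>m\<close> collide at each of \<open>n\<close> points. No curve of degree less than \<open>s m\<close>
has multiplicity \<open>m\<close> at \<open>s\<^sup>2\<close> general points, so the limit has multiplicity \<open>D = s m\<close>. In addition, if the points
approach along a suitable direction, then the leading form in the limit is divisible by the power \<open>l^t\<close> of a linear form
\<open>l\<close>, with \<open>t = m\<close> for \<open>s = 2\<close> and \<open>t = 3 m\<close> for \<open>s = 3\<close>. In local coordinates with \<open>l\<close> as the first one, this is the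
vanishing of the coefficients in the set \<open>stair D t\<close>, and \<open>D (D + 1)/2 + t = s\<^sup>2 m (m + 1)/2\<close>: the limit imposes
as many conditions as the colliding points. By semicontinuity of the rank (\<open>collision\<close>) it is
enough to treat \<open>n\<close> stairs. That the limit is as described amounts to finding \<open>s\<^sup>2\<close> points such that no nonzero
polynomial with exponents in the stair has multiplicity \<open>m\<close> at all of them. For \<open>s = 2\<close> the points lie on two
lines (\<open>four_points_rows\<close>), for \<open>s = 3\<close> on three parallel lines (\<open>nine_points_rows\<close>).

It remains to show that \<open>n\<close> stairs with general points and general linear forms impose as many conditions as
possible (\<open>stair_rank\<close>), given that \<open>n\<close> points of multiplicity \<open>D\<close> and \<open>n\<close> points of multiplicity
\<open>D + 1\<close> do. If the latter impose independent conditions, then so do the stairs, which are weaker. Otherwise no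
curve of degree \<open>d\<close> has multiplicity \<open>D + 1\<close> at \<open>n\<close> general points. Start with multiplicity \<open>D\<close> everywhere and
add the \<open>t\<close> conditions on the leading form at one point after the other. The leading forms at the next point of the
curves that are left make up a space of binary forms, of dimension \<open>r\<close> say, and divisibility by the \<open>t\<close>-th power of a general
linear form imposes \<open>min r t\<close> conditions on such a space in characteristic zero (\<open>divisible_combinations_finite\<close>).
Thus either the \<open>t\<close> conditions are independent, or they force multiplicity \<open>D + 1\<close> (\<open>stair_dichotomy\<close>). If the
second case ever occurs, then, since general points are interchangeable, curves satisfying all the stair conditions
have multiplicity \<open>D + 1\<close> at every point, and there are none.\<close>

section \<open>Dimensions of spaces of coefficient vectors\<close>

text \<open>Functionals are given by their coefficient vectors. The requirement that \<open>v\<close> vanishes outside \<open>I\<close>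
makes the space of all functions on \<open>I\<close> a set of functions on the whole type.\<close>

definition common_kernel :: "'i set \<Rightarrow> ('i \<Rightarrow> complex) set \<Rightarrow> ('i \<Rightarrow> complex) set" where
  "common_kernel I L = {v. (\<forall>i. i \<notin> I \<longrightarrow> v i = 0) \<and> (\<forall>f\<in>L. (\<Sum>i\<in>I. f i * v i) = 0)}"

definition lin_subspace :: "('i \<Rightarrow> complex) set \<Rightarrow> bool" where
  "lin_subspace S \<longleftrightarrow> (\<lambda>i. 0) \<in> S \<and> (\<forall>u\<in>S. \<forall>v\<in>S. \<forall>a b. (\<lambda>i. a * u i + b * v i) \<in> S)"

definition separates :: "'i set \<Rightarrow> ('i \<Rightarrow> complex) set \<Rightarrow> bool" where
  "separates K S \<longleftrightarrow> (\<forall>v\<in>S. (\<forall>k\<in>K. v k = 0) \<longrightarrow> (\<forall>i. v i = 0))"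

text \<open>For a subspace of a finite-dimensional space of functions this says that the dimension is at most
\<open>b\<close>: restriction to some set of \<open>b\<close> coordinates is injective. In this form the bound is a statement about
the common kernel of explicit functionals, which is what semicontinuity needs.\<close>

definition dim_at_most :: "('i \<Rightarrow> complex) set \<Rightarrow> nat \<Rightarrow> bool" where
  "dim_at_most S b \<longleftrightarrow> (\<exists>K. finite K \<and> card K \<le> b \<and> separates K S)"

lemma lin_subspace_common_kernel: "lin_subspace (common_kernel I L)"
  by (auto simp: lin_subspace_def common_kernel_def algebra_simps sum.distrib
        simp flip: sum_distrib_left)

lemma eq_of_combination: "1 * a + (-1) * b = 0 \<Longrightarrow> a = (b::complex)"
  by simp

lemma separatesD:
  "separates K S \<Longrightarrow> v \<in> S \<Longrightarrow> (\<And>k. k \<in> K \<Longrightarrow> v k = 0) \<Longrightarrow> v i = 0"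
  by (simp add: separates_def)

lemma lin_subspaceD:
  "lin_subspace S \<Longrightarrow> u \<in> S \<Longrightarrow> v \<in> S \<Longrightarrow> (\<lambda>i. a * u i + b * v i) \<in> S"
  by (simp add: lin_subspace_def)

lemma lin_subspace_sum:
  assumes "lin_subspace S" "finite K" "\<And>k. k \<in> K \<Longrightarrow> w k \<in> S"
  shows "(\<lambda>i. \<Sum>k\<in>K. y k * w k i) \<in> S"
  using assms(2,3)
proof (induction K)
  case empty
  then show ?case using assms(1) by (simp add: lin_subspace_def)
next
  case (insert k K)
  have "(\<lambda>i. y k * w k i + 1 * (\<Sum>k\<in>K. y k * w k i)) \<in> S"
    by (rule lin_subspaceD[OF assms(1)]) (use insert in auto)
  then show ?case using insert by simp
qed

lemma dim_at_most_mono: "dim_at_most S b \<Longrightarrow> S' \<subseteq> S \<Longrightarrow> b \<le> b' \<Longrightarrow> dim_at_most S' b'"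
  unfolding dim_at_most_def separates_def by (meson le_trans subsetD)

text \<open>In a minimal separating set \<open>K'\<close> no coordinate can be omitted, so for every \<open>k\<close> in \<open>K'\<close> some
vector of \<open>S\<close> has \<open>k\<close> as its only nonzero coordinate in \<open>K'\<close>. Normalized, these vectors form a basis of \<open>S\<close>
whose coordinate functionals are the coordinates in \<open>K'\<close>.\<close>

lemma dual_basis:
  assumes S: "lin_subspace S" and K: "finite K" "separates K S"
  shows "\<exists>K' w. K' \<subseteq> K \<and> separates K' S \<and> (\<forall>k\<in>K'. w k \<in> S) \<and>
    (\<forall>k\<in>K'. \<forall>l\<in>K'. w k l = (if l = k then 1 else 0)) \<and>
    (\<forall>v\<in>S. \<forall>i. v i = (\<Sum>k\<in>K'. v k * w k i))"
proof -
  have "\<exists>K' w. K' \<subseteq> K \<and> separates K' S \<and> (\<forall>k\<in>K'. w k \<in> S \<and> (\<forall>l\<in>K'. w k l = (if l = k then 1 else 0)))"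
    using K
  proof (induction K rule: finite_psubset_induct)
    case (psubset K)
    show ?case
    proof (cases "\<exists>k\<in>K. separates (K - {k}) S")
      case True
      then obtain k where "k \<in> K" "separates (K - {k}) S" by blast
      then have "\<exists>K' w. K' \<subseteq> K - {k} \<and> separates K' S \<and> (\<forall>k\<in>K'. w k \<in> S \<and> (\<forall>l\<in>K'. w k l = (if l = k then 1 else 0)))"
        by (intro psubset.IH) auto
      then show ?thesis by blast
    next
      case False
      have "\<exists>u. u \<in> S \<and> (\<forall>l\<in>K. u l = (if l = k then 1 else 0))" if k: "k \<in> K" for k
      proof -
        from False k obtain v where v: "v \<in> S" "\<forall>l\<in>K-{k}. v l = 0" "\<exists>i. v i \<noteq> 0"
          unfolding separates_def by blast
        have vk: "v k \<noteq> 0"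
        proof
          assume "v k = 0"
          then have "v l = 0" if "l \<in> K" for l using v(2) that by blast
          then show False using separatesD[OF _ v(1), of K] psubset.prems v(3) by blast
        qed
        have "(\<lambda>i. (1 / v k) * v i + 0 * v i) \<in> S"
          by (rule lin_subspaceD[OF S v(1) v(1)])
        then show ?thesis using vk v(2) by (intro exI[of _ "\<lambda>i. (1 / v k) * v i + 0 * v i"]) auto
      qed
      then obtain w where "\<forall>k\<in>K. w k \<in> S \<and> (\<forall>l\<in>K. w k l = (if l = k then 1 else 0))" by metis
      then show ?thesis using psubset.prems by blast
    qed
  qed
  then obtain K' w where *: "K' \<subseteq> K" "separates K' S"
    and w: "\<And>k. k \<in> K' \<Longrightarrow> w k \<in> S" "\<And>k l. k \<in> K' \<Longrightarrow> l \<in> K' \<Longrightarrow> w k l = (if l = k then 1 else 0)"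
    by blast
  have fin: "finite K'" using *(1) K(1) finite_subset by blast
  have "v i = (\<Sum>k\<in>K'. v k * w k i)" if v: "v \<in> S" for v i
  proof -
    have "(\<lambda>i. \<Sum>k\<in>K'. v k * w k i) \<in> S" by (rule lin_subspace_sum[OF S fin w(1)])
    then have m: "(\<lambda>i. 1 * v i + (-1) * (\<Sum>k\<in>K'. v k * w k i)) \<in> S"
      by (rule lin_subspaceD[OF S v])
    have "(\<Sum>k\<in>K'. v k * w k l) = v l" if l: "l \<in> K'" for l
    proof -
      have "(\<Sum>k\<in>K'. v k * w k l) = (\<Sum>k\<in>K'. if k = l then v k else 0)"
        by (rule sum.cong) (auto simp: w(2) l)
      then show ?thesis using fin l by simp
    qed
    note eq = this
    have "1 * v i + (-1) * (\<Sum>k\<in>K'. v k * w k i) = 0" by (rule separatesD[OF *(2) m]) (simp add: eq)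
    then show ?thesis by (rule eq_of_combination)
  qed
  with * w show ?thesis by (intro exI[of _ K'] exI[of _ w]) simp
qed

text \<open>If a minimal set of coordinates separating \<open>S'\<close> were the whole set that separates \<open>S\<close>, then
the dual basis of \<open>S'\<close> would span \<open>S\<close> as well.\<close>

lemma dim_at_most_proper_subspace:
  assumes "lin_subspace S" "lin_subspace S'" "S' \<subseteq> S" "S' \<noteq> S" "dim_at_most S b"
  shows "b > 0 \<and> dim_at_most S' (b - 1)"
proof -
  obtain K where K: "finite K" "card K \<le> b" "separates K S" using assms(5) unfolding dim_at_most_def by blast
  have K': "separates K S'" using K(3) assms(3) unfolding separates_def by blast
  from dual_basis[OF assms(2) K(1) K'] obtain L w where L: "L \<subseteq> K" "separates L S'" "\<forall>k\<in>L. w k \<in> S'"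
    "\<forall>k\<in>L. \<forall>l\<in>L. w k l = (if l = k then 1 else 0)"
    by blast
  have "L \<noteq> K"
  proof
    assume LK: "L = K"
    have "v \<in> S'" if v: "v \<in> S" for v
    proof -
      have s: "(\<lambda>i. \<Sum>k\<in>K. v k * w k i) \<in> S'"
        by (rule lin_subspace_sum[OF assms(2) K(1)]) (use L(3) LK in blast)
      then have m: "(\<lambda>i. 1 * v i + (-1) * (\<Sum>k\<in>K. v k * w k i)) \<in> S"
        by (intro lin_subspaceD[OF assms(1) v]) (use assms(3) in blast)
      have "(\<Sum>k\<in>K. v k * w k l) = v l" if l: "l \<in> K" for l
      proof -
        have "(\<Sum>k\<in>K. v k * w k l) = (\<Sum>k\<in>K. if k = l then v k else 0)"
          by (rule sum.cong) (auto simp: L(4) LK l)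
        then show ?thesis using K(1) l by simp
      qed
      note eq = this
      have "1 * v i + (-1) * (\<Sum>k\<in>K. v k * w k i) = 0" for i by (rule separatesD[OF K(3) m]) (simp add: eq)
      then have vi: "v i = (\<Sum>k\<in>K. v k * w k i)" for i
        by (rule eq_of_combination)
      have "(\<lambda>i. \<Sum>k\<in>K. v k * w k i) = v" by (rule ext) (rule vi[symmetric])
      with s show ?thesis by (simp only:)
    qed
    then show False using assms(3,4) by blast
  qed
  then have "card L < card K" using L(1) K(1) by (simp add: psubset_card_mono psubset_eq)
  then show ?thesis using K L(1,2) finite_subset[OF L(1) K(1)] unfolding dim_at_most_def
    by (intro conjI exI[of _ L]) auto
qed

text \<open>If \<open>K\<close> does not already separate \<open>S\<close>, take \<open>v\<close> in \<open>S\<close> vanishing on \<open>K\<close> with \<open>v k \<noteq> 0\<close>. Subtracting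
a multiple of \<open>v\<close> moves a vector of \<open>S\<close> into the kernel of \<open>f\<close>, so \<open>K\<close> and \<open>k\<close> together separate \<open>S\<close>.\<close>

lemma dim_at_most_drop_condition:
  assumes S: "lin_subspace S" and f: "\<And>u v a b. f (\<lambda>i. a * u i + b * v i) = a * f u + b * f v"
    and d: "dim_at_most {v\<in>S. f v = (0::complex)} b"
  shows "dim_at_most S (Suc b)"
proof -
  obtain K where K: "finite K" "card K \<le> b" "separates K {v\<in>S. f v = 0}" using d unfolding dim_at_most_def by blast
  show ?thesis
  proof (cases "separates K S")
    case True
    then show ?thesis using K unfolding dim_at_most_def by (meson le_SucI)
  next
    case False
    then obtain v k where v: "v \<in> S" "\<forall>l\<in>K. v l = 0" "v k \<noteq> 0" unfolding separates_def by blast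
    have fv: "f v \<noteq> 0" using v K(3) unfolding separates_def by blast
    have "separates (insert k K) S"
      unfolding separates_def
    proof (intro ballI impI allI)
      fix u i assume u: "u \<in> S" "\<forall>l\<in>insert k K. u l = 0"
      define x where "x = (\<lambda>i. 1 * u i + (- f u / f v) * v i)"
      have "x \<in> S" unfolding x_def by (rule lin_subspaceD[OF S u(1) v(1)])
      moreover have "f x = 0" using fv by (simp only: x_def f) simp
      moreover have "\<forall>l\<in>K. x l = 0" using u v by (simp add: x_def)
      ultimately have *: "x i = 0" for i using K(3) separatesD[of K "{v \<in> S. f v = 0}" x i] by blast
      from *[of k] have "f u = 0" using u(2) v(3) fv by (simp add: x_def)
      then show "u i = 0" using *[of i] by (simp add: x_def)
    qed
    then show ?thesis unfolding dim_at_most_def using K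
      by (intro exI[of _ "insert k K"]) (auto simp: card_insert_if)
  qed
qed

lemma dim_at_most_drop_conditions:
  assumes I: "finite I" and F: "finite F" and d: "dim_at_most (common_kernel I (L \<union> F)) b"
  shows "dim_at_most (common_kernel I L) (b + card F)"
  using F d
proof (induction F arbitrary: b)
  case empty
  then show ?case by simp
next
  case (insert g F)
  have eq: "common_kernel I (L \<union> insert g F) = {v\<in>common_kernel I (L \<union> F). (\<Sum>i\<in>I. g i * v i) = 0}"
    by (auto simp: common_kernel_def)
  have "dim_at_most (common_kernel I (L \<union> F)) (Suc b)"
  proof (rule dim_at_most_drop_condition[where f="\<lambda>v. \<Sum>i\<in>I. g i * v i"])
    show "(\<Sum>i\<in>I. g i * (a * u i + c * v i)) = a * (\<Sum>i\<in>I. g i * u i) + c * (\<Sum>i\<in>I. g i * v i)" for u v a c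
      by (simp add: sum_distrib_left sum.distrib[symmetric] algebra_simps)
    show "dim_at_most {v\<in>common_kernel I (L \<union> F). (\<Sum>i\<in>I. g i * v i) = 0} b"
      using insert.prems unfolding eq .
  qed (rule lin_subspace_common_kernel)
  then show ?case using insert.IH[of "Suc b"] insert.hyps by simp
qed

lemma dim_at_most_full: 
  assumes "finite I" "dim_at_most (common_kernel I {}) b" shows "card I \<le> b"
proof -
  obtain K where K: "finite K" "card K \<le> b" "separates K (common_kernel I {})" using assms unfolding dim_at_most_def by blast
  have "I \<subseteq> K"
  proof
    fix i assume i: "i \<in> I"
    show "i \<in> K"
    proof (rule ccontr)
      assume "i \<notin> K"
      have "(\<lambda>j. if j = i then 1 else 0) \<in> common_kernel I {}" using i by (auto simp: common_kernel_def)
      then have "(if i = i then 1 else 0) = (0::complex)"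
        by (rule separatesD[OF K(3)]) (use \<open>i \<notin> K\<close> in auto)
      then show False by simp
    qed
  qed
  then show ?thesis using K card_mono by (meson le_trans)
qed

section \<open>Linear systems depending on a parameter\<close>

text \<open>Injectivity of a matrix with polynomial entries is an open condition on the parameter.
Gaussian elimination proves this without determinants: pivot on an entry that is nonzero at \<open>t0\<close>; the
reduced system has one unknown less and still has polynomial entries, and the pivot has finitely many
zeros.\<close>

lemma trivial_kernel_cofinite:
  fixes A :: "'g \<Rightarrow> 'i \<Rightarrow> complex poly"
  assumes "finite I"
    and "\<And>v. (\<forall>g\<in>G. (\<Sum>i\<in>I. poly (A g i) t0 * v i) = 0) \<Longrightarrow> \<forall>i\<in>I. v i = 0"
  shows "finite {t. \<exists>v. (\<forall>g\<in>G. (\<Sum>i\<in>I. poly (A g i) t * v i) = 0) \<and> (\<exists>i\<in>I. v i \<noteq> 0)}"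
  using assms
proof (induction I arbitrary: A)
  case empty
  then show ?case by simp
next
  case (insert i I)
  have "\<exists>f\<in>G. poly (A f i) t0 \<noteq> 0"
  proof (rule ccontr)
    assume c: "\<not> ?thesis"
    have "\<forall>g\<in>G. (\<Sum>j\<in>insert i I. poly (A g j) t0 * (if j = i then 1 else 0)) = 0"
    proof
      fix g assume "g \<in> G"
      then show "(\<Sum>j\<in>insert i I. poly (A g j) t0 * (if j = i then 1 else 0)) = 0"
        using insert.hyps c by (auto intro!: sum.neutral)
    qed
    from insert.prems[OF this] show False by simp
  qed
  then obtain f where f: "f \<in> G" "poly (A f i) t0 \<noteq> 0" by blast
  \<comment> \<open>elimination without division keeps the entries polynomial\<close>
  define B where "B g j = A f i * A g j - A g i * A f j" for g j
  have elim: "(\<Sum>j\<in>I. poly (B g j) t * v j) =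
      poly (A f i) t * (\<Sum>j\<in>insert i I. poly (A g j) t * v j) - poly (A g i) t * (\<Sum>j\<in>insert i I. poly (A f j) t * v j)" for g t v
    using insert.hyps by (simp add: B_def sum_distrib_left algebra_simps sum_subtractf)
  have fin: "finite {t. \<exists>v. (\<forall>g\<in>G. (\<Sum>j\<in>I. poly (B g j) t * v j) = 0) \<and> (\<exists>j\<in>I. v j \<noteq> 0)}"
  proof (rule insert.IH)
    fix v assume v: "\<forall>g\<in>G. (\<Sum>j\<in>I. poly (B g j) t0 * v j) = 0"
    define u where "u = v(i := - (\<Sum>j\<in>I. poly (A f j) t0 * v j) / poly (A f i) t0)"
    have uI: "(\<Sum>j\<in>I. h j * u j) = (\<Sum>j\<in>I. h j * v j)" for h
      using insert.hyps by (intro sum.cong) (auto simp: u_def)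
    have fu: "(\<Sum>j\<in>insert i I. poly (A f j) t0 * u j) = 0"
      using insert.hyps f(2) by (simp add: uI) (simp add: u_def)
    have "\<forall>g\<in>G. (\<Sum>j\<in>insert i I. poly (A g j) t0 * u j) = 0"
    proof
      fix g assume "g \<in> G"
      then show "(\<Sum>j\<in>insert i I. poly (A g j) t0 * u j) = 0"
        using elim[of g t0 u] v f(2) by (simp only: uI fu) simp
    qed
    from insert.prems[OF this] have u0: "\<forall>j\<in>insert i I. u j = 0" .
    show "\<forall>j\<in>I. v j = 0"
    proof
      fix j assume "j \<in> I"
      then have "u j = 0" "j \<noteq> i" using u0 insert.hyps by auto
      then show "v j = 0" by (simp add: u_def)
    qed
  qed
  have "A f i \<noteq> 0" using f(2) by auto
  then have "finite {t. poly (A f i) t = 0}" by (rule poly_roots_finite)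
  moreover have "{t. \<exists>v. (\<forall>g\<in>G. (\<Sum>j\<in>insert i I. poly (A g j) t * v j) = 0) \<and> (\<exists>j\<in>insert i I. v j \<noteq> 0)} \<subseteq>
      {t. poly (A f i) t = 0} \<union> {t. \<exists>v. (\<forall>g\<in>G. (\<Sum>j\<in>I. poly (B g j) t * v j) = 0) \<and> (\<exists>j\<in>I. v j \<noteq> 0)}"
  proof (rule subsetI, rule UnCI)
    fix t assume "t \<in> {t. \<exists>v. (\<forall>g\<in>G. (\<Sum>j\<in>insert i I. poly (A g j) t * v j) = 0) \<and> (\<exists>j\<in>insert i I. v j \<noteq> 0)}"
    then obtain v where v: "\<forall>g\<in>G. (\<Sum>j\<in>insert i I. poly (A g j) t * v j) = 0" "\<exists>j\<in>insert i I. v j \<noteq> 0" by blast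
    assume n: "t \<notin> {t. \<exists>v. (\<forall>g\<in>G. (\<Sum>j\<in>I. poly (B g j) t * v j) = 0) \<and> (\<exists>j\<in>I. v j \<noteq> 0)}"
    have "\<forall>g\<in>G. (\<Sum>j\<in>I. poly (B g j) t * v j) = 0" using v(1) f(1) by (simp add: elim)
    with n have z: "\<forall>j\<in>I. v j = 0" by blast
    then have "v i \<noteq> 0" using v(2) by blast
    moreover have "poly (A f i) t * v i = 0" using v(1) f(1) z insert.hyps by force
    ultimately show "t \<in> {t. poly (A f i) t = 0}" by simp
  qed
  ultimately show ?case using fin finite_subset by blast
qed

text \<open>Polynomial dependence of matrix entries on a parameter, in the form in which it is checked by
closure rules.\<close>

definition poly_fun :: "(complex \<Rightarrow> complex) \<Rightarrow> bool" where
  "poly_fun f \<longleftrightarrow> (\<exists>p. \<forall>t. f t = poly p t)"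

lemma poly_fun_const [intro!, simp]: "poly_fun (\<lambda>t. c)"
  unfolding poly_fun_def by (intro exI[of _ "[:c:]"]) simp

lemma poly_fun_ident [intro!, simp]: "poly_fun (\<lambda>t. t)"
  unfolding poly_fun_def by (intro exI[of _ "[:0,1:]"]) simp

lemma poly_fun_add [intro]: "poly_fun f \<Longrightarrow> poly_fun g \<Longrightarrow> poly_fun (\<lambda>t. f t + g t)"
  unfolding poly_fun_def by (metis poly_add)

lemma poly_fun_mult [intro]: "poly_fun f \<Longrightarrow> poly_fun g \<Longrightarrow> poly_fun (\<lambda>t. f t * g t)"
  unfolding poly_fun_def by (metis poly_mult)

lemma poly_fun_power [intro]: "poly_fun f \<Longrightarrow> poly_fun (\<lambda>t. f t ^ n)"
  by (induction n) auto

lemma poly_fun_sum [intro]: "(\<And>i. i \<in> A \<Longrightarrow> poly_fun (\<lambda>t. f t i)) \<Longrightarrow> poly_fun (\<lambda>t. \<Sum>i\<in>A. f t i)"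
  by (induction A rule: infinite_finite_induct) auto

lemma separates_cofinite:
  fixes A :: "complex \<Rightarrow> 'g \<Rightarrow> 'i \<Rightarrow> complex"
  assumes I: "finite I" and A: "\<And>g i. g \<in> G \<Longrightarrow> i \<in> I \<Longrightarrow> poly_fun (\<lambda>t. A t g i)"
    and s: "separates K (common_kernel I (A t0 ` G))"
  shows "finite {t. \<not> separates K (common_kernel I (A t ` G))}"
proof -
  obtain P where P: "\<And>g i t. g \<in> G \<Longrightarrow> i \<in> I \<Longrightarrow> A t g i = poly (P g i) t"
    using A unfolding poly_fun_def by metis
  define Q where "Q g i = (case g of Inl h \<Rightarrow> P h i | Inr k \<Rightarrow> if i = k then 1 else (0::complex poly))" for g i
  let ?G = "Inl ` G \<union> Inr ` (K \<inter> I)"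
  have sumk: "(\<Sum>i\<in>I. poly (if i = k then 1 else 0) t * v i) = v k" if "k \<in> I" for k v and t :: complex
  proof -
    have "(\<Sum>i\<in>I. poly (if i = k then 1 else 0) t * v i) = (\<Sum>i\<in>I. if i = k then v i else 0)"
      by (rule sum.cong) auto
    then show ?thesis using I that by simp
  qed
  have sys: "(\<forall>g\<in>?G. (\<Sum>i\<in>I. poly (Q g i) t * v i) = 0) \<longleftrightarrow>
    (\<forall>g\<in>G. (\<Sum>i\<in>I. A t g i * v i) = 0) \<and> (\<forall>k\<in>K\<inter>I. v k = 0)" for t and v :: "'i \<Rightarrow> complex"
    by (simp add: ball_Un Q_def sumk P)
  have sep: "separates K (common_kernel I (A t ` G)) \<longleftrightarrow>
     (\<forall>v. (\<forall>g\<in>?G. (\<Sum>i\<in>I. poly (Q g i) t * v i) = 0) \<longrightarrow> (\<forall>i\<in>I. v i = 0))" for t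
  proof
    assume a: "separates K (common_kernel I (A t ` G))"
    show "\<forall>v. (\<forall>g\<in>?G. (\<Sum>i\<in>I. poly (Q g i) t * v i) = 0) \<longrightarrow> (\<forall>i\<in>I. v i = 0)"
    proof (intro allI impI)
      fix v assume v: "\<forall>g\<in>?G. (\<Sum>i\<in>I. poly (Q g i) t * v i) = 0"
      define u where "u i = (if i \<in> I then v i else 0)" for i
      have "u \<in> common_kernel I (A t ` G)" using v unfolding sys by (auto simp: common_kernel_def u_def)
      moreover have "\<forall>k\<in>K. u k = 0" using v unfolding sys by (auto simp: u_def)
      ultimately show "\<forall>i\<in>I. v i = 0" using a unfolding separates_def by (metis u_def)
    qed
  next
    assume a: "\<forall>v. (\<forall>g\<in>?G. (\<Sum>i\<in>I. poly (Q g i) t * v i) = 0) \<longrightarrow> (\<forall>i\<in>I. v i = 0)"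
    show "separates K (common_kernel I (A t ` G))" unfolding separates_def
    proof (intro ballI impI)
      fix v assume v: "v \<in> common_kernel I (A t ` G)" "\<forall>k\<in>K. v k = 0"
      then have "\<forall>g\<in>?G. (\<Sum>i\<in>I. poly (Q g i) t * v i) = 0" unfolding sys by (simp add: common_kernel_def)
      then have "\<forall>i\<in>I. v i = 0" using a by blast
      then show "\<forall>i. v i = 0" using v(1) by (auto simp: common_kernel_def)
    qed
  qed
  have "finite {t. \<exists>v. (\<forall>g\<in>?G. (\<Sum>i\<in>I. poly (Q g i) t * v i) = 0) \<and> (\<exists>i\<in>I. v i \<noteq> 0)}"
    by (rule trivial_kernel_cofinite[OF I, where ?t0.0=t0]) (use s sep in blast)
  then show ?thesis by (rule finite_subset[rotated]) (use sep in blast)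
qed

lemma dim_at_most_cofinite:
  fixes A :: "complex \<Rightarrow> 'g \<Rightarrow> 'i \<Rightarrow> complex"
  assumes I: "finite I" and A: "\<And>g i. g \<in> G \<Longrightarrow> i \<in> I \<Longrightarrow> poly_fun (\<lambda>t. A t g i)"
    and s: "dim_at_most (common_kernel I (A t0 ` G)) b"
  shows "finite {t. \<not> dim_at_most (common_kernel I (A t ` G)) b}"
proof -
  obtain K where K: "finite K" "card K \<le> b" "separates K (common_kernel I (A t0 ` G))"
    using s unfolding dim_at_most_def by blast
  show ?thesis
    by (rule finite_subset[OF _ separates_cofinite[OF I A K(3)]]) (use K in \<open>auto simp: dim_at_most_def\<close>)
qed

text \<open>An injective matrix has a left inverse. The elimination is the one of
\<open>trivial_kernel_cofinite\<close>; the coordinate functional at the pivot \<open>i\<close> is recovered from the pivot row \<open>f\<close> and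
the coordinate functionals found for the remaining unknowns.\<close>

lemma coordinate_in_span:
  fixes A :: "'g \<Rightarrow> 'i \<Rightarrow> complex"
  assumes "finite I" "finite G"
    and "\<And>v. (\<forall>g\<in>G. (\<Sum>i\<in>I. A g i * v i) = 0) \<Longrightarrow> \<forall>i\<in>I. v i = 0"
    and "e \<in> I"
  shows "\<exists>\<mu>. \<forall>i\<in>I. (\<Sum>g\<in>G. \<mu> g * A g i) = (if i = e then 1 else 0)"
  using assms(1,3,4)
proof (induction I arbitrary: A e)
  case empty
  then show ?case by simp
next
  case (insert i I)
  have "\<exists>f\<in>G. A f i \<noteq> 0"
  proof (rule ccontr)
    assume c: "\<not> ?thesis"
    have "\<forall>g\<in>G. (\<Sum>j\<in>insert i I. A g j * (if j = i then 1 else 0)) = 0"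
      using insert.hyps c by (auto intro!: sum.neutral)
    from insert.prems(1)[OF this] show False by simp
  qed
  then obtain f where f: "f \<in> G" "A f i \<noteq> 0" by blast
  \<comment> \<open>eliminate the unknown i from all functionals by means of f\<close>
  define B where "B g j = A g j - A g i / A f i * A f j" for g j
  have elim: "(\<Sum>j\<in>I. B g j * v j) =
      (\<Sum>j\<in>insert i I. A g j * v j) - A g i / A f i * (\<Sum>j\<in>insert i I. A f j * v j)" for g v
    using insert.hyps f(2) by (simp add: B_def sum_distrib_left algebra_simps sum_subtractf)
  have prem: "\<forall>j\<in>I. v j = 0" if v: "\<forall>g\<in>G. (\<Sum>j\<in>I. B g j * v j) = 0" for v
  proof -
    define u where "u = v(i := - (\<Sum>j\<in>I. A f j * v j) / A f i)"
    have uI: "(\<Sum>j\<in>I. h j * u j) = (\<Sum>j\<in>I. h j * v j)" for h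
      using insert.hyps by (intro sum.cong) (auto simp: u_def)
    have fu: "(\<Sum>j\<in>insert i I. A f j * u j) = 0"
      using insert.hyps f(2) by (simp add: uI) (simp add: u_def)
    have "\<forall>g\<in>G. (\<Sum>j\<in>insert i I. A g j * u j) = 0"
    proof
      fix g assume "g \<in> G"
      then show "(\<Sum>j\<in>insert i I. A g j * u j) = 0"
        using elim[of g u] v f(2) by (simp only: uI fu) simp
    qed
    from insert.prems(1)[OF this] have u0: "\<forall>j\<in>insert i I. u j = 0" .
    show "\<forall>j\<in>I. v j = 0"
    proof
      fix j assume "j \<in> I"
      then have "u j = 0" "j \<noteq> i" using u0 insert.hyps by auto
      then show "v j = 0" by (simp add: u_def)
    qed
  qed
  have comb: "(\<Sum>g\<in>G. (\<mu> g - (if g = f then (\<Sum>h\<in>G. \<mu> h * A h i) / A f i else 0)) * A g j) = (\<Sum>g\<in>G. \<mu> g * B g j)" for \<mu> j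
  proof -
    have "(\<Sum>g\<in>G. (\<mu> g - (if g = f then (\<Sum>h\<in>G. \<mu> h * A h i) / A f i else 0)) * A g j) =
      (\<Sum>g\<in>G. \<mu> g * A g j) - (\<Sum>g\<in>G. if g = f then (\<Sum>h\<in>G. \<mu> h * A h i) / A f i * A g j else 0)"
      unfolding sum_subtractf[symmetric] by (rule sum.cong) (auto simp: algebra_simps)
    also have "\<dots> = (\<Sum>g\<in>G. \<mu> g * A g j) - (\<Sum>h\<in>G. \<mu> h * A h i) / A f i * A f j"
      using assms(2) f(1) by simp
    also have "\<dots> = (\<Sum>g\<in>G. \<mu> g * B g j)"
      by (simp add: B_def algebra_simps sum_subtractf sum_divide_distrib sum_distrib_left)
    finally show ?thesis .
  qed
  have inI: "\<exists>\<mu>. \<forall>j\<in>insert i I. (\<Sum>g\<in>G. \<mu> g * A g j) = (if j = e then 1 else 0)" if e: "e \<in> I" for e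
  proof -
    obtain \<mu> where \<mu>: "\<forall>j\<in>I. (\<Sum>g\<in>G. \<mu> g * B g j) = (if j = e then 1 else 0)"
      using insert.IH[of B e] prem e by blast
    have "(\<Sum>g\<in>G. \<mu> g * B g i) = 0" using f(2) by (simp add: B_def)
    then have "\<forall>j\<in>insert i I. (\<Sum>g\<in>G. \<mu> g * B g j) = (if j = e then 1 else 0)"
      using \<mu> e insert.hyps(2) by auto
    then show ?thesis unfolding comb[symmetric]
      by (rule exI[of _ "\<lambda>g. \<mu> g - (if g = f then (\<Sum>h\<in>G. \<mu> h * A h i) / A f i else 0)"])
  qed
  show ?case
  proof (cases "e \<in> I")
    case True
    then show ?thesis by (rule inI)
  next
    case False
    then have e: "e = i" using insert.prems by blast
    from inI obtain M where M: "\<And>k j. k \<in> I \<Longrightarrow> j \<in> insert i I \<Longrightarrow> (\<Sum>g\<in>G. M k g * A g j) = (if j = k then 1 else 0)" by metis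
    define \<mu> where "\<mu> g = ((if g = f then 1 else 0) - (\<Sum>k\<in>I. A f k * M k g)) / A f i" for g
    have "(\<Sum>g\<in>G. \<mu> g * A g j) = (if j = e then 1 else 0)" if j: "j \<in> insert i I" for j
    proof -
      have "(\<Sum>g\<in>G. \<mu> g * A g j) = (\<Sum>g\<in>G. (if g = f then A g j else 0) / A f i - (\<Sum>k\<in>I. A f k * (M k g * A g j)) / A f i)"
        by (rule sum.cong) (auto simp: \<mu>_def algebra_simps diff_divide_distrib sum_distrib_left sum_distrib_right)
      also have "\<dots> = (\<Sum>g\<in>G. (if g = f then A g j else 0)) / A f i - (\<Sum>g\<in>G. \<Sum>k\<in>I. A f k * (M k g * A g j)) / A f i"
        by (simp add: sum_subtractf sum_divide_distrib)
      also have "(\<Sum>g\<in>G. (if g = f then A g j else 0)) = A f j" using assms(2) f(1) by simp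
      also have "(\<Sum>g\<in>G. \<Sum>k\<in>I. A f k * (M k g * A g j)) = (\<Sum>k\<in>I. A f k * (if j = k then 1 else 0))"
        by (subst sum.swap) (use j in \<open>auto simp: sum_distrib_left[symmetric] M intro!: sum.cong\<close>)
      also have "\<dots> = (if j \<in> I then A f j else 0)"
        using insert.hyps(1) by (simp add: if_distrib cong: if_cong)
      finally show ?thesis using j insert.hyps f(2) e by (auto simp: diff_divide_distrib)
    qed
    then show ?thesis by blast
  qed
qed

section \<open>Generic sets\<close>

definition on_line :: "('a \<Rightarrow> 'b \<Rightarrow> complex) \<Rightarrow> ('a \<Rightarrow> 'b \<Rightarrow> complex) \<Rightarrow> complex \<Rightarrow> 'a \<Rightarrow> 'b \<Rightarrow> complex" where
  "on_line x y t = (\<lambda>i k. x i k + t * y i k)"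

text \<open>A substitute for nonempty Zariski open sets that does not mention polynomials in many
variables: a nonempty set is generic if each line through one of its points leaves it at finitely many
parameters only. Such sets are closed under finite intersections, and an upper bound for the
dimension of a solution space defines such a set as soon as it holds somewhere.\<close>

definition line_generic :: "('a \<Rightarrow> 'b \<Rightarrow> complex) set \<Rightarrow> bool" where
  "line_generic U \<longleftrightarrow> U \<noteq> {} \<and> (\<forall>x\<in>U. \<forall>y. finite {t. on_line x y t \<notin> U})"

text \<open>On the line joining a point of \<open>U\<close> to a point of \<open>V\<close> all but finitely many points lie in both sets.\<close>

lemma line_generic_Int:
  assumes "line_generic U" "line_generic V"
  shows "line_generic (U \<inter> V)"
proof -
  obtain u v where uv: "u \<in> U" "v \<in> V" using assms by (auto simp: line_generic_def)
  define y where "y = (\<lambda>i k. v i k - u i k)"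
  have r: "on_line v (\<lambda>i k. - y i k) (1 - t) = on_line u y t" for t
    by (auto simp: on_line_def y_def algebra_simps)
  have "finite {t. on_line u y t \<notin> U}" using assms uv by (auto simp: line_generic_def)
  moreover have "finite {t. on_line u y t \<notin> V}"
  proof -
    have "finite {s. on_line v (\<lambda>i k. - y i k) s \<notin> V}" using assms uv by (auto simp: line_generic_def)
    then have "finite ((\<lambda>s. 1 - s) ` {s. on_line v (\<lambda>i k. - y i k) s \<notin> V})" by blast
    moreover have "{t. on_line u y t \<notin> V} \<subseteq> (\<lambda>s. 1 - s) ` {s. on_line v (\<lambda>i k. - y i k) s \<notin> V}"
    proof
      fix t assume "t \<in> {t. on_line u y t \<notin> V}"
      then have "1 - t \<in> {s. on_line v (\<lambda>i k. - y i k) s \<notin> V}" by (simp add: r)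
      then show "t \<in> (\<lambda>s. 1 - s) ` {s. on_line v (\<lambda>i k. - y i k) s \<notin> V}"
        by (rule rev_image_eqI) simp
    qed
    ultimately show ?thesis by (rule finite_subset[rotated])
  qed
  ultimately have "finite ({t. on_line u y t \<notin> U} \<union> {t. on_line u y t \<notin> V})" by simp
  then have "{t. on_line u y t \<notin> U} \<union> {t. on_line u y t \<notin> V} \<noteq> UNIV"
    using infinite_UNIV_char_0[where 'a=complex] by metis
  then have ne: "U \<inter> V \<noteq> {}" by blast
  moreover have "finite {t. on_line x z t \<notin> U \<inter> V}" if "x \<in> U \<inter> V" for x z
  proof -
    have "finite {t. on_line x z t \<notin> U}" "finite {t. on_line x z t \<notin> V}"
      using assms that by (auto simp: line_generic_def)
    moreover have "{t. on_line x z t \<notin> U \<inter> V} = {t. on_line x z t \<notin> U} \<union> {t. on_line x z t \<notin> V}" by blast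
    ultimately show ?thesis by simp
  qed
  ultimately show ?thesis by (simp add: line_generic_def)
qed

lemma line_generic_UNIV: "line_generic UNIV" by (simp add: line_generic_def)

lemma line_generic_INT:
  assumes "finite J" "\<And>j. j \<in> J \<Longrightarrow> line_generic (U j)"
  shows "line_generic (\<Inter>j\<in>J. U j)"
  using assms by (induction J) (auto intro: line_generic_Int line_generic_UNIV)

section \<open>Vanishing orders at a general point\<close>

text \<open>A space \<open>W\<close> spanned by \<open>r\<close> polynomials contains, for all but finitely many \<open>c\<close>, no nonzero
element vanishing to order \<open>r\<close> at \<open>c\<close>. Let \<open>B\<close> be one of the generators. The map sending \<open>p\<close> to
\<open>p' B - p B'\<close> kills \<open>B\<close> and so has an image spanned by \<open>r - 1\<close> polynomials, and it lowers vanishing orders by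
at most one. By induction \<open>p' B = p B'\<close> for general \<open>c\<close>, and comparing orders at a point \<open>c\<close> with
\<open>B(c) \<noteq> 0\<close> and \<open>p(c) = 0\<close> gives \<open>p = 0\<close>. This uses characteristic zero: differentiation lowers the order of
a zero by exactly one.\<close>

lemma divisible_combinations_finite:
  fixes b :: "nat \<Rightarrow> complex poly"
  shows "finite {c. \<exists>y. (\<Sum>k<r. smult (y k) (b k)) \<noteq> 0 \<and> [:-c, 1:] ^ r dvd (\<Sum>k<r. smult (y k) (b k))}"
proof (induction r arbitrary: b)
  case 0
  then show ?case by simp
next
  case (Suc r)
  show ?case
  proof (cases "b r = 0")
    case True
    have "[:-c, 1:] ^ r dvd p" if "[:-c, 1:] ^ Suc r dvd p" for c and p :: "complex poly"
      by (rule dvd_trans[OF le_imp_power_dvd that]) simp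
    then show ?thesis
      using True by (intro finite_subset[OF _ Suc.IH[of b]] Collect_mono) (simp only: sum.lessThan_Suc smult_0_right add_0_right, blast)
  next
    case False
    define B where "B = b r"
    define W where "W p = pderiv p * B - p * pderiv B" for p
    have Wsum: "W (\<Sum>k\<in>A. smult (y k) (b k)) = (\<Sum>k\<in>A. smult (y k) (W (b k)))" for y and A :: "nat set"
    proof -
      have add: "W (p + q) = W p + W q" for p q by (simp add: W_def pderiv_add algebra_simps)
      have smult: "W (smult c p) = smult c (W p)" for c p
        by (simp add: W_def pderiv_smult smult_diff_right)
      have zero: "W 0 = 0" by (simp add: W_def)
      show ?thesis by (induction A rule: infinite_finite_induct) (simp_all add: add smult zero)
    qed
    have WB: "W B = 0" by (simp add: W_def)
    have "{c. \<exists>y. (\<Sum>k<Suc r. smult (y k) (b k)) \<noteq> 0 \<and> [:-c, 1:] ^ Suc r dvd (\<Sum>k<Suc r. smult (y k) (b k))}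
      \<subseteq> {c. poly B c = 0} \<union> {c. \<exists>y. (\<Sum>k<r. smult (y k) (W (b k))) \<noteq> 0 \<and> [:-c, 1:] ^ r dvd (\<Sum>k<r. smult (y k) (W (b k)))}"
    proof (rule subsetI, rule UnCI)
      fix c assume "c \<in> {c. \<exists>y. (\<Sum>k<Suc r. smult (y k) (b k)) \<noteq> 0 \<and> [:-c, 1:] ^ Suc r dvd (\<Sum>k<Suc r. smult (y k) (b k))}"
      then obtain y where y: "(\<Sum>k<Suc r. smult (y k) (b k)) \<noteq> 0" "[:-c, 1:] ^ Suc r dvd (\<Sum>k<Suc r. smult (y k) (b k))" by blast
      assume n: "c \<notin> {c. \<exists>y. (\<Sum>k<r. smult (y k) (W (b k))) \<noteq> 0 \<and> [:-c, 1:] ^ r dvd (\<Sum>k<r. smult (y k) (W (b k)))}"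
      define p where "p = (\<Sum>k<Suc r. smult (y k) (b k))"
      have p: "p \<noteq> 0" "[:-c, 1:] ^ Suc r dvd p" using y by (auto simp: p_def)
      have Wp: "W p = (\<Sum>k<r. smult (y k) (W (b k)))" unfolding p_def Wsum using WB by (simp add: B_def)
      obtain q where q: "p = [:-c, 1:] ^ Suc r * q" using p(2) by blast
      have "pderiv p = [:-c,1:]^r * (smult (of_nat (Suc r)) q + [:-c,1:] * pderiv q)"
        unfolding q pderiv_mult pderiv_power_Suc by (simp add: algebra_simps pderiv_pCons)
      then have "[:-c,1:]^r dvd pderiv p" by simp
      moreover have "[:-c,1:]^r dvd p" by (rule dvd_trans[OF le_imp_power_dvd p(2)]) simp
      ultimately have "[:-c, 1:] ^ r dvd W p" by (simp add: W_def dvd_diff)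
      with n have "W p = 0" unfolding Wp by blast
      then have eq: "pderiv p * B = p * pderiv B" by (simp add: W_def)
      show "c \<in> {c. poly B c = 0}"
      proof (rule ccontr)
        assume "c \<notin> {c. poly B c = 0}"
        then have Bc: "poly B c \<noteq> 0" by simp
        have pc: "poly p c = 0" unfolding q by simp
        have "pderiv p \<noteq> 0"
        proof
          assume "pderiv p = 0"
          then have "degree p = 0" by (simp add: pderiv_eq_0_iff)
          then obtain a where "p = [:a:]" by (rule degree_eq_zeroE)
          then show False using pc p(1) by simp
        qed
        moreover have "B \<noteq> 0" using False by (simp add: B_def)
        ultimately have ne: "pderiv p * B \<noteq> 0" by simp
        have o1: "order c p = Suc (order c (pderiv p))"
          using p(1) pc by (intro order_pderiv) (auto simp: order_root)
        have "order c B = 0" using Bc by (simp add: order_0I)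
        then have "order c (pderiv p * B) = order c (pderiv p)" using ne by (simp add: order_mult)
        moreover have "order c (p * pderiv B) \<ge> order c p" using ne eq by (simp add: order_mult)
        ultimately show False using eq o1 by simp
      qed
    qed
    moreover have "finite {c. poly B c = 0}" using False by (simp add: poly_roots_finite B_def)
    ultimately show ?thesis using Suc.IH[of "\<lambda>k. W (b k)"] finite_subset by blast
  qed
qed

section \<open>Expansions of bivariate polynomials\<close>

definition monomials :: "nat \<Rightarrow> (nat \<times> nat) set" where
  "monomials d = {e. fst e + snd e \<le> d}"

lemma monomials_eq: "monomials d = (\<Union>k\<le>d. (\<lambda>r. (r, k - r)) ` {..k})"
  by (force simp: monomials_def)

lemma finite_monomials [simp, intro]: "finite (monomials d)"
  unfolding monomials_eq by blast

lemma sum_monomials: "(\<Sum>e\<in>monomials d. h e) = (\<Sum>k\<le>d. \<Sum>r\<le>k. h (r, k - r))"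
proof -
  have "(\<Sum>e\<in>monomials d. h e) = (\<Sum>k\<le>d. \<Sum>e\<in>(\<lambda>r. (r, k - r)) ` {..k}. h e)"
    unfolding monomials_eq by (rule sum.UNION_disjoint) auto
  also have "\<dots> = (\<Sum>k\<le>d. \<Sum>r\<le>k. h (r, k - r))"
    by (intro sum.cong refl) (simp add: sum.reindex inj_on_def)
  finally show ?thesis .
qed

text \<open>The coefficient of \<open>u^e\<^sub>1 w^e\<^sub>2\<close> in \<open>(a + u)^f\<^sub>1 (b + w)^f\<^sub>2\<close>. Truncated subtraction is harmless since the
binomial coefficient is zero whenever it occurs.\<close>

definition taylor :: "complex \<Rightarrow> complex \<Rightarrow> nat \<times> nat \<Rightarrow> nat \<times> nat \<Rightarrow> complex" where
  "taylor a b e f = of_nat (fst f choose fst e) * a ^ (fst f - fst e) *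
     (of_nat (snd f choose snd e) * b ^ (snd f - snd e))"

text \<open>A point is \<open>p = (p 0, p 1)\<close> together with a direction parameter \<open>p 2\<close>. The value is the coefficient
of \<open>u^e\<^sub>1 w^e\<^sub>2\<close> in \<open>(p 0 + u + p 2 w)^f\<^sub>1 (p 1 + w)^f\<^sub>2\<close>: local coordinates in which the line \<open>u = 0\<close> has
direction \<open>(p 2, 1)\<close>.\<close>

definition twisted :: "(nat \<Rightarrow> complex) \<Rightarrow> nat \<times> nat \<Rightarrow> nat \<times> nat \<Rightarrow> complex" where
  "twisted p e f = (\<Sum>r\<le>fst e + snd e. of_nat (r choose fst e) * p 2 ^ (r - fst e) *
     taylor (p 0) (p 1) (r, fst e + snd e - r) f)"

text \<open>Here \<open>v\<close> is the coefficient vector of a polynomial of degree at most \<open>d\<close>, and the result is a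
coefficient of its expansion in the twisted coordinates at \<open>p\<close>.\<close>

definition local_coeff :: "nat \<Rightarrow> (nat \<Rightarrow> complex) \<Rightarrow> nat \<times> nat \<Rightarrow> (nat \<times> nat \<Rightarrow> complex) \<Rightarrow> complex" where
  "local_coeff d p e v = (\<Sum>f\<in>monomials d. twisted p e f * v f)"

lemma taylor_eq_0: "fst f + snd f < fst e + snd e \<Longrightarrow> taylor a b e f = 0"
  by (cases "fst f < fst e") (auto simp: taylor_def binomial_eq_0)

lemma local_coeff_outside: "e \<notin> monomials d \<Longrightarrow> local_coeff d p e v = 0"
  by (auto simp: local_coeff_def twisted_def monomials_def taylor_eq_0 intro!: sum.neutral)

lemma twisted_untwisted: "p 2 = 0 \<Longrightarrow> twisted p e f = taylor (p 0) (p 1) e f"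
proof -
  assume p: "p 2 = 0"
  have "twisted p e f = (\<Sum>r\<le>fst e + snd e. if r = fst e then taylor (p 0) (p 1) (r, fst e + snd e - r) f else 0)"
    unfolding twisted_def by (rule sum.cong) (auto simp: p binomial_eq_0 power_0_left not_less)
  then show ?thesis by simp
qed

lemma poly_fun_twisted: "poly_fun (\<lambda>t. twisted (on_line x y t i) e f)"
  unfolding twisted_def taylor_def on_line_def
  by (intro poly_fun_sum poly_fun_mult poly_fun_power poly_fun_add poly_fun_const poly_fun_ident)

lemma taylor_expansion:
  assumes "f \<in> monomials d"
  shows "(a + u) ^ fst f * (b + w) ^ snd f = (\<Sum>e\<in>monomials d. taylor a b e f * (u ^ fst e * w ^ snd e))"
proof -
  have "(a + u) ^ fst f * (b + w) ^ snd f =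
      (\<Sum>r\<le>fst f. of_nat (fst f choose r) * u ^ r * a ^ (fst f - r)) *
      (\<Sum>s\<le>snd f. of_nat (snd f choose s) * w ^ s * b ^ (snd f - s))"
    by (simp add: binomial_ring[symmetric] add.commute)
  also have "\<dots> = (\<Sum>e\<in>{..fst f} \<times> {..snd f}. taylor a b e f * (u ^ fst e * w ^ snd e))"
    by (simp add: sum_product sum.cartesian_product taylor_def case_prod_beta mult_ac)
  also have "\<dots> = (\<Sum>e\<in>monomials d. taylor a b e f * (u ^ fst e * w ^ snd e))"
  proof (rule sum.mono_neutral_left)
    show "{..fst f} \<times> {..snd f} \<subseteq> monomials d" using assms by (auto simp: monomials_def)
    show "\<forall>e\<in>monomials d - {..fst f} \<times> {..snd f}. taylor a b e f * (u ^ fst e * w ^ snd e) = 0"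
      by (auto simp: taylor_def binomial_eq_0)
  qed simp
  finally show ?thesis .
qed

lemma binomial_expansion_le:
  assumes "r \<le> (k::nat)"
  shows "(u + c * w) ^ r * w ^ (k - r) = (\<Sum>\<alpha>\<le>k. of_nat (r choose \<alpha>) * c ^ (r - \<alpha>) * (u ^ \<alpha> * w ^ (k - \<alpha>)) :: complex)"
proof -
  have "(u + c * w) ^ r * w ^ (k - r) = (\<Sum>\<alpha>\<le>r. of_nat (r choose \<alpha>) * u ^ \<alpha> * (c * w) ^ (r - \<alpha>) * w ^ (k - r))"
    by (simp add: binomial_ring sum_distrib_right)
  also have "\<dots> = (\<Sum>\<alpha>\<le>r. of_nat (r choose \<alpha>) * c ^ (r - \<alpha>) * (u ^ \<alpha> * w ^ (k - \<alpha>)))"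
  proof (rule sum.cong[OF refl])
    fix \<alpha> assume "\<alpha> \<in> {..r}"
    then have "w ^ (k - \<alpha>) = w ^ (r - \<alpha>) * w ^ (k - r)" using assms by (simp add: power_add[symmetric])
    then show "of_nat (r choose \<alpha>) * u ^ \<alpha> * (c * w) ^ (r - \<alpha>) * w ^ (k - r) = of_nat (r choose \<alpha>) * c ^ (r - \<alpha>) * (u ^ \<alpha> * w ^ (k - \<alpha>))"
      by (simp add: power_mult_distrib mult_ac)
  qed
  also have "\<dots> = (\<Sum>\<alpha>\<le>k. of_nat (r choose \<alpha>) * c ^ (r - \<alpha>) * (u ^ \<alpha> * w ^ (k - \<alpha>)))"
    using assms by (intro sum.mono_neutral_left) (auto simp: binomial_eq_0)
  finally show ?thesis .
qed

lemma twisted_expansion_monomial: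
  assumes "f \<in> monomials d"
  shows "(p 0 + u + p 2 * w) ^ fst f * (p 1 + w) ^ snd f = (\<Sum>e\<in>monomials d. twisted p e f * (u ^ fst e * w ^ snd e))"
proof -
  let ?T = "\<lambda>r k. taylor (p 0) (p 1) (r, k - r) f"
  have "(p 0 + u + p 2 * w) ^ fst f * (p 1 + w) ^ snd f = (\<Sum>k\<le>d. \<Sum>r\<le>k. ?T r k * ((u + p 2 * w) ^ r * w ^ (k - r)))"
    using taylor_expansion[OF assms, of "p 0" "u + p 2 * w" "p 1" w] by (simp add: sum_monomials add.assoc)
  also have "\<dots> = (\<Sum>k\<le>d. \<Sum>r\<le>k. \<Sum>\<alpha>\<le>k. ?T r k * (of_nat (r choose \<alpha>) * p 2 ^ (r - \<alpha>) * (u ^ \<alpha> * w ^ (k - \<alpha>))))"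
    by (intro sum.cong refl) (subst binomial_expansion_le, simp, simp add: sum_distrib_left)
  also have "\<dots> = (\<Sum>k\<le>d. \<Sum>\<alpha>\<le>k. \<Sum>r\<le>k. ?T r k * (of_nat (r choose \<alpha>) * p 2 ^ (r - \<alpha>) * (u ^ \<alpha> * w ^ (k - \<alpha>))))"
    by (intro sum.cong refl sum.swap)
  also have "\<dots> = (\<Sum>k\<le>d. \<Sum>\<alpha>\<le>k. twisted p (\<alpha>, k - \<alpha>) f * (u ^ \<alpha> * w ^ (k - \<alpha>)))"
    by (intro sum.cong refl) (simp add: twisted_def sum_distrib_left sum_distrib_right mult_ac)
  also have "\<dots> = (\<Sum>e\<in>monomials d. twisted p e f * (u ^ fst e * w ^ snd e))"
    by (simp add: sum_monomials)
  finally show ?thesis .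
qed

lemma twisted_expansion:
  "(\<Sum>e\<in>monomials d. local_coeff d p e v * (u ^ fst e * w ^ snd e)) =
   (\<Sum>f\<in>monomials d. v f * ((p 0 + u + p 2 * w) ^ fst f * (p 1 + w) ^ snd f))"
proof -
  have "(\<Sum>e\<in>monomials d. local_coeff d p e v * (u ^ fst e * w ^ snd e)) =
      (\<Sum>e\<in>monomials d. \<Sum>f\<in>monomials d. v f * (twisted p e f * (u ^ fst e * w ^ snd e)))"
    by (simp add: local_coeff_def sum_distrib_left sum_distrib_right mult_ac)
  also have "\<dots> = (\<Sum>f\<in>monomials d. v f * (\<Sum>e\<in>monomials d. twisted p e f * (u ^ fst e * w ^ snd e)))"
    by (subst sum.swap) (simp add: sum_distrib_left)
  also have "\<dots> = (\<Sum>f\<in>monomials d. v f * ((p 0 + u + p 2 * w) ^ fst f * (p 1 + w) ^ snd f))"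
    by (intro sum.cong refl) (simp only: twisted_expansion_monomial)
  finally show ?thesis .
qed

text \<open>A polynomial function of two variables determines its coefficients, by applying the
univariate statement twice.\<close>

lemma bivariate_coeffs_eq_0:
  fixes g :: "nat \<times> nat \<Rightarrow> complex"
  assumes M: "finite M" and z: "\<And>u w. (\<Sum>e\<in>M. g e * (u ^ fst e * w ^ snd e)) = 0" and e: "e \<in> M"
  shows "g e = 0"
proof -
  have 1: "(\<Sum>f\<in>M. if fst f = fst e then g f * w ^ snd f else 0) = 0" for w
  proof -
    let ?P = "\<Sum>f\<in>M. monom (g f * w ^ snd f) (fst f)"
    have "poly ?P u = 0" for u
      using z[of u w] by (simp add: poly_sum poly_monom mult_ac)
    then have "?P = 0" by (simp add: poly_all_0_iff_0[symmetric])
    then have "coeff ?P (fst e) = 0" by simp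
    then show ?thesis by (simp add: coeff_sum)
  qed
  let ?P = "\<Sum>f\<in>M. monom (if fst f = fst e then g f else 0) (snd f)"
  have "poly ?P w = 0" for w
  proof -
    have "poly ?P w = (\<Sum>f\<in>M. if fst f = fst e then g f * w ^ snd f else 0)"
      unfolding poly_sum by (rule sum.cong) (auto simp: poly_monom)
    then show ?thesis using 1 by simp
  qed
  then have "?P = 0" by (simp add: poly_all_0_iff_0[symmetric])
  then have "coeff ?P (snd e) = 0" by simp
  moreover have "coeff ?P (snd e) = (\<Sum>f\<in>M. if f = e then g f else 0)"
    unfolding coeff_sum by (rule sum.cong) (auto simp: prod_eq_iff)
  ultimately show ?thesis using M e by simp
qed

text \<open>Expanding at \<open>p\<close> and then expanding the result at \<open>q\<close> is expanding at one point, because the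
two expansions are the same polynomial function.\<close>

lemma local_coeff_shift:
  assumes q: "q 2 = 0"
  shows "local_coeff d q e (\<lambda>f. local_coeff d p f v) =
    local_coeff d (\<lambda>k. if k = 0 then p 0 + q 0 + p 2 * q 1 else if k = 1 then p 1 + q 1 else p 2) e v"
    (is "_ = local_coeff d ?r e v")
proof (cases "e \<in> monomials d")
  case True
  define g where "g e = local_coeff d q e (\<lambda>f. local_coeff d p f v) - local_coeff d ?r e v" for e
  have "(\<Sum>e\<in>monomials d. g e * (u ^ fst e * w ^ snd e)) = 0" for u w
  proof -
    have "(\<Sum>e\<in>monomials d. local_coeff d q e (\<lambda>f. local_coeff d p f v) * (u ^ fst e * w ^ snd e)) =
      (\<Sum>f\<in>monomials d. local_coeff d p f v * ((q 0 + u) ^ fst f * (q 1 + w) ^ snd f))"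
      by (simp add: twisted_expansion q)
    also have "\<dots> = (\<Sum>f\<in>monomials d. v f * ((p 0 + (q 0 + u) + p 2 * (q 1 + w)) ^ fst f * (p 1 + (q 1 + w)) ^ snd f))"
      by (simp add: twisted_expansion)
    also have "\<dots> = (\<Sum>e\<in>monomials d. local_coeff d ?r e v * (u ^ fst e * w ^ snd e))"
      by (subst twisted_expansion) (simp add: algebra_simps)
    finally show ?thesis by (simp add: g_def algebra_simps sum_subtractf)
  qed
  from bivariate_coeffs_eq_0[OF finite_monomials this True] show ?thesis by (simp add: g_def)
next
  case False
  then show ?thesis by (simp add: local_coeff_outside)
qed

text \<open>The homogeneous part of degree \<open>k\<close> of the expansion at the point \<open>p\<close> in the untwisted
coordinates, dehomogenized by setting the second coordinate to \<open>1\<close>. It does not involve \<open>p 2\<close>; the twist by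
\<open>p 2\<close> becomes the translation of its variable by \<open>p 2\<close>.\<close>

definition local_form :: "nat \<Rightarrow> (nat \<Rightarrow> complex) \<Rightarrow> nat \<Rightarrow> (nat \<times> nat \<Rightarrow> complex) \<Rightarrow> complex poly" where
  "local_form d p k v = (\<Sum>r\<le>k. monom (\<Sum>f\<in>monomials d. taylor (p 0) (p 1) (r, k - r) f * v f) r)"

lemma pcompose_monom: "pcompose (monom a r) q = smult a (q ^ r)"
  by (induction r) (simp_all add: monom_0 monom_Suc pcompose_pCons mult_smult_right)

lemma coeff_monom_pcompose:
  fixes a c :: complex
  shows "coeff (pcompose (monom a r) [:c, 1:]) i = a * of_nat (r choose i) * c ^ (r - i)"
proof -
  have "pcompose (monom a r) [:c, 1:] = smult a ([:c, 1:] ^ r)"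
    by (simp add: pcompose_monom)
  moreover have "coeff ([:c, 1:] ^ r) i = of_nat (r choose i) * c ^ (r - i)"
  proof (cases "i \<le> r")
    case True
    then show ?thesis by (simp add: coeff_linear_poly_power)
  next
    case False
    then show ?thesis by (simp add: coeff_eq_0 degree_linear_power binomial_eq_0)
  qed
  ultimately show ?thesis by simp
qed

lemma coeff_local_form:
  assumes "i \<le> k"
  shows "coeff (pcompose (local_form d p k v) [:p 2, 1:]) i = local_coeff d p (i, k - i) v"
proof -
  have "local_coeff d p (i, k - i) v = (\<Sum>r\<le>k. \<Sum>f\<in>monomials d. of_nat (r choose i) * p 2 ^ (r - i) * (taylor (p 0) (p 1) (r, k - r) f * v f))"
    unfolding local_coeff_def twisted_def using assms
    by (subst sum.swap) (simp add: sum_distrib_left sum_distrib_right mult_ac)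
  then show ?thesis
    by (simp add: local_form_def pcompose_sum coeff_sum coeff_monom_pcompose sum_distrib_left sum_distrib_right mult_ac)
qed

lemma degree_local_form: "degree (local_form d p k v) \<le> k"
  unfolding local_form_def by (intro degree_sum_le) (auto intro: order.trans[OF degree_monom_le])

lemma local_form_cong: "p 0 = q 0 \<Longrightarrow> p 1 = q 1 \<Longrightarrow> local_form d p k v = local_form d q k v"
  by (simp add: local_form_def)

lemma local_form_sum:
  "local_form d p k (\<lambda>f. \<Sum>j\<in>J. y j * w j f) = (\<Sum>j\<in>J. smult (y j) (local_form d p k (w j)))"
proof (rule poly_eqI)
  fix n
  have c: "coeff (local_form d p k v) n = (if n \<le> k then \<Sum>f\<in>monomials d. taylor (p 0) (p 1) (n, k - n) f * v f else 0)" for v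
    by (simp add: local_form_def coeff_sum)
  show "coeff (local_form d p k (\<lambda>f. \<Sum>j\<in>J. y j * w j f)) n = coeff (\<Sum>j\<in>J. smult (y j) (local_form d p k (w j))) n"
    unfolding coeff_sum coeff_smult c
    by (simp add: sum_distrib_left sum_distrib_right sum.swap[of _ J] mult_ac)
qed

lemma local_form_eq_0_iff:
  "local_form d p k v = 0 \<longleftrightarrow> (\<forall>e. fst e + snd e = k \<longrightarrow> local_coeff d p e v = 0)"
proof
  assume z: "local_form d p k v = 0"
  show "\<forall>e. fst e + snd e = k \<longrightarrow> local_coeff d p e v = 0"
  proof (intro allI impI)
    fix e :: "nat \<times> nat" assume "fst e + snd e = k"
    then have "fst e \<le> k" "e = (fst e, k - fst e)" by (auto simp: prod_eq_iff)
    then show "local_coeff d p e v = 0" using coeff_local_form[of "fst e" k d p v] z by simp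
  qed
next
  assume z: "\<forall>e. fst e + snd e = k \<longrightarrow> local_coeff d p e v = 0"
  let ?q = "pcompose (local_form d p k v) [:p 2, 1:]"
  have "?q = 0"
  proof (rule poly_eqI)
    fix i show "coeff ?q i = coeff 0 i"
    proof (cases "i \<le> k")
      case True
      then show ?thesis using coeff_local_form[OF True, of d p v] z by simp
    next
      case False
      have "degree ?q \<le> k" using degree_local_form[of d p k v] by (simp add: degree_pcompose)
      then show ?thesis using False by (simp add: coeff_eq_0)
    qed
  qed
  then show "local_form d p k v = 0" by (simp add: pcompose_eq_0_iff)
qed

lemma dvd_if_shifted_coeffs_0:
  assumes "\<And>i. i < t \<Longrightarrow> coeff (pcompose q [:c, 1:]) i = (0::complex)"
  shows "[:- c, 1:] ^ t dvd q"
proof -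
  have "monom 1 t dvd pcompose q [:c, 1:]" using assms by (simp add: monom_1_dvd_iff')
  then obtain s where s: "pcompose q [:c, 1:] = monom 1 t * s" by blast
  have "q = pcompose (pcompose q [:c, 1:]) [:- c, 1:]"
    by (simp add: pcompose_assoc[symmetric] pcompose_pCons)
  also have "\<dots> = [:- c, 1:] ^ t * pcompose s [:- c, 1:]"
    unfolding s by (simp add: pcompose_mult pcompose_monom)
  finally show ?thesis by simp
qed

text \<open>Thus divisibility of the form by a power of the linear form attached to the parameter \<open>p 2\<close> is
the vanishing of its first twisted coefficients.\<close>

lemma local_form_dvd:
  assumes "t \<le> k" and z: "\<And>i. i < t \<Longrightarrow> local_coeff d p (i, k - i) v = 0"
  shows "[:- p 2, 1:] ^ t dvd local_form d p k v"
proof (rule dvd_if_shifted_coeffs_0)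
  fix i assume "i < t"
  then show "coeff (pcompose (local_form d p k v) [:p 2, 1:]) i = 0"
    using assms coeff_local_form[of i k d p v] by simp
qed

section \<open>General points with stairs\<close>

text \<open>The indices of the Taylor coefficients whose vanishing is multiplicity at least \<open>m\<close>.\<close>

definition fat :: "nat \<Rightarrow> (nat \<times> nat) set" where
  "fat m = {e. fst e + snd e < m}"

text \<open>In the twisted coordinates at a point, vanishing of these coefficients means multiplicity \<open>D\<close> and a
form of degree \<open>D\<close> divisible by \<open>u^t\<close>. These conditions interpolate between multiplicity \<open>D\<close> (\<open>t = 0\<close>) and
multiplicity \<open>D + 1\<close> (\<open>t = D + 1\<close>).\<close>

definition stair :: "nat \<Rightarrow> nat \<Rightarrow> (nat \<times> nat) set" where
  "stair D t = {e. fst e + snd e < D \<or> fst e + snd e = D \<and> fst e < t}"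

lemma finite_stair [simp, intro]: "finite (stair D t)"
  by (rule finite_subset[OF _ finite_monomials[of D]]) (auto simp: stair_def monomials_def)

lemma fat_Suc: "fat (Suc D) = stair D (Suc D)"
  by (auto simp: fat_def stair_def)

lemma stair_0: "stair D 0 = fat D"
  by (auto simp: fat_def stair_def)

lemma finite_fat [simp, intro]: "finite (fat m)"
  unfolding stair_0[symmetric] by blast

lemma card_stair: "t \<le> Suc D \<Longrightarrow> card (stair D t) = card (fat D) + t"
proof -
  assume t: "t \<le> Suc D"
  have "stair D t = fat D \<union> (\<lambda>i. (i, D - i)) ` {..<t}"
    using t by (force simp: stair_def fat_def)
  moreover have "card (fat D \<union> (\<lambda>i. (i, D - i)) ` {..<t}) = card (fat D) + card ((\<lambda>i. (i, D - i)) ` {..<t})"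
    by (intro card_Un_disjoint finite_fat) (use t in \<open>auto simp: fat_def\<close>)
  ultimately show ?thesis by (simp add: card_image inj_on_def)
qed

lemma card_fat_Suc: "card (fat (Suc D)) = card (fat D) + Suc D"
  by (simp add: fat_Suc card_stair)

lemma card_fat: "2 * card (fat m) = m * (m + 1)"
proof (induction m)
  case 0
  then show ?case by (simp add: fat_def)
next
  case (Suc m)
  then show ?case by (simp add: card_fat_Suc)
qed

text \<open>The polynomials of degree at most \<open>d\<close> whose coefficients indexed by \<open>T i\<close> at the \<open>i\<close>-th point vanish,
for all \<open>i < n\<close>.\<close>

definition solutions :: "nat \<Rightarrow> nat \<Rightarrow> (nat \<Rightarrow> (nat \<times> nat) set) \<Rightarrow> (nat \<Rightarrow> nat \<Rightarrow> complex) \<Rightarrow> (nat \<times> nat \<Rightarrow> complex) set" where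
  "solutions d n T x = common_kernel (monomials d) ((\<lambda>(i, e). twisted (x i) e) ` (SIGMA i:{..<n}. T i))"

lemma mem_solutions:
  "v \<in> solutions d n T x \<longleftrightarrow> (\<forall>f. f \<notin> monomials d \<longrightarrow> v f = 0) \<and> (\<forall>i<n. \<forall>e\<in>T i. local_coeff d (x i) e v = 0)"
  by (auto simp: solutions_def common_kernel_def local_coeff_def)

text \<open>Along a line the conditions depend polynomially on the parameter.\<close>

lemma line_generic_dim_at_most:
  assumes "dim_at_most (solutions d n T x) b"
  shows "line_generic {x. dim_at_most (solutions d n T x) b}"
  unfolding line_generic_def
proof (intro conjI ballI allI)
  show "{x. dim_at_most (solutions d n T x) b} \<noteq> {}" using assms by blast
  fix x y :: "nat \<Rightarrow> nat \<Rightarrow> complex" assume "x \<in> {x. dim_at_most (solutions d n T x) b}"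
  then have "dim_at_most (common_kernel (monomials d) ((\<lambda>g. twisted (on_line x y 0 (fst g)) (snd g)) ` (SIGMA i:{..<n}. T i))) b"
    by (simp add: solutions_def on_line_def case_prod_beta')
  from dim_at_most_cofinite[where A="\<lambda>t g. twisted (on_line x y t (fst g)) (snd g)" and G="SIGMA i:{..<n}. T i" and ?t0.0=0,
      OF finite_monomials poly_fun_twisted this]
  have "finite {t. \<not> dim_at_most (common_kernel (monomials d) ((\<lambda>g. twisted (on_line x y t (fst g)) (snd g)) ` (SIGMA i:{..<n}. T i))) b}"
    .
  then show "finite {t. on_line x y t \<notin> {x. dim_at_most (solutions d n T x) b}}"
    by (simp add: solutions_def case_prod_beta')
qed

lemma solutions_permute:
  assumes "bij_betw \<sigma> {..<n} {..<n}"
  shows "solutions d n (\<lambda>i. T (\<sigma> i)) (\<lambda>i. x (\<sigma> i)) = solutions d n T x"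
proof -
  have "(\<forall>i<n. P (\<sigma> i)) \<longleftrightarrow> (\<forall>i<n. P i)" for P
    using assms unfolding bij_betw_def by (metis (no_types, lifting) image_iff lessThan_iff)
  from this[of "\<lambda>i. \<forall>e\<in>T i. local_coeff d (x i) e v = 0" for v]
  show ?thesis unfolding set_eq_iff mem_solutions by blast
qed

lemma bij_betw_subsets:
  assumes "finite N" "J \<subseteq> N" "J' \<subseteq> N" "card J = card J'"
  shows "\<exists>\<sigma>. bij_betw \<sigma> N N \<and> (\<forall>i\<in>N. \<sigma> i \<in> J \<longleftrightarrow> i \<in> J')"
proof -
  have fin: "finite J" "finite J'" using assms finite_subset by blast+
  obtain g where g: "bij_betw g J' J" using finite_same_card_bij[OF fin(2,1)] assms(4) by auto
  have "card (N - J') = card (N - J)" using assms fin by (simp add: card_Diff_subset)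
  then obtain h where h: "bij_betw h (N - J') (N - J)"
    using finite_same_card_bij[of "N - J'" "N - J"] assms(1) by blast
  define s where "s i = (if i \<in> J' then g i else h i)" for i
  have "bij_betw s J' J \<longleftrightarrow> bij_betw g J' J" "bij_betw s (N - J') (N - J) \<longleftrightarrow> bij_betw h (N - J') (N - J)"
    by (intro bij_betw_cong; simp add: s_def)+
  then have "bij_betw s J' J" "bij_betw s (N - J') (N - J)"
    using g h by simp_all
  moreover from this have "bij_betw s (J' \<union> (N - J')) (J \<union> (N - J))"
    by (rule bij_betw_combine) blast
  then have "bij_betw s N N" using assms by (simp add: Un_absorb1)
  ultimately show ?thesis by (intro exI[of _ s]) (auto simp: bij_betw_def)
qed

lemma divisible_combinations_finite_set:
  fixes b :: "'k \<Rightarrow> complex poly"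
  assumes "finite R"
  shows "finite {c. \<exists>y. (\<Sum>k\<in>R. smult (y k) (b k)) \<noteq> 0 \<and> [:-c, 1:] ^ card R dvd (\<Sum>k\<in>R. smult (y k) (b k))}"
proof -
  obtain h where h: "bij_betw h {..<card R} R"
    using ex_bij_betw_nat_finite[OF assms] by (auto simp: atLeast0LessThan)
  have "(\<Sum>k\<in>R. smult (y k) (b k)) = (\<Sum>i<card R. smult (y (h i)) (b (h i)))" for y
    by (rule sum.reindex_bij_betw[OF h, symmetric])
  then show ?thesis
    by (intro finite_subset[OF _ divisible_combinations_finite[of "\<lambda>i. b (h i)" "card R"]] Collect_mono) metis
qed

text \<open>Multiplicity \<open>D + 1\<close> at the points of \<open>M\<close>, a stair at the other points of \<open>J\<close>, and multiplicity \<open>D\<close>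
at all remaining points.\<close>

definition mixed_conditions :: "nat \<Rightarrow> nat \<Rightarrow> nat set \<Rightarrow> nat set \<Rightarrow> nat \<Rightarrow> (nat \<times> nat) set" where
  "mixed_conditions D t J M i = (if i \<in> M then fat (Suc D) else if i \<in> J then stair D t else fat D)"

lemma fat_conditions_iff:
  "(\<forall>e\<in>fat m. local_coeff d p e v = 0) \<longleftrightarrow> (\<forall>k<m. local_form d p k v = 0)"
  by (auto simp: fat_def local_form_eq_0_iff)

lemma fat_conditions_cong:
  assumes "p 0 = q 0" "p 1 = q 1"
  shows "(\<forall>e\<in>fat m. local_coeff d p e v = 0) \<longleftrightarrow> (\<forall>e\<in>fat m. local_coeff d q e v = 0)"
  unfolding fat_conditions_iff using local_form_cong[OF assms] by simp

lemma smult_sum_right: "smult a (\<Sum>i\<in>S. f i) = (\<Sum>i\<in>S. smult a (f i))"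
  by (induction S rule: infinite_finite_induct) (simp_all add: smult_add_right)

lemma maximal_independent_family:
  fixes \<phi> :: "'k \<Rightarrow> complex poly"
  assumes "finite K"
  shows "\<exists>R\<subseteq>K. (\<forall>y. (\<Sum>k\<in>R. smult (y k) (\<phi> k)) = 0 \<longrightarrow> (\<forall>k\<in>R. y k = 0)) \<and>
    (\<forall>y. \<exists>z. (\<Sum>k\<in>K. smult (y k) (\<phi> k)) = (\<Sum>k\<in>R. smult (z k) (\<phi> k)))"
proof -
  define indep where "indep R \<longleftrightarrow> (\<forall>y. (\<Sum>k\<in>R. smult (y k) (\<phi> k)) = 0 \<longrightarrow> (\<forall>k\<in>R. y k = 0))" for R
  have "\<exists>R. (R \<subseteq> K \<and> indep R) \<and> (\<forall>R'. R' \<subseteq> K \<and> indep R' \<longrightarrow> card R' \<le> card R)"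
    by (rule ex_has_greatest_nat[where k="{}" and b="Suc (card K)"])
      (use assms in \<open>auto simp: indep_def less_Suc_eq_le card_mono\<close>)
  then obtain R where R: "R \<subseteq> K" "indep R" and max: "\<And>R'. R' \<subseteq> K \<Longrightarrow> indep R' \<Longrightarrow> card R' \<le> card R"
    by blast
  have fR: "finite R" using R(1) assms finite_subset by blast
  have span: "\<exists>z. \<phi> k = (\<Sum>l\<in>R. smult (z l) (\<phi> l))" if k: "k \<in> K" for k
  proof (cases "k \<in> R")
    case True
    have "(\<Sum>l\<in>R. smult (if l = k then 1 else 0) (\<phi> l)) = (\<Sum>l\<in>R. if l = k then \<phi> l else 0)"
      by (rule sum.cong) auto
    then show ?thesis using True fR by (intro exI[of _ "\<lambda>l. if l = k then 1 else 0"]) simp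
  next
    case False
    have "card (insert k R) > card R" using False fR by simp
    then have "\<not> indep (insert k R)" using max[of "insert k R"] R(1) k by auto
    then obtain y l where y: "(\<Sum>k\<in>insert k R. smult (y k) (\<phi> k)) = 0" "l \<in> insert k R" "y l \<noteq> 0"
      unfolding indep_def by blast
    have s: "smult (y k) (\<phi> k) + (\<Sum>l\<in>R. smult (y l) (\<phi> l)) = 0" using y(1) False fR by simp
    have "y k \<noteq> 0"
    proof
      assume yk: "y k = 0"
      then have "(\<Sum>l\<in>R. smult (y l) (\<phi> l)) = 0" using s by simp
      then have "\<forall>l\<in>R. y l = 0" using R(2) unfolding indep_def by blast
      then show False using y(2,3) yk by auto
    qed
    have "smult (y k) (\<phi> k) = - (\<Sum>l\<in>R. smult (y l) (\<phi> l))" using s by (simp add: eq_neg_iff_add_eq_0)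
    then have "smult (1 / y k) (smult (y k) (\<phi> k)) = smult (1 / y k) (- (\<Sum>l\<in>R. smult (y l) (\<phi> l)))" by simp
    then have "\<phi> k = (\<Sum>l\<in>R. smult (- y l / y k) (\<phi> l))"
      using \<open>y k \<noteq> 0\<close> by (simp add: smult_sum_right sum_negf)
    then show ?thesis by (rule exI[of _ "\<lambda>l. - y l / y k"])
  qed
  then obtain Z where Z: "\<And>k. k \<in> K \<Longrightarrow> \<phi> k = (\<Sum>l\<in>R. smult (Z k l) (\<phi> l))" by metis
  have "(\<Sum>k\<in>K. smult (y k) (\<phi> k)) = (\<Sum>l\<in>R. smult (\<Sum>k\<in>K. y k * Z k l) (\<phi> l))" for y
  proof -
    have "(\<Sum>k\<in>K. smult (y k) (\<phi> k)) = (\<Sum>k\<in>K. smult (y k) (\<Sum>l\<in>R. smult (Z k l) (\<phi> l)))"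
      by (intro sum.cong refl arg_cong2[of _ _ _ _ smult] Z)
    also have "\<dots> = (\<Sum>l\<in>R. \<Sum>k\<in>K. smult (y k * Z k l) (\<phi> l))"
      by (subst sum.swap) (simp add: smult_sum_right)
    also have "\<dots> = (\<Sum>l\<in>R. smult (\<Sum>k\<in>K. y k * Z k l) (\<phi> l))"
      by (intro sum.cong refl) (simp add: smult_sum)
    finally show ?thesis .
  qed
  then have "\<exists>z. (\<Sum>k\<in>K. smult (y k) (\<phi> k)) = (\<Sum>k\<in>R. smult (z k) (\<phi> k))" for y
    by (rule exI[of _ "\<lambda>l. \<Sum>k\<in>K. y k * Z k l"])
  then show ?thesis using R by (intro exI[of _ R]) (simp add: indep_def)
qed

text \<open>Passing from multiplicity \<open>D\<close> to a stair at the \<open>j\<close>-th point, with a general direction \<open>c\<close>, either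
costs the full \<open>t\<close> dimensions or forces multiplicity \<open>D + 1\<close> there. The forms of degree \<open>D\<close> at that
point of the solutions make up a space of some dimension \<open>r\<close>, the size of a maximal independent family \<open>R\<close>. If
\<open>r \<ge> t\<close>, then no nonzero form in the span of \<open>t\<close> members of \<open>R\<close> is divisible by the \<open>t\<close>-th power of a general
linear form, and the \<open>t\<close> corresponding coordinates become superfluous. If \<open>r < t\<close>, then zero is the
only form in the whole space with that divisibility.\<close>

lemma stair_dichotomy:
  assumes J: "j < n" "j \<notin> J" and t: "t \<le> D" and dim: "dim_at_most (solutions d n (mixed_conditions D t J {}) x) b"
  defines "y \<equiv> \<lambda>c. x(j := (x j)(2 := c))"
  shows "finite {c. \<not> (dim_at_most (solutions d n (mixed_conditions D t (insert j J) {}) (y c)) (b - t) \<or>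
     solutions d n (mixed_conditions D t (insert j J) {}) (y c) \<subseteq> solutions d n (mixed_conditions D t (insert j J) {j}) (y c))}"
proof -
  let ?W = "solutions d n (mixed_conditions D t J {}) x"
  let ?S = "\<lambda>c. solutions d n (mixed_conditions D t (insert j J) {}) (y c)"
  obtain K0 where K0: "finite K0" "card K0 \<le> b" "separates K0 ?W" using dim unfolding dim_at_most_def by blast
  have linW: "lin_subspace ?W" unfolding solutions_def by (rule lin_subspace_common_kernel)
  from dual_basis[OF linW K0(1,3)] obtain K w where K: "K \<subseteq> K0" "separates K ?W" "\<forall>k\<in>K. w k \<in> ?W"
    "\<forall>v\<in>?W. \<forall>i. v i = (\<Sum>k\<in>K. v k * w k i)" by blast
  have fK: "finite K" using K(1) K0(1) finite_subset by blast
  have cK: "card K \<le> b" using K(1) K0 card_mono by (meson le_trans)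
  define \<phi> where "\<phi> k = local_form d (x j) D (w k)" for k
  have form: "local_form d (x j) D v = (\<Sum>k\<in>K. smult (v k) (\<phi> k))" if "v \<in> ?W" for v
  proof -
    have "(\<lambda>f. \<Sum>k\<in>K. v k * w k f) = v" by (rule ext) (use K(4) that in metis)
    then show ?thesis using local_form_sum[where d=d and p="x j" and k=D and J=K and y=v and w=w] by (simp add: \<phi>_def)
  qed
  have yj: "y c i = (if i = j then (x j)(2 := c) else x i)" for c i by (simp add: y_def)
  have lf: "local_form d (y c j) k v = local_form d (x j) k v" for c k v
    by (rule local_form_cong) (simp_all add: yj)
  have SW: "v \<in> ?W" if v: "v \<in> ?S c" for v c
    unfolding mem_solutions
  proof (intro conjI allI impI ballI)
    fix f assume "f \<notin> monomials d" then show "v f = 0" using v unfolding mem_solutions by blast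
  next
    fix i e assume i: "i < n" "e \<in> mixed_conditions D t J {} i"
    show "local_coeff d (x i) e v = 0"
    proof (cases "i = j")
      case True
      have "\<forall>e\<in>stair D t. local_coeff d (y c j) e v = 0" using v J(1) by (auto simp: mem_solutions mixed_conditions_def)
      then have "\<forall>e\<in>fat D. local_coeff d (y c j) e v = 0" by (auto simp: stair_def fat_def)
      then have "\<forall>e\<in>fat D. local_coeff d (x j) e v = 0" using lf by (simp add: fat_conditions_iff)
      then show ?thesis using i J True by (simp add: mixed_conditions_def)
    next
      case False
      then show ?thesis using v i by (auto simp: mem_solutions mixed_conditions_def yj split: if_splits)
    qed
  qed
  have Sdvd: "[:- c, 1:] ^ t dvd local_form d (x j) D v" if v: "v \<in> ?S c" for v c
  proof -
    have "[:- y c j 2, 1:] ^ t dvd local_form d (y c j) D v"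
      by (rule local_form_dvd[OF t]) (use v J(1) t in \<open>auto simp: mem_solutions mixed_conditions_def stair_def\<close>)
    then show ?thesis by (simp add: lf) (simp add: yj)
  qed
  have SC: "v \<in> solutions d n (mixed_conditions D t (insert j J) {j}) (y c)" if v: "v \<in> ?S c" and z: "local_form d (x j) D v = 0" for v c
    unfolding mem_solutions
  proof (intro conjI allI impI ballI)
    fix f assume "f \<notin> monomials d" then show "v f = 0" using v unfolding mem_solutions by blast
  next
    fix i e assume i: "i < n" "e \<in> mixed_conditions D t (insert j J) {j} i"
    show "local_coeff d (y c i) e v = 0"
    proof (cases "i = j")
      case True
      have "\<forall>e\<in>stair D t. local_coeff d (y c j) e v = 0" using v J(1) by (auto simp: mem_solutions mixed_conditions_def)
      then have "\<forall>e\<in>fat D. local_coeff d (y c j) e v = 0" by (auto simp: stair_def fat_def)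
      then have "\<forall>e\<in>fat (Suc D). local_coeff d (y c j) e v = 0"
        using z by (auto simp: fat_conditions_iff lf less_Suc_eq)
      then show ?thesis using i True by (simp add: mixed_conditions_def)
    next
      case False
      then show ?thesis using v i by (auto simp: mem_solutions mixed_conditions_def)
    qed
  qed
  from maximal_independent_family[OF fK, of \<phi>] obtain R where R: "R \<subseteq> K"
    "\<forall>y. (\<Sum>k\<in>R. smult (y k) (\<phi> k)) = 0 \<longrightarrow> (\<forall>k\<in>R. y k = 0)"
    "\<forall>y. \<exists>z. (\<Sum>k\<in>K. smult (y k) (\<phi> k)) = (\<Sum>k\<in>R. smult (z k) (\<phi> k))"
    by blast
  have fR: "finite R" using R(1) fK finite_subset by blast
  show ?thesis
  proof (cases "t \<le> card R")
    case True
    then obtain Q where Q: "Q \<subseteq> R" "card Q = t" "finite Q" by (meson obtain_subset_with_card_n)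
    have "{c. \<not> (dim_at_most (?S c) (b - t) \<or> ?S c \<subseteq> solutions d n (mixed_conditions D t (insert j J) {j}) (y c))}
        \<subseteq> {c. \<exists>y. (\<Sum>k\<in>Q. smult (y k) (\<phi> k)) \<noteq> 0 \<and> [:-c, 1:] ^ card Q dvd (\<Sum>k\<in>Q. smult (y k) (\<phi> k))}"
    proof (rule subsetI, rule ccontr)
      fix c assume c: "c \<in> {c. \<not> (dim_at_most (?S c) (b - t) \<or> ?S c \<subseteq> solutions d n (mixed_conditions D t (insert j J) {j}) (y c))}"
        and n: "c \<notin> {c. \<exists>y. (\<Sum>k\<in>Q. smult (y k) (\<phi> k)) \<noteq> 0 \<and> [:-c, 1:] ^ card Q dvd (\<Sum>k\<in>Q. smult (y k) (\<phi> k))}"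
      have "separates (K - Q) (?S c)"
        unfolding separates_def
      proof (rule ballI, rule impI)
        fix v assume v: "v \<in> ?S c" and v0: "\<forall>k\<in>K - Q. v k = 0"
        have QK: "Q \<subseteq> K" using Q R by blast
        have eq: "local_form d (x j) D v = (\<Sum>k\<in>Q. smult (v k) (\<phi> k))"
          unfolding form[OF SW[OF v]] by (rule sum.mono_neutral_right) (use fK QK v0 in auto)
        have "[:-c, 1:] ^ card Q dvd (\<Sum>k\<in>Q. smult (v k) (\<phi> k))"
          using Sdvd[OF v] by (simp only: eq Q)
        then have z: "(\<Sum>k\<in>Q. smult (v k) (\<phi> k)) = 0" using n by blast
        have "(\<Sum>k\<in>R. smult (if k \<in> Q then v k else 0) (\<phi> k)) = (\<Sum>k\<in>Q. smult (v k) (\<phi> k))"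
          by (rule sum.mono_neutral_cong_right) (use fR Q in auto)
        then have "(\<Sum>k\<in>R. smult (if k \<in> Q then v k else 0) (\<phi> k)) = 0" using z by simp
        with spec[OF R(2), of "\<lambda>k. if k \<in> Q then v k else 0"]
        have "\<forall>k\<in>R. (if k \<in> Q then v k else 0) = 0" by (rule mp)
        from this have "v k = 0" if "k \<in> Q" for k using Q(1) that by (metis subsetD)
        then have "v k = 0" if "k \<in> K" for k using v0 that by blast
        then show "\<forall>i. v i = 0" using K(2) SW[OF v] unfolding separates_def by blast
      qed
      moreover have "card (K - Q) \<le> b - t"
        using cK Q R(1) fK by (simp add: card_Diff_subset subset_trans[OF Q(1) R(1)])
      ultimately have "dim_at_most (?S c) (b - t)" unfolding dim_at_most_def
        by (intro exI[of _ "K - Q"] conjI) (use fK in simp_all)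
      then show False using c by blast
    qed
    then show ?thesis by (rule finite_subset[OF _ divisible_combinations_finite_set[OF Q(3)]])
  next
    case False
    have "{c. \<not> (dim_at_most (?S c) (b - t) \<or> ?S c \<subseteq> solutions d n (mixed_conditions D t (insert j J) {j}) (y c))}
        \<subseteq> {c. \<exists>y. (\<Sum>k\<in>R. smult (y k) (\<phi> k)) \<noteq> 0 \<and> [:-c, 1:] ^ card R dvd (\<Sum>k\<in>R. smult (y k) (\<phi> k))}"
    proof (rule subsetI, rule ccontr)
      fix c assume c: "c \<in> {c. \<not> (dim_at_most (?S c) (b - t) \<or> ?S c \<subseteq> solutions d n (mixed_conditions D t (insert j J) {j}) (y c))}"
        and n: "c \<notin> {c. \<exists>y. (\<Sum>k\<in>R. smult (y k) (\<phi> k)) \<noteq> 0 \<and> [:-c, 1:] ^ card R dvd (\<Sum>k\<in>R. smult (y k) (\<phi> k))}"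
      have "v \<in> solutions d n (mixed_conditions D t (insert j J) {j}) (y c)" if v: "v \<in> ?S c" for v
      proof (rule SC[OF v])
        obtain z where z: "local_form d (x j) D v = (\<Sum>k\<in>R. smult (z k) (\<phi> k))"
          using spec[OF R(3), of v] form[OF SW[OF v]] by auto
        have "[:- c, 1:] ^ card R dvd local_form d (x j) D v"
          by (rule dvd_trans[OF le_imp_power_dvd Sdvd[OF v]]) (use False in simp)
        then show "local_form d (x j) D v = 0" unfolding z using n by blast
      qed
      then show False using c by blast
    qed
    then show ?thesis by (rule finite_subset[OF _ divisible_combinations_finite_set[OF fR]])
  qed
qed


lemma solutions_cong:
  assumes "\<And>i. i < n \<Longrightarrow> T i = T' i"
  shows "solutions d n T x = solutions d n T' x"
proof -
  have "(SIGMA i:{..<n}. T i) = (SIGMA i:{..<n}. T' i)" using assms by auto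
  then show ?thesis by (simp add: solutions_def)
qed

lemma solutions_antimono: "(\<And>i. i < n \<Longrightarrow> T i \<subseteq> T' i) \<Longrightarrow> solutions d n T' x \<subseteq> solutions d n T x"
  unfolding subset_iff mem_solutions by blast

lemma dim_at_most_solutions: "dim_at_most (solutions d n T x) (card (monomials d))"
proof -
  have "separates (monomials d) (solutions d n T x)" by (auto simp: separates_def solutions_def common_kernel_def)
  then show ?thesis using finite_monomials unfolding dim_at_most_def by blast
qed

lemma fat_subset_stair: "fat D \<subseteq> stair D t"
  by (auto simp: fat_def stair_def)

lemma stair_subset_fat: "stair D t \<subseteq> fat (Suc D)"
  by (auto simp: fat_def stair_def)

text \<open>Existence of points that impose as many conditions as possible. The truncated subtraction covers
the case in which there are more conditions than monomials and the solutions are zero.\<close>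

definition max_rank :: "nat \<Rightarrow> bool" where
  "max_rank n \<longleftrightarrow> (\<forall>d m. \<exists>x. dim_at_most (solutions d n (\<lambda>_. fat m) x) (card (monomials d) - n * card (fat m)))"

lemma stair_rank_if_independent:
  assumes x: "dim_at_most (solutions d n (\<lambda>_. fat (Suc D)) x) (card (monomials d) - n * card (fat (Suc D)))"
    and le: "n * card (fat (Suc D)) \<le> card (monomials d)"
  shows "dim_at_most (solutions d n (\<lambda>_. stair D t) x) (card (monomials d) - n * card (stair D t))"
proof -
  let ?r = "\<lambda>(i, e). twisted (x i) e"
  let ?F = "?r ` (SIGMA i:{..<n}. fat (Suc D) - stair D t)"
  have un: "(SIGMA i:{..<n}. fat (Suc D)) = (SIGMA i:{..<n}. stair D t) \<union> (SIGMA i:{..<n}. fat (Suc D) - stair D t)"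
    using stair_subset_fat[of D t] by blast
  have "dim_at_most (common_kernel (monomials d) (?r ` (SIGMA i:{..<n}. stair D t) \<union> ?F)) (card (monomials d) - n * card (fat (Suc D)))"
    using x unfolding solutions_def un image_Un .
  moreover have fin: "finite ?F" by blast
  ultimately have d: "dim_at_most (solutions d n (\<lambda>_. stair D t) x) (card (monomials d) - n * card (fat (Suc D)) + card ?F)"
    unfolding solutions_def using dim_at_most_drop_conditions[OF finite_monomials] by blast
  have "card ?F \<le> card (SIGMA i:{..<n}. fat (Suc D) - stair D t)" by (rule card_image_le) blast
  also have "\<dots> = n * (card (fat (Suc D)) - card (stair D t))"
    by (simp add: card_Diff_subset stair_subset_fat)
  finally have "card ?F \<le> n * card (fat (Suc D)) - n * card (stair D t)" by (simp add: diff_mult_distrib2)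
  moreover have "n * card (stair D t) \<le> n * card (fat (Suc D))"
    by (intro mult_le_mono2 card_mono stair_subset_fat finite_fat)
  ultimately show ?thesis by (intro dim_at_most_mono[OF d order_refl]) (use le in linarith)
qed

text \<open>The proof works at parameters \<open>x\<close> that minimize the dimension for all mixed conditions at
once; \<open>\<delta> J M\<close> is the minimal dimension. By symmetry \<open>\<delta> J {}\<close> depends only on the size of \<open>J\<close>. As long as each
new stair costs \<open>t\<close> dimensions (\<open>bound\<close>), the count is the expected one. Let \<open>k\<close> be the first number of
stairs for which this fails. Then the dichotomy gives multiplicity \<open>D + 1\<close> at the point that
receives the \<open>k\<close>-th stair, for some choice of its direction; comparing minimal dimensions
carries this over to \<open>x\<close> itself, and the symmetry makes any point \<open>j\<close> the one that receives the last stair.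
So solutions with stairs everywhere have multiplicity \<open>D + 1\<close> everywhere, and they are zero if
these conditions are too many to be independent.\<close>

lemma stair_rank:
  assumes n: "max_rank n" and t: "t \<le> D"
  shows "\<exists>x. dim_at_most (solutions d n (\<lambda>_. stair D t) x) (card (monomials d) - n * card (stair D t))"
proof (cases "n * card (fat (Suc D)) \<le> card (monomials d)")
  case True
  then show ?thesis using n stair_rank_if_independent unfolding max_rank_def by blast
next
  case False
  let ?N = "card (monomials d)"
  define S where "S J M x = solutions d n (mixed_conditions D t J M) x" for J M x
  define \<delta> where "\<delta> J M = (LEAST b. \<exists>x. dim_at_most (S J M x) b)" for J M
  have \<delta>_le: "\<delta> J M \<le> b" if "dim_at_most (S J M x) b" for J M x b
    unfolding \<delta>_def by (rule Least_le) (use that in blast)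
  have \<delta>_ex: "\<exists>x. dim_at_most (S J M x) (\<delta> J M)" for J M
    unfolding \<delta>_def S_def by (rule LeastI_ex) (use dim_at_most_solutions in blast)
  define U where "U = (\<Inter>P\<in>Pow {..<n} \<times> Pow {..<n}. {x. dim_at_most (S (fst P) (snd P) x) (\<delta> (fst P) (snd P))})"
  have U: "line_generic U"
    unfolding U_def
  proof (rule line_generic_INT)
    fix P assume "P \<in> Pow {..<n} \<times> Pow {..<n}"
    show "line_generic {x. dim_at_most (S (fst P) (snd P) x) (\<delta> (fst P) (snd P))}"
      using \<delta>_ex[of "fst P" "snd P"] line_generic_dim_at_most unfolding S_def by blast
  qed blast
  have UD: "dim_at_most (S J M x) (\<delta> J M)" if "x \<in> U" "J \<subseteq> {..<n}" "M \<subseteq> {..<n}" for J M x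
    using that unfolding U_def by auto
  obtain x where x: "x \<in> U" using U by (auto simp: line_generic_def)
  have sym: "\<delta> J' {} \<le> \<delta> J {}" if J: "J \<subseteq> {..<n}" "J' \<subseteq> {..<n}" "card J = card J'" for J J'
  proof -
    from bij_betw_subsets[OF finite_lessThan J]
    obtain \<sigma> where \<sigma>: "bij_betw \<sigma> {..<n} {..<n}" "\<forall>i\<in>{..<n}. \<sigma> i \<in> J \<longleftrightarrow> i \<in> J'"
      by blast
    have "S J' {} (\<lambda>i. x (\<sigma> i)) = solutions d n (\<lambda>i. mixed_conditions D t J {} (\<sigma> i)) (\<lambda>i. x (\<sigma> i))"
      unfolding S_def by (rule solutions_cong) (use \<sigma>(2) in \<open>auto simp: mixed_conditions_def\<close>)
    also have "\<dots> = S J {} x" unfolding S_def by (rule solutions_permute[OF \<sigma>(1)])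
    finally show ?thesis using UD[OF x J(1), of "{}"] \<delta>_le by (metis empty_subsetI)
  qed
  define bound where "bound k = ?N - n * card (fat D) - k * t" for k
  have S_all: "S {..<n} {} y = solutions d n (\<lambda>_. stair D t) y" for y
    unfolding S_def by (rule solutions_cong) (simp add: mixed_conditions_def)
  show ?thesis
  proof (cases "\<delta> {..<n} {} \<le> bound n")
    case True
    have "bound n = ?N - n * card (stair D t)"
      using t by (simp add: bound_def card_stair distrib_left)
    then show ?thesis
      using dim_at_most_mono[OF UD[OF x, of "{..<n}" "{}"] order_refl True] unfolding S_all by auto
  next
    case notgood: False
    obtain z where "dim_at_most (solutions d n (\<lambda>_. fat D) z) (bound 0)"
      using n unfolding max_rank_def bound_def by auto
    then have good0: "\<delta> {..<0} {} \<le> bound 0"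
      by (intro \<delta>_le[of _ _ z]) (simp add: S_def mixed_conditions_def[abs_def])
    define k where "k = (LEAST k. \<not> \<delta> {..<k} {} \<le> bound k)"
    have k: "\<not> \<delta> {..<k} {} \<le> bound k" unfolding k_def by (rule LeastI[of _ n]) (rule notgood)
    have kn: "k \<le> n" unfolding k_def by (rule Least_le) (rule notgood)
    have "k \<noteq> 0" using k good0 by (intro notI) simp
    then obtain k' where k': "k = Suc k'" using not0_implies_Suc by blast
    have good': "\<delta> {..<k'} {} \<le> bound k'"
      using not_less_Least[of k' "\<lambda>k. \<not> \<delta> {..<k} {} \<le> bound k"] k' unfolding k_def[symmetric] by simp
    have key: "local_coeff d (x j) e v = 0" if j: "j < n" and e: "e \<in> fat (Suc D)" and v: "v \<in> S {..<n} {} x" for j e v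
    proof -
      have "k' \<le> card ({..<n} - {j})" using j kn k' by simp
      then obtain J where J: "J \<subseteq> {..<n} - {j}" "card J = k'" "finite J"
        by (meson obtain_subset_with_card_n)
      have Jn: "J \<subseteq> {..<n}" "j \<notin> J" "insert j J \<subseteq> {..<n}"
        using J(1) j by auto
      have cJ: "card (insert j J) = k" using Jn(2) J(2,3) k' by simp
      have "\<delta> J {} \<le> bound k'"
      proof (rule order.trans[OF _ good'])
        have "{..<k'} \<subseteq> {..<n}" "card {..<k'} = card J" using kn k' J(2) by auto
        then show "\<delta> J {} \<le> \<delta> {..<k'} {}" using Jn(1) by (intro sym)
      qed
      then have dJ: "dim_at_most (solutions d n (mixed_conditions D t J {}) x) (bound k')"
        using dim_at_most_mono[OF UD[OF x Jn(1), of "{}"] order_refl] unfolding S_def by blast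
      define y where "y c = x(j := (x j)(2 := c))" for c
      have f1: "finite {c. \<not> (dim_at_most (S (insert j J) {} (y c)) (bound k' - t) \<or>
          S (insert j J) {} (y c) \<subseteq> S (insert j J) {j} (y c))}"
        unfolding S_def y_def by (rule stair_dichotomy[OF j Jn(2) t dJ])
      \<comment> \<open>changing only the direction at j moves x along a line, so y c is generic for almost all c\<close>
      define r where "r = (\<lambda>i (k::nat). if i = j \<and> k = 2 then 1 else (0::complex))"
      have yr: "y c = on_line x r (c - x j 2)" for c
        by (auto simp: fun_eq_iff y_def on_line_def r_def)
      have "finite {s. on_line x r s \<notin> U}" using U x by (auto simp: line_generic_def)
      then have "finite ((\<lambda>s. s + x j 2) ` {s. on_line x r s \<notin> U})" by blast
      moreover have "{c. y c \<notin> U} \<subseteq> (\<lambda>s. s + x j 2) ` {s. on_line x r s \<notin> U}"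
      proof
        fix c assume "c \<in> {c. y c \<notin> U}"
        then show "c \<in> (\<lambda>s. s + x j 2) ` {s. on_line x r s \<notin> U}"
          by (intro rev_image_eqI[of "c - x j 2"]) (simp_all add: yr)
      qed
      ultimately have f2: "finite {c. y c \<notin> U}" by (rule finite_subset[rotated])
      have "\<exists>c. c \<notin> {c. \<not> (dim_at_most (S (insert j J) {} (y c)) (bound k' - t) \<or>
          S (insert j J) {} (y c) \<subseteq> S (insert j J) {j} (y c))} \<union> {c. y c \<notin> U}"
        by (rule ex_new_if_finite) (use f1 f2 infinite_UNIV_char_0 in auto)
      then obtain c where c: "y c \<in> U" "dim_at_most (S (insert j J) {} (y c)) (bound k' - t) \<or>
          S (insert j J) {} (y c) \<subseteq> S (insert j J) {j} (y c)" by blast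
      have "\<not> dim_at_most (S (insert j J) {} (y c)) (bound k' - t)"
      proof
        assume "dim_at_most (S (insert j J) {} (y c)) (bound k' - t)"
        from \<delta>_le[OF this] have "\<delta> (insert j J) {} \<le> bound k" by (simp add: bound_def k' add.commute)
        moreover have "\<delta> {..<k} {} \<le> \<delta> (insert j J) {}"
          by (rule sym[OF Jn(3)]) (use kn cJ in simp_all)
        ultimately show False using k by linarith
      qed
      then have inc: "S (insert j J) {} (y c) \<subseteq> S (insert j J) {j} (y c)" using c(2) by blast
      have jn: "{j} \<subseteq> {..<n}" using j by simp
      \<comment> \<open>at y c the two spaces coincide, hence their minimal dimensions agree\<close>
      have \<delta>\<delta>: "\<delta> (insert j J) {} \<le> \<delta> (insert j J) {j}"
        by (rule \<delta>_le[OF dim_at_most_mono[OF UD[OF c(1) Jn(3) jn] inc order_refl]])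
      have "S (insert j J) {j} x = S (insert j J) {} x"
      proof (rule ccontr)
        assume ne: "S (insert j J) {j} x \<noteq> S (insert j J) {} x"
        have sub: "S (insert j J) {j} x \<subseteq> S (insert j J) {} x"
          unfolding S_def by (rule solutions_antimono) (use stair_subset_fat in \<open>auto simp: mixed_conditions_def\<close>)
        have lin: "lin_subspace (S J M x)" for J M
          unfolding S_def solutions_def by (rule lin_subspace_common_kernel)
        from dim_at_most_proper_subspace[OF lin lin sub ne UD[OF x Jn(3) empty_subsetI]]
        have "\<delta> (insert j J) {} > 0" "\<delta> (insert j J) {j} \<le> \<delta> (insert j J) {} - 1"
          using \<delta>_le by blast+
        then show False using \<delta>\<delta> by linarith
      qed
      moreover have "S {..<n} {} x \<subseteq> S (insert j J) {} x"
        unfolding S_def by (rule solutions_antimono) (use fat_subset_stair in \<open>auto simp: mixed_conditions_def\<close>)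
      ultimately have "v \<in> S (insert j J) {j} x" using v by blast
      then show ?thesis using j e unfolding S_def mem_solutions by (auto simp: mixed_conditions_def)
    qed
    have SC: "S {} {..<n} y = solutions d n (\<lambda>_. fat (Suc D)) y" for y
      unfolding S_def by (rule solutions_cong) (simp add: mixed_conditions_def)
    have "S {..<n} {} x \<subseteq> S {} {..<n} x"
    proof
      fix v assume v: "v \<in> S {..<n} {} x"
      then have "\<forall>f. f \<notin> monomials d \<longrightarrow> v f = 0" unfolding S_def mem_solutions by blast
      then show "v \<in> S {} {..<n} x" unfolding SC mem_solutions using key v by blast
    qed
    moreover obtain u where "dim_at_most (solutions d n (\<lambda>_. fat (Suc D)) u) (?N - n * card (fat (Suc D)))"
      using n unfolding max_rank_def by blast
    then have "\<delta> {} {..<n} \<le> ?N - n * card (fat (Suc D))" by (intro \<delta>_le[of _ _ u]) (simp add: SC)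
    then have "\<delta> {} {..<n} \<le> ?N - n * card (stair D t)" using False by linarith
    ultimately show ?thesis
      using dim_at_most_mono[OF UD[OF x empty_subsetI order_refl]] unfolding S_all by blast
  qed
qed

section \<open>Collisions of points\<close>

text \<open>A polynomial with exponents in \<open>E\<close> that vanishes to order \<open>m\<close> at certain \<open>s\<close> points is zero. Only the
coefficients of \<open>v\<close> at exponents in \<open>E\<close> enter.\<close>

definition unisolvent :: "nat \<Rightarrow> (nat \<times> nat) set \<Rightarrow> nat \<Rightarrow> bool" where
  "unisolvent s E m \<longleftrightarrow> (\<exists>a b. \<forall>v. (\<forall>j<s. \<forall>e\<in>fat m. (\<Sum>f\<in>E. taylor (a j) (b j) e f * v f) = 0) \<longrightarrow> (\<forall>f\<in>E. v f = 0))"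

text \<open>Under the substitution of \<open>\<epsilon>^(D + 2) u\<close> and \<open>\<epsilon>^(D + 1) w\<close> for \<open>u\<close> and \<open>w\<close>, the monomial with
exponent \<open>e\<close> is multiplied by \<open>\<epsilon> ^ weight D e\<close>. The two factors are so close that the degree decides
first and the exponent of \<open>u\<close> second; so a stair is an initial segment for the weight.\<close>

definition weight :: "nat \<Rightarrow> nat \<times> nat \<Rightarrow> nat" where
  "weight D e = (D + 1) * (fst e + snd e) + fst e"

lemma weight_less:
  assumes "t \<le> D" "e \<in> stair D t" "f \<notin> stair D t"
  shows "weight D e < weight D f"
proof -
  consider "fst e + snd e < fst f + snd f" | "fst e + snd e = fst f + snd f" "fst e < fst f"
    using assms by (fastforce simp: stair_def)
  then show ?thesis
  proof cases
    case 1
    have "weight D e < (D + 1) * (fst e + snd e) + (D + 1)"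
      using assms(2) by (auto simp: weight_def stair_def)
    also have "\<dots> = (D + 1) * Suc (fst e + snd e)" by simp
    also have "\<dots> \<le> (D + 1) * (fst f + snd f)" using 1 by (intro mult_le_mono2) simp
    also have "\<dots> \<le> weight D f" by (simp add: weight_def)
    finally show ?thesis .
  qed (simp add: weight_def)
qed

lemma taylor_scale:
  fixes \<epsilon> :: complex
  shows "\<epsilon> ^ weight D e * taylor (\<epsilon> ^ (D + 2) * a) (\<epsilon> ^ (D + 1) * b) e f = \<epsilon> ^ weight D f * taylor a b e f"
proof (cases "fst e \<le> fst f \<and> snd e \<le> snd f")
  case True
  then have "weight D f = weight D e + (D + 2) * (fst f - fst e) + (D + 1) * (snd f - snd e)"
    by (auto simp: weight_def algebra_simps dest!: le_Suc_ex)
  then show ?thesis by (simp add: taylor_def power_mult_distrib power_add power_mult[symmetric] mult_ac)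
next
  case False
  then show ?thesis by (auto simp: taylor_def binomial_eq_0)
qed

text \<open>At each point \<open>x i\<close> place a copy of the unisolvent configuration, shrunk with the factors
\<open>\<epsilon>^(D + 2)\<close> and \<open>\<epsilon>^(D + 1)\<close> in the twisted coordinates. By unisolvence every coefficient functional \<open>e\<close> of the
stair is, on polynomials supported in the stair, a combination (with coefficients \<open>\<mu>\<close>) of the multiplicity
conditions at the unscaled points. After scaling and division by \<open>\<epsilon> ^ weight D e\<close> the same combination is the
functional \<open>B \<epsilon> (i, e)\<close>: the functional \<open>e\<close> itself plus terms outside the stair, which carry positive powers of
\<open>\<epsilon>\<close>. Hence the stair conditions are the limits for \<open>\<epsilon> = 0\<close> of consequences of the multiplicity conditions, and
the dimension for small \<open>\<epsilon>\<close> is at most the one in the limit.\<close>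

lemma collision:
  assumes uni: "unisolvent s (stair D t) m" and t: "t \<le> D"
    and x: "dim_at_most (solutions d n (\<lambda>_. stair D t) x) b"
  shows "\<exists>x'. dim_at_most (solutions d (n * s) (\<lambda>_. fat m) x') b"
proof -
  let ?E = "stair D t" and ?M = "monomials d"
  obtain \<alpha> \<beta> where \<alpha>\<beta>: "\<And>v. (\<forall>j<s. \<forall>e\<in>fat m. (\<Sum>f\<in>?E. taylor (\<alpha> j) (\<beta> j) e f * v f) = 0) \<Longrightarrow> (\<forall>f\<in>?E. v f = 0)"
    using uni unfolding unisolvent_def by blast
  define T where "T g f = taylor (\<alpha> (fst g)) (\<beta> (fst g)) (snd g) f" for g f
  let ?G = "{..<s} \<times> fat m"
  have "\<exists>\<mu>. \<forall>f\<in>?E. (\<Sum>g\<in>?G. \<mu> g * T g f) = (if f = e then 1 else 0)" if "e \<in> ?E" for e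
    by (rule coordinate_in_span) (use \<alpha>\<beta> that in \<open>auto simp: T_def\<close>)
  then obtain \<mu> where \<mu>: "\<And>e f. e \<in> ?E \<Longrightarrow> f \<in> ?E \<Longrightarrow> (\<Sum>g\<in>?G. \<mu> e g * T g f) = (if f = e then 1 else 0)"
    by metis
  define L where "L e f = (\<Sum>g\<in>?G. \<mu> e g * T g f)" for e f
  define B where "B \<epsilon> h f' = twisted (x (fst h)) (snd h) f' +
    (\<Sum>f\<in>?M - ?E. \<epsilon> ^ (weight D f - weight D (snd h)) * L (snd h) f * twisted (x (fst h)) f f')"
    for \<epsilon> :: complex and h :: "nat \<times> nat \<times> nat" and f'
  let ?H = "SIGMA i:{..<n}. ?E"
  have "B 0 h = twisted (x (fst h)) (snd h)" if h: "h \<in> ?H" for h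
  proof
    fix f'
    have "(\<Sum>f\<in>?M - ?E. 0 ^ (weight D f - weight D (snd h)) * L (snd h) f * twisted (x (fst h)) f f') = 0"
    proof (rule sum.neutral, rule ballI)
      fix f assume "f \<in> ?M - ?E"
      then have "weight D (snd h) < weight D f" using h by (intro weight_less[OF t]) auto
      then show "0 ^ (weight D f - weight D (snd h)) * L (snd h) f * twisted (x (fst h)) f f' = 0"
        by (simp add: power_0_left)
    qed
    then show "B 0 h f' = twisted (x (fst h)) (snd h) f'" by (simp add: B_def)
  qed
  then have "B 0 ` ?H = (\<lambda>(i, e). twisted (x i) e) ` ?H" by (intro image_cong) auto
  then have B0: "dim_at_most (common_kernel ?M (B 0 ` ?H)) b" using x by (simp add: solutions_def)
  have "poly_fun (\<lambda>\<epsilon>. B \<epsilon> h f')" for h f'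
    unfolding B_def by (intro poly_fun_add poly_fun_sum poly_fun_mult poly_fun_power poly_fun_const poly_fun_ident)
  from dim_at_most_cofinite[where A=B and ?t0.0=0, OF finite_monomials this B0]
  have "finite {\<epsilon>. \<not> dim_at_most (common_kernel ?M (B \<epsilon> ` ?H)) b}" .
  then have "\<exists>\<epsilon>. \<epsilon> \<notin> insert 0 {\<epsilon>. \<not> dim_at_most (common_kernel ?M (B \<epsilon> ` ?H)) b}"
    by (intro ex_new_if_finite infinite_UNIV_char_0) simp
  then obtain \<epsilon> where \<epsilon>: "\<epsilon> \<noteq> 0" "dim_at_most (common_kernel ?M (B \<epsilon> ` ?H)) b" by blast
  define q where "q j k = (if k = 0 then \<epsilon> ^ (D + 2) * \<alpha> j else if k = 1 then \<epsilon> ^ (D + 1) * \<beta> j else 0)" for j and k :: nat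
  define x' where "x' l = (\<lambda>k::nat. if k = 0 then x (l div s) 0 + q (l mod s) 0 + x (l div s) 2 * q (l mod s) 1
    else if k = 1 then x (l div s) 1 + q (l mod s) 1 else x (l div s) 2)" for l
  have "solutions d (n * s) (\<lambda>_. fat m) x' \<subseteq> common_kernel ?M (B \<epsilon> ` ?H)"
  proof
    fix v assume v: "v \<in> solutions d (n * s) (\<lambda>_. fat m) x'"
    have "(\<Sum>f'\<in>?M. B \<epsilon> (i, e) f' * v f') = 0" if i: "i < n" and e: "e \<in> ?E" for i e
    proof -
      define F where "F f = local_coeff d (x i) f v" for f
      have T0: "(\<Sum>f\<in>?M. \<epsilon> ^ weight D f * T g f * F f) = 0" if g: "g \<in> ?G" for g
      proof -
        obtain j e where je: "g = (j, e)" "j < s" "e \<in> fat m" using g by auto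
        have "i * s + j < n * s"
        proof -
          have "i * s + j < Suc i * s" using je by simp
          also have "\<dots> \<le> n * s" using i by (intro mult_le_mono1) simp
          finally show ?thesis .
        qed
        then have z: "local_coeff d (x' (i * s + j)) e v = 0" using v je(3) unfolding mem_solutions by blast
        have dm: "(i * s + j) div s = i" "(i * s + j) mod s = j" using je(2) by simp_all
        have "x' (i * s + j) = (\<lambda>k. if k = 0 then x i 0 + q j 0 + x i 2 * q j 1 else if k = 1 then x i 1 + q j 1 else x i 2)"
          unfolding x'_def dm ..
        then have "local_coeff d (q j) e F = 0"
          using z local_coeff_shift[of "q j" d e "x i" v] unfolding F_def by (simp add: q_def)
        then have "\<epsilon> ^ weight D e * (\<Sum>f\<in>?M. taylor (\<epsilon> ^ (D + 2) * \<alpha> j) (\<epsilon> ^ (D + 1) * \<beta> j) e f * F f) = 0"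
          by (simp add: local_coeff_def twisted_untwisted q_def)
        then have "(\<Sum>f\<in>?M. (\<epsilon> ^ weight D e * taylor (\<epsilon> ^ (D + 2) * \<alpha> j) (\<epsilon> ^ (D + 1) * \<beta> j) e f) * F f) = 0"
          by (simp only: sum_distrib_left mult.assoc)
        then show ?thesis unfolding taylor_scale by (simp add: T_def je(1))
      qed
      have "(\<Sum>f\<in>?M. \<epsilon> ^ weight D f * L e f * F f) = (\<Sum>g\<in>?G. \<mu> e g * (\<Sum>f\<in>?M. \<epsilon> ^ weight D f * T g f * F f))"
      proof -
        have "(\<Sum>f\<in>?M. \<epsilon> ^ weight D f * L e f * F f) = (\<Sum>f\<in>?M. \<Sum>g\<in>?G. \<mu> e g * (\<epsilon> ^ weight D f * T g f * F f))"
          by (intro sum.cong refl) (simp add: L_def sum_distrib_left sum_distrib_right mult_ac)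
        also have "\<dots> = (\<Sum>g\<in>?G. \<mu> e g * (\<Sum>f\<in>?M. \<epsilon> ^ weight D f * T g f * F f))"
          by (subst sum.swap) (simp only: sum_distrib_left)
        finally show ?thesis .
      qed
      also have "\<dots> = 0" using T0 by (intro sum.neutral) simp
      finally have s0: "(\<Sum>f\<in>?M. \<epsilon> ^ weight D f * L e f * F f) = 0" .
      have "(\<Sum>f\<in>?M. \<epsilon> ^ weight D f * L e f * F f) =
        (\<Sum>f\<in>?M - ?E. \<epsilon> ^ weight D f * L e f * F f) + (\<Sum>f\<in>?M \<inter> ?E. \<epsilon> ^ weight D f * L e f * F f)"
        by (subst sum.union_disjoint[symmetric]) (auto intro!: sum.cong simp: Un_commute Un_Diff_Int)
      also have "(\<Sum>f\<in>?M \<inter> ?E. \<epsilon> ^ weight D f * L e f * F f) = (\<Sum>f\<in>?M \<inter> ?E. if f = e then \<epsilon> ^ weight D e * F e else 0)"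
        by (rule sum.cong) (auto simp: L_def \<mu> e)
      also have "\<dots> = \<epsilon> ^ weight D e * F e"
        using e by (auto simp: F_def local_coeff_outside)
      also have "(\<Sum>f\<in>?M - ?E. \<epsilon> ^ weight D f * L e f * F f) =
          \<epsilon> ^ weight D e * (\<Sum>f\<in>?M - ?E. \<epsilon> ^ (weight D f - weight D e) * L e f * F f)"
        unfolding sum_distrib_left
      proof (rule sum.cong[OF refl])
        fix f assume "f \<in> ?M - ?E"
        then have "weight D e < weight D f" using e by (intro weight_less[OF t]) auto
        then have "\<epsilon> ^ weight D f = \<epsilon> ^ weight D e * \<epsilon> ^ (weight D f - weight D e)"
          by (simp add: power_add[symmetric])
        then show "\<epsilon> ^ weight D f * L e f * F f = \<epsilon> ^ weight D e * (\<epsilon> ^ (weight D f - weight D e) * L e f * F f)"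
          by (simp only: mult.assoc)
      qed
      finally have "\<epsilon> ^ weight D e * ((\<Sum>f\<in>?M - ?E. \<epsilon> ^ (weight D f - weight D e) * L e f * F f) + F e) = 0"
        using s0 by (simp only: distrib_left)
      then have z: "F e + (\<Sum>f\<in>?M - ?E. \<epsilon> ^ (weight D f - weight D e) * L e f * F f) = 0"
        using \<epsilon>(1) by (simp add: add.commute)
      have "(\<Sum>f'\<in>?M. B \<epsilon> (i, e) f' * v f') =
         F e + (\<Sum>f'\<in>?M. \<Sum>f\<in>?M - ?E. \<epsilon> ^ (weight D f - weight D e) * L e f * (twisted (x i) f f' * v f'))"
        by (simp add: B_def F_def local_coeff_def distrib_right sum.distrib sum_distrib_right mult.assoc)
      also have "\<dots> = F e + (\<Sum>f\<in>?M - ?E. \<epsilon> ^ (weight D f - weight D e) * L e f * F f)"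
        by (subst sum.swap) (simp only: F_def local_coeff_def sum_distrib_left)
      finally show ?thesis using z by simp
    qed
    then show "v \<in> common_kernel ?M (B \<epsilon> ` ?H)"
      using v unfolding mem_solutions common_kernel_def by auto
  qed
  then show ?thesis using dim_at_most_mono[OF \<epsilon>(2)] by blast
qed

text \<open>The third condition on \<open>D\<close> and \<open>t\<close> says that a stair has as many conditions as the fat points that
collide to it, so that no dimension is lost in the limit.\<close>

lemma max_rank_mult:
  assumes n: "max_rank n"
    and uni: "\<And>m. t m \<le> D m" "\<And>m. unisolvent s (stair (D m) (t m)) m"
      "\<And>m. card (stair (D m) (t m)) = s * card (fat m)"
  shows "max_rank (n * s)"
  unfolding max_rank_def
proof (intro allI)
  fix d m
  obtain x where "dim_at_most (solutions d n (\<lambda>_. stair (D m) (t m)) x) (card (monomials d) - n * card (stair (D m) (t m)))"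
    using stair_rank[OF n uni(1)] by blast
  from collision[OF uni(2) uni(1) this] uni(3)
  show "\<exists>x. dim_at_most (solutions d (n * s) (\<lambda>_. fat m) x) (card (monomials d) - n * s * card (fat m))"
    by (simp add: mult.assoc)
qed

text \<open>At the origin the conditions are the vanishing of coefficients.\<close>

lemma max_rank_1: "max_rank 1"
  unfolding max_rank_def
proof (intro allI)
  fix d m
  define x where "x = (\<lambda>(i::nat) (k::nat). 0::complex)"
  have t: "twisted (x i) e f = (if f = e then 1 else 0)" for i e f
    by (subst twisted_untwisted) (auto simp: x_def taylor_def power_0_left prod_eq_iff binomial_eq_0 not_le)
  have c: "local_coeff d (x i) e v = v e" if "e \<in> monomials d" for i e v
  proof -
    have "local_coeff d (x i) e v = (\<Sum>f\<in>monomials d. if f = e then v f else 0)"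
      unfolding local_coeff_def t by (rule sum.cong) auto
    then show ?thesis using that by simp
  qed
  have sep: "separates (monomials d - fat m) (solutions d 1 (\<lambda>_. fat m) x)"
    unfolding separates_def
  proof (intro ballI impI allI)
    fix v f assume v: "v \<in> solutions d 1 (\<lambda>_. fat m) x" "\<forall>k\<in>monomials d - fat m. v k = 0"
    show "v f = 0"
    proof (cases "f \<in> monomials d")
      case True
      then show ?thesis using v c[of f 0 v] unfolding mem_solutions by (cases "f \<in> fat m") auto
    next
      case False
      then show ?thesis using v(1) unfolding mem_solutions by blast
    qed
  qed
  have "card (monomials d - fat m) \<le> card (monomials d) - 1 * card (fat m)"
  proof (cases "m \<le> Suc d")
    case True
    then have "fat m \<subseteq> monomials d" by (auto simp: fat_def monomials_def)
    then show ?thesis by (simp add: card_Diff_subset)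
  next
    case False
    then have "monomials d - fat m = {}" by (auto simp: fat_def monomials_def)
    then show ?thesis by (simp only: card.empty le0)
  qed
  then show "\<exists>x. dim_at_most (solutions d 1 (\<lambda>_. fat m) x) (card (monomials d) - 1 * card (fat m))"
    unfolding dim_at_most_def using sep finite_monomials by blast
qed

section \<open>Configurations of four and nine points\<close>

lemma linear_power_dvd_cancel:
  fixes s q :: "complex poly"
  assumes "[:- b, 1:] ^ m dvd s * q" "poly s b \<noteq> 0"
  shows "[:- b, 1:] ^ m dvd q"
proof (cases "q = 0")
  case False
  have "s \<noteq> 0" using assms(2) by auto
  then have "order b (s * q) = order b q" using False assms(2) by (simp add: order_mult order_0I)
  moreover have "m \<le> order b (s * q)" using assms(1) False \<open>s \<noteq> 0\<close> by (simp add: order_divides)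
  ultimately show ?thesis using False by (simp add: order_divides)
qed simp

text \<open>A polynomial in two variables is written as the family of the coefficients \<open>p j\<close>, polynomials in
\<open>x\<close>, of the powers \<open>y^j\<close>, with \<open>p j = 0\<close> for \<open>j > N\<close>. In this form division by a polynomial in \<open>x\<close> acts on each \<open>p j\<close>,
and division by \<open>y\<close> is a shift of the index. The value is the Taylor coefficient with index
\<open>(\<alpha>, \<beta>)\<close> at the point \<open>(a, b)\<close>.\<close>

definition row_taylor :: "nat \<Rightarrow> complex \<Rightarrow> complex \<Rightarrow> nat \<Rightarrow> nat \<Rightarrow> (nat \<Rightarrow> complex poly) \<Rightarrow> complex" where
  "row_taylor N a b \<alpha> \<beta> p =
     (\<Sum>j\<le>N. coeff (pcompose (p j) [:a, 1:]) \<alpha> * (of_nat (j choose \<beta>) * b ^ (j - \<beta>)))"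

definition row_order :: "nat \<Rightarrow> nat \<Rightarrow> complex \<Rightarrow> complex \<Rightarrow> (nat \<Rightarrow> complex poly) \<Rightarrow> bool" where
  "row_order N m a b p \<longleftrightarrow> (\<forall>\<alpha> \<beta>. \<alpha> + \<beta> < m \<longrightarrow> row_taylor N a b \<alpha> \<beta> p = 0)"

lemma row_taylor_mult_x:
  "row_taylor N a b \<alpha> \<beta> (\<lambda>j. [:- k, 1:] * p j) =
     (a - k) * row_taylor N a b \<alpha> \<beta> p + (case \<alpha> of 0 \<Rightarrow> 0 | Suc \<alpha>' \<Rightarrow> row_taylor N a b \<alpha>' \<beta> p)"
proof -
  have "pcompose ([:- k, 1:] * q) [:a, 1:] = [:a - k, 1:] * pcompose q [:a, 1:]" for q
    by (simp only: pcompose_mult) (simp add: pcompose_pCons)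
  then have c: "coeff (pcompose ([:- k, 1:] * q) [:a, 1:]) \<alpha> = (a - k) * coeff (pcompose q [:a, 1:]) \<alpha> +
      (case \<alpha> of 0 \<Rightarrow> 0 | Suc \<alpha>' \<Rightarrow> coeff (pcompose q [:a, 1:]) \<alpha>')" for q
    by (simp add: coeff_pCons split: nat.split)
  show ?thesis
    unfolding row_taylor_def c by (cases \<alpha>) (simp_all add: distrib_right sum.distrib sum_distrib_left mult.assoc)
qed

text \<open>A factor that does not vanish at the point can be cancelled; solve for the coefficients in the
order of increasing \<open>\<alpha>\<close>.\<close>

lemma row_order_div_x_unit:
  assumes "row_order N m a b (\<lambda>j. [:- k, 1:] * p j)" "a \<noteq> k"
  shows "row_order N m a b p"
  unfolding row_order_def
proof (intro allI impI)
  fix \<alpha> \<beta> show "\<alpha> + \<beta> < m \<Longrightarrow> row_taylor N a b \<alpha> \<beta> p = 0"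
  proof (induction \<alpha>)
    case 0
    then have "row_taylor N a b 0 \<beta> (\<lambda>j. [:- k, 1:] * p j) = 0" using assms(1) unfolding row_order_def by blast
    then show ?case using assms(2) unfolding row_taylor_mult_x by simp
  next
    case (Suc \<alpha>)
    then have "row_taylor N a b (Suc \<alpha>) \<beta> (\<lambda>j. [:- k, 1:] * p j) = 0" using assms(1) unfolding row_order_def by blast
    then show ?case using Suc assms(2) unfolding row_taylor_mult_x by simp
  qed
qed

lemma row_order_div_x:
  assumes "row_order N (Suc m) k b (\<lambda>j. [:- k, 1:] * p j)"
  shows "row_order N m k b p"
  unfolding row_order_def
proof (intro allI impI)
  fix \<alpha> \<beta> :: nat assume "\<alpha> + \<beta> < m"
  then have "Suc \<alpha> + \<beta> < Suc m" by simp
  then have "row_taylor N k b (Suc \<alpha>) \<beta> (\<lambda>j. [:- k, 1:] * p j) = 0" using assms unfolding row_order_def by blast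
  then show "row_taylor N k b \<alpha> \<beta> p = 0" unfolding row_taylor_mult_x by simp
qed

text \<open>The right-hand side is the sum \<open>b + w\<close> times the expansion of the quotient by \<open>y\<close>; on
coefficients this is Pascal's rule.\<close>

lemma row_taylor_mult_y:
  assumes "p (Suc N) = 0" "p 0 = 0"
  shows "row_taylor N a b \<alpha> \<beta> p = b * row_taylor N a b \<alpha> \<beta> (\<lambda>j. p (Suc j)) +
     (case \<beta> of 0 \<Rightarrow> 0 | Suc \<beta>' \<Rightarrow> row_taylor N a b \<alpha> \<beta>' (\<lambda>j. p (Suc j)))"
proof -
  let ?c = "\<lambda>j. coeff (pcompose (p j) [:a, 1:]) \<alpha>"
  have "row_taylor N a b \<alpha> \<beta> p = (\<Sum>j\<le>Suc N. ?c j * (of_nat (j choose \<beta>) * b ^ (j - \<beta>)))"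
    by (simp add: row_taylor_def assms(1))
  also have "\<dots> = (\<Sum>j\<le>N. ?c (Suc j) * (of_nat (Suc j choose \<beta>) * b ^ (Suc j - \<beta>)))"
    by (simp only: sum.atMost_Suc_shift) (simp add: assms(2))
  also have "\<dots> = (\<Sum>j\<le>N. ?c (Suc j) * (b * (of_nat (j choose \<beta>) * b ^ (j - \<beta>)) +
     (case \<beta> of 0 \<Rightarrow> 0 | Suc \<beta>' \<Rightarrow> of_nat (j choose \<beta>') * b ^ (j - \<beta>'))))"
  proof (intro sum.cong refl arg_cong2[of _ _ _ _ "(*)"])
    fix j
    show "of_nat (Suc j choose \<beta>) * b ^ (Suc j - \<beta>) = b * (of_nat (j choose \<beta>) * b ^ (j - \<beta>)) +
      (case \<beta> of 0 \<Rightarrow> 0 | Suc \<beta>' \<Rightarrow> of_nat (j choose \<beta>') * b ^ (j - \<beta>'))"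
    proof (cases \<beta>)
      case (Suc \<beta>')
      have "j < Suc \<beta>' \<or> j - \<beta>' = Suc (j - Suc \<beta>')" by linarith
      then show ?thesis by (auto simp: Suc binomial_eq_0 algebra_simps)
    qed simp
  qed
  also have "\<dots> = b * row_taylor N a b \<alpha> \<beta> (\<lambda>j. p (Suc j)) +
     (case \<beta> of 0 \<Rightarrow> 0 | Suc \<beta>' \<Rightarrow> row_taylor N a b \<alpha> \<beta>' (\<lambda>j. p (Suc j)))"
    by (cases \<beta>) (simp_all add: row_taylor_def distrib_left sum.distrib sum_distrib_left mult_ac)
  finally show ?thesis .
qed

lemma row_order_div_y_unit:
  assumes "row_order N m a b p" "b \<noteq> 0" "p (Suc N) = 0" "p 0 = 0"
  shows "row_order N m a b (\<lambda>j. p (Suc j))"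
  unfolding row_order_def
proof (intro allI impI)
  fix \<alpha> \<beta> show "\<alpha> + \<beta> < m \<Longrightarrow> row_taylor N a b \<alpha> \<beta> (\<lambda>j. p (Suc j)) = 0"
  proof (induction \<beta>)
    case 0
    then have "row_taylor N a b \<alpha> 0 p = 0" using assms(1) unfolding row_order_def by blast
    then show ?case using assms(2) unfolding row_taylor_mult_y[of p, OF assms(3,4)] by simp
  next
    case (Suc \<beta>)
    then have "row_taylor N a b \<alpha> (Suc \<beta>) p = 0" using assms(1) unfolding row_order_def by blast
    then show ?case using Suc assms(2) unfolding row_taylor_mult_y[of p, OF assms(3,4)] by simp
  qed
qed

lemma row_order_div_y:
  assumes "row_order N (Suc m) a 0 p" "p (Suc N) = 0" "p 0 = 0"
  shows "row_order N m a 0 (\<lambda>j. p (Suc j))"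
  unfolding row_order_def
proof (intro allI impI)
  fix \<alpha> \<beta> :: nat assume "\<alpha> + \<beta> < m"
  then have "\<alpha> + Suc \<beta> < Suc m" by simp
  then have "row_taylor N a 0 \<alpha> (Suc \<beta>) p = 0" using assms(1) unfolding row_order_def by blast
  then show "row_taylor N a 0 \<alpha> \<beta> (\<lambda>j. p (Suc j)) = 0"
    unfolding row_taylor_mult_y[of p, OF assms(2,3)] by simp
qed

text \<open>The restriction of the polynomial to the vertical line \<open>x = a\<close>.\<close>

definition column :: "nat \<Rightarrow> (nat \<Rightarrow> complex poly) \<Rightarrow> complex \<Rightarrow> complex poly" where
  "column N p a = (\<Sum>j\<le>N. monom (poly (p j) a) j)"

lemma coeff_column: "(\<And>j. j > N \<Longrightarrow> p j = 0) \<Longrightarrow> coeff (column N p a) j = poly (p j) a"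
  by (simp add: column_def coeff_sum)

lemma row_order_column:
  assumes "row_order N m a b p"
  shows "[:- b, 1:] ^ m dvd column N p a"
proof (rule dvd_if_shifted_coeffs_0)
  fix i assume "i < m"
  have "coeff (pcompose q [:a, 1:]) 0 = poly q a" for q
    by (simp add: poly_0_coeff_0[symmetric] poly_pcompose)
  then have "coeff (pcompose (column N p a) [:b, 1:]) i = row_taylor N a b 0 i p"
    by (simp add: column_def pcompose_sum coeff_sum coeff_monom_pcompose row_taylor_def mult.assoc)
  then show "coeff (pcompose (column N p a) [:b, 1:]) i = 0"
    using assms \<open>i < m\<close> unfolding row_order_def by simp
qed

lemma row_order_bottom:
  assumes "row_order N m a 0 p"
  shows "[:- a, 1:] ^ m dvd p 0"
proof (rule dvd_if_shifted_coeffs_0)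
  fix i assume "i < m"
  have "row_taylor N a 0 i 0 p = (\<Sum>j\<le>N. if j = 0 then coeff (pcompose (p j) [:a, 1:]) i else 0)"
    unfolding row_taylor_def by (rule sum.cong) auto
  then show "coeff (pcompose (p 0) [:a, 1:]) i = 0"
    using assms \<open>i < m\<close> unfolding row_order_def by simp
qed

definition linear_factors :: "complex list \<Rightarrow> complex poly" where
  "linear_factors rs = prod_list (map (\<lambda>r. [:- r, 1:]) rs)"

lemma linear_factors_simps [simp]:
  "linear_factors [] = 1" "linear_factors (r # rs) = [:- r, 1:] * linear_factors rs"
  "linear_factors (rs @ ss) = linear_factors rs * linear_factors ss"
  "linear_factors (replicate m r) = [:- r, 1:] ^ m"
  by (induction m) (simp_all add: linear_factors_def)

lemma linear_factors_nonzero: "linear_factors rs \<noteq> 0"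
  by (auto simp: linear_factors_def prod_list_zero_iff)

lemma degree_linear_factors: "degree (linear_factors rs) = length rs"
proof (induction rs)
  case (Cons r rs)
  have "degree ([:- r, 1:] * linear_factors rs) = degree [:- r, 1:] + degree (linear_factors rs)"
    by (rule degree_mult_eq) (simp_all add: linear_factors_nonzero)
  then show ?case using Cons by (simp only: linear_factors_simps) simp
qed simp

lemma lead_coeff_linear_factors: "coeff (linear_factors rs) (length rs) = 1"
proof (induction rs)
  case (Cons r rs)
  have "coeff (linear_factors rs) (Suc (length rs)) = 0"
    by (rule coeff_eq_0) (simp add: degree_linear_factors)
  then show ?case using Cons by (simp add: coeff_pCons)
qed simp

lemma second_coeff_linear_factors:
  "rs \<noteq> [] \<Longrightarrow> coeff (linear_factors rs) (length rs - 1) = - sum_list rs"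
proof (induction rs)
  case (Cons r rs)
  then show ?case
    using lead_coeff_linear_factors[of rs] by (cases rs) (auto simp: coeff_pCons split: nat.split)
qed simp

lemma poly_linear_factors_eq_0: "poly (linear_factors rs) a = 0 \<longleftrightarrow> a \<in> set rs"
  by (induction rs) auto

lemma linear_factors_dvd:
  assumes "distinct bs" "\<And>b. b \<in> set bs \<Longrightarrow> [:- b, 1:] ^ m dvd q"
  shows "linear_factors (concat (map (replicate m) bs)) dvd q"
  using assms
proof (induction bs)
  case (Cons b bs)
  then have "linear_factors (concat (map (replicate m) bs)) dvd q" by simp
  then obtain s where s: "q = linear_factors (concat (map (replicate m) bs)) * s" by blast
  have "[:- b, 1:] ^ m dvd linear_factors (concat (map (replicate m) bs)) * s"
    using Cons.prems(2)[of b] s by simp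
  moreover have "poly (linear_factors (concat (map (replicate m) bs))) b \<noteq> 0"
    using Cons.prems(1) by (auto simp: poly_linear_factors_eq_0)
  ultimately have "[:- b, 1:] ^ m dvd s" by (rule linear_power_dvd_cancel)
  then show ?case unfolding s by (simp add: mult.commute mult_dvd_mono)
qed simp

lemma dvd_x_minus: "(\<And>j. poly (p j) k = 0) \<Longrightarrow> \<exists>q. \<forall>j. p j = [:- k, 1:] * (q j :: complex poly)"
  by (simp add: poly_eq_0_iff_dvd dvd_def) metis

text \<open>Two of the points lie on the line \<open>y = 0\<close> and two on \<open>x = 0\<close>. The polynomial has degree less than
\<open>2 m\<close> on \<open>y = 0\<close>, because the stair omits \<open>x^(2 m)\<close>, and \<open>2 m\<close> zeros there. On \<open>x = 0\<close> it has degree at most \<open>2 m\<close>, with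
\<open>2 m\<close> zeros at the points and one more at the origin. Hence it is \<open>x y\<close> times a polynomial with multiplicity
\<open>m - 1\<close> at the points, whose exponents lie in the stair for \<open>m - 1\<close>.\<close>

lemma four_points_rows:
  assumes "\<And>j i. coeff (p j) i \<noteq> 0 \<Longrightarrow> (i, j) \<in> stair (2 * m) m" "\<And>j. j > N \<Longrightarrow> p j = 0"
    "row_order N m 1 0 p" "row_order N m 2 0 p" "row_order N m 0 1 p" "row_order N m 0 2 p"
  shows "p j = 0"
  using assms
proof (induction m arbitrary: p j)
  case 0
  then have "coeff (p j) i = 0" for i by (force simp: stair_def)
  then show ?case by (simp add: poly_eq_iff)
next
  case (Suc m)
  have bottom: "p 0 = 0"
  proof (rule ccontr)
    assume "p 0 \<noteq> 0"
    then have "(degree (p 0), 0) \<in> stair (2 * Suc m) (Suc m)" by (intro Suc.prems(1)) simp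
    then have "degree (p 0) < 2 * Suc m" by (auto simp: stair_def)
    moreover have "linear_factors (concat (map (replicate (Suc m)) [1, 2])) dvd p 0"
      using row_order_bottom[OF Suc.prems(3)] row_order_bottom[OF Suc.prems(4)]
      by (intro linear_factors_dvd) auto
    then have "length (concat (map (replicate (Suc m)) [1, 2::complex])) \<le> degree (p 0)"
      using \<open>p 0 \<noteq> 0\<close> dvd_imp_degree_le unfolding degree_linear_factors[symmetric] by blast
    ultimately show False by simp
  qed
  have "column N p 0 = 0"
  proof (rule ccontr)
    assume ne: "column N p 0 \<noteq> 0"
    let ?j = "degree (column N p 0)"
    have c: "coeff (column N p 0) j = poly (p j) 0" for j by (rule coeff_column) (rule Suc.prems(2))
    have "coeff (p ?j) 0 \<noteq> 0" using ne c[of ?j] by (metis leading_coeff_0_iff poly_0_coeff_0)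
    then have "?j \<le> 2 * Suc m" using Suc.prems(1)[of ?j 0] by (auto simp: stair_def)
    moreover have "linear_factors (concat (map (replicate (Suc m)) [1, 2])) dvd column N p 0"
      using row_order_column[OF Suc.prems(5)] row_order_column[OF Suc.prems(6)]
      by (intro linear_factors_dvd) auto
    then obtain s where s: "column N p 0 = linear_factors (concat (map (replicate (Suc m)) [1, 2])) * s" by blast
    have "poly (column N p 0) 0 = 0" using c[of 0] bottom by (simp add: poly_0_coeff_0)
    then have "[:- 0, 1:] ^ 1 dvd column N p 0" unfolding poly_eq_0_iff_dvd by simp
    then have "[:- 0, 1:] ^ 1 dvd s" unfolding s
      by (rule linear_power_dvd_cancel) (auto simp: poly_linear_factors_eq_0)
    then have "linear_factors (concat (map (replicate (Suc m)) [1, 2]) @ [0]) dvd column N p 0"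
      unfolding s linear_factors_simps by (intro mult_dvd_mono) auto
    then have "length (concat (map (replicate (Suc m)) [1, 2]) @ [0::complex]) \<le> ?j"
      using ne dvd_imp_degree_le unfolding degree_linear_factors[symmetric] by blast
    ultimately show False by simp
  qed
  then have "poly (p j) 0 = 0" for j using coeff_column[of N p 0 j] Suc.prems(2) by simp
  then obtain q where q: "\<And>j. p j = [:- 0, 1:] * q j" using dvd_x_minus[of p 0] by blast
  have pq: "p = (\<lambda>j. [:- 0, 1:] * q j)" by (rule ext) (rule q)
  have q0: "q 0 = 0" "\<And>j. j > N \<Longrightarrow> q j = 0"
    using bottom Suc.prems(2) unfolding q by (metis mult_eq_0_iff pCons_eq_0_iff one_neq_zero)+
  have "q (Suc j) = 0" for j
  proof (rule Suc.IH[of "\<lambda>j. q (Suc j)"])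
    fix j i assume "coeff (q (Suc j)) i \<noteq> 0"
    then have "coeff (p (Suc j)) (Suc i) \<noteq> 0" by (simp add: q)
    from Suc.prems(1)[OF this] show "(i, j) \<in> stair (2 * m) m" by (auto simp: stair_def)
  next
    have qN: "q (Suc N) = 0" using q0(2) by simp
    have "row_order N (Suc m) 1 0 q" "row_order N (Suc m) 2 0 q"
      by (rule row_order_div_x_unit[of _ _ _ _ 0]; use Suc.prems(3,4) in \<open>simp only: pq\<close>; simp)+
    then show "row_order N m 1 0 (\<lambda>j. q (Suc j))" "row_order N m 2 0 (\<lambda>j. q (Suc j))"
      by (simp_all only: row_order_div_y[OF _ qN q0(1)])
    have "row_order N m 0 1 q" "row_order N m 0 2 q"
      by (rule row_order_div_x; use Suc.prems(5,6) in \<open>simp only: pq\<close>)+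
    then show "row_order N m 0 1 (\<lambda>j. q (Suc j))" "row_order N m 0 2 (\<lambda>j. q (Suc j))"
      by (simp_all add: row_order_div_y_unit[OF _ _ qN q0(1)])
  qed (use q0 in simp)
  then have "q j = 0" using q0(1) by (cases j) auto
  then show ?case by (simp add: q)
qed

text \<open>The points lie on the three vertical lines \<open>x = 0, 1, 2\<close>. On the line \<open>x = a\<close> the polynomial is a
constant \<open>c\<close> times the product of the \<open>m\<close>-th powers of the three factors \<open>y - b\<close>, where \<open>c\<close> is the coefficient
of \<open>y^(3 m)\<close> and so does not depend on \<open>a\<close>. The coefficient of \<open>y^(3 m - 1)\<close> is an affine function of \<open>a\<close>. On the other
hand it is \<open>- c m\<close> times the sum of the values \<open>b\<close> on the line, and these sums \<open>3, 3, 4\<close> are not affine in \<open>a\<close>.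
So \<open>c = 0\<close>, the polynomial is divisible by \<open>x (x - 1) (x - 2)\<close>, and the quotient satisfies the
hypotheses for \<open>m - 1\<close>; in particular the omission of \<open>x^(3 m)\<close> from the stair passes to \<open>x^(3 m - 3)\<close>.\<close>

lemma nine_points_rows:
  assumes "\<And>j i. coeff (p j) i \<noteq> 0 \<Longrightarrow> (i, j) \<in> stair (3 * m) (3 * m)" "\<And>j. j > N \<Longrightarrow> p j = 0"
    "\<And>b. b \<in> {0, 1, 2} \<Longrightarrow> row_order N m 0 b p" "\<And>b. b \<in> {0, 1, 2} \<Longrightarrow> row_order N m 1 b p"
    "\<And>b. b \<in> {0, 1, 3} \<Longrightarrow> row_order N m 2 b p"
  shows "p j = 0"
  using assms
proof (induction m arbitrary: p j)
  case 0
  then have "coeff (p j) i = 0" for i by (force simp: stair_def)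
  then show ?case by (simp add: poly_eq_iff)
next
  case (Suc m)
  let ?M = "3 * Suc m"
  define c where "c = coeff (p ?M) 0"
  have cc: "coeff (column N p a) j = poly (p j) a" for a j by (rule coeff_column) (rule Suc.prems(2))
  have top: "p ?M = [:c:]"
  proof (rule poly_eqI)
    fix i
    have "i = 0" if "coeff (p ?M) i \<noteq> 0" using Suc.prems(1)[OF that] by (auto simp: stair_def)
    then show "coeff (p ?M) i = coeff [:c:] i" by (cases i) (auto simp: c_def)
  qed
  define c0 c1 where "c0 = coeff (p (?M - 1)) 0" and "c1 = coeff (p (?M - 1)) 1"
  have next_top: "p (?M - 1) = [:c0, c1:]"
  proof (rule poly_eqI)
    fix i
    have lt: "i < 2" if "coeff (p (?M - 1)) i \<noteq> 0" using Suc.prems(1)[OF that] by (auto simp: stair_def)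
    show "coeff (p (?M - 1)) i = coeff [:c0, c1:] i"
    proof (cases "i < 2")
      case True
      then show ?thesis unfolding c0_def c1_def by (auto simp: less_2_cases_iff)
    next
      case False
      then have "coeff [:c0, c1:] i = 0" by (intro coeff_eq_0) auto
      then show ?thesis using lt False by metis
    qed
  qed
  have col: "column N p a = smult c (linear_factors (concat (map (replicate (Suc m)) bs))) \<and>
      c0 + a * c1 = - c * of_nat (Suc m) * sum_list bs"
    if ord: "\<And>b. b \<in> set bs \<Longrightarrow> row_order N (Suc m) a b p" and bs: "distinct bs" "length bs = 3" for a bs
  proof -
    let ?rs = "concat (map (replicate (Suc m)) bs)"
    have len: "length ?rs = ?M" and sum: "sum_list ?rs = of_nat (Suc m) * sum_list bs"
    proof -
      obtain b0 b1 b2 where "bs = [b0, b1, b2]"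
        using bs(2) by (auto simp: numeral_3_eq_3 length_Suc_conv)
      then show "length ?rs = ?M" "sum_list ?rs = of_nat (Suc m) * sum_list bs"
        by (simp_all add: sum_list_replicate algebra_simps)
    qed
    have "linear_factors ?rs dvd column N p a"
      using row_order_column[OF ord] bs(1) by (intro linear_factors_dvd) auto
    then obtain s where s: "column N p a = linear_factors ?rs * s" by blast
    have "degree (column N p a) \<le> ?M"
    proof (rule degree_le, intro allI impI)
      fix i assume i: "?M < i"
      have "coeff (p i) l = 0" for l using Suc.prems(1)[of i l] i by (force simp: stair_def)
      then have "p i = 0" by (simp add: poly_eq_iff)
      then show "coeff (column N p a) i = 0" by (simp add: cc)
    qed
    then have "degree s = 0"
      unfolding s using degree_mult_eq[OF linear_factors_nonzero, of s ?rs] len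
      by (cases "s = 0") (auto simp: degree_linear_factors)
    then obtain r where r: "s = [:r:]" by (rule degree_eq_zeroE)
    have sr: "column N p a = smult r (linear_factors ?rs)" by (simp add: s r)
    have "c = r"
      using cc[of a ?M] lead_coeff_linear_factors[of ?rs] by (simp only: sr coeff_smult len top) simp
    moreover have "?rs \<noteq> []" using len by auto
    then have "c0 + a * c1 = - r * of_nat (Suc m) * sum_list bs"
      using cc[of a "?M - 1"] second_coeff_linear_factors[of ?rs]
      by (simp only: sr coeff_smult len next_top sum) (simp add: mult.assoc)
    ultimately show ?thesis using sr by simp
  qed
  note col0 = col[of "[0, 1, 2]" 0] and col1 = col[of "[0, 1, 2]" 1] and col2 = col[of "[0, 1, 3]" 2]
  have e: "c0 = - c * of_nat (Suc m) * 3" "c0 + c1 = - c * of_nat (Suc m) * 3" "c0 + 2 * c1 = - c * of_nat (Suc m) * 4"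
    using col0 col1 col2 Suc.prems(3-5) by auto
  \<comment> \<open>second difference of the values 3, 3, 4\<close>
  have "c * of_nat (Suc m) = 0" using e by algebra
  then have "c = 0" by (metis mult_eq_0_iff of_nat_eq_0_iff nat.distinct(1))
  then have "column N p 0 = 0" "column N p 1 = 0" "column N p 2 = 0"
    using col0 col1 col2 Suc.prems(3-5) by auto
  then have z: "poly (p j) 0 = 0" "poly (p j) 1 = 0" "poly (p j) 2 = 0" for j
    using cc[of 0 j] cc[of 1 j] cc[of 2 j] by auto
  obtain q1 where q1: "\<And>j. p j = [:- 0, 1:] * q1 j" using dvd_x_minus[of p, OF z(1)] by blast
  have "poly (q1 j) 1 = 0" "poly (q1 j) 2 = 0" for j using z(2,3)[of j] by (auto simp: q1)
  note z1 = this
  obtain q2 where q2: "\<And>j. q1 j = [:- 1, 1:] * q2 j" using dvd_x_minus[of q1, OF z1(1)] by blast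
  have z2: "poly (q2 j) 2 = 0" for j using z1(2)[of j] by (auto simp: q2)
  obtain q where q3: "\<And>j. q2 j = [:- 2, 1:] * q j" using dvd_x_minus[of q2, OF z2] by blast
  have pq: "p = (\<lambda>j. [:- 0, 1:] * ([:- 1, 1:] * ([:- 2, 1:] * q j)))"
    by (rule ext) (simp only: q1 q2 q3)
  have p_eq: "p j = linear_factors [0, 1, 2] * q j" for j
    unfolding pq by (simp only: linear_factors_simps mult.assoc mult_1_left)
  have "q j = 0"
  proof (rule Suc.IH[of q])
    fix j i assume ne: "coeff (q j) i \<noteq> 0"
    then have qj: "q j \<noteq> 0" by auto
    then have pj: "p j \<noteq> 0" "degree (p j) = 3 + degree (q j)"
      by (simp_all add: p_eq linear_factors_nonzero degree_mult_eq degree_linear_factors del: linear_factors_simps)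
    have "i \<le> degree (q j)" using ne by (rule le_degree)
    moreover have "(degree (p j), j) \<in> stair ?M ?M" using pj(1) by (intro Suc.prems(1)) simp
    ultimately show "(i, j) \<in> stair (3 * m) (3 * m)" using pj(2) by (auto simp: stair_def)
  next
    fix j assume "j > N"
    then show "q j = 0" using Suc.prems(2)[of j] linear_factors_nonzero[of "[0, 1, 2]"] by (simp only: p_eq mult_eq_0_iff) blast
  next
    fix b :: complex assume b: "b \<in> {0, 1, 2}"
    have "row_order N m 0 b (\<lambda>j. [:- 1, 1:] * ([:- 2, 1:] * q j))"
      by (rule row_order_div_x) (use Suc.prems(3)[OF b] in \<open>simp only: pq\<close>)
    then have "row_order N m 0 b (\<lambda>j. [:- 2, 1:] * q j)" by (rule row_order_div_x_unit) simp
    then show "row_order N m 0 b q" by (rule row_order_div_x_unit) simp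
    have "row_order N (Suc m) 1 b (\<lambda>j. [:- 1, 1:] * ([:- 2, 1:] * q j))"
      by (rule row_order_div_x_unit[of _ _ _ _ 0]) (use Suc.prems(4)[OF b] in \<open>simp_all only: pq\<close>, simp)
    then have "row_order N m 1 b (\<lambda>j. [:- 2, 1:] * q j)" by (rule row_order_div_x)
    then show "row_order N m 1 b q" by (rule row_order_div_x_unit) simp
  next
    fix b :: complex assume b: "b \<in> {0, 1, 3}"
    have "row_order N (Suc m) 2 b (\<lambda>j. [:- 1, 1:] * ([:- 2, 1:] * q j))"
      by (rule row_order_div_x_unit[of _ _ _ _ 0]) (use Suc.prems(5)[OF b] in \<open>simp_all only: pq\<close>, simp)
    then have "row_order N (Suc m) 2 b (\<lambda>j. [:- 2, 1:] * q j)" by (rule row_order_div_x_unit) simp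
    then show "row_order N m 2 b q" by (rule row_order_div_x)
  qed
  then show ?case by (simp add: p_eq)
qed

definition rows :: "(nat \<times> nat) set \<Rightarrow> nat \<Rightarrow> (nat \<times> nat \<Rightarrow> complex) \<Rightarrow> nat \<Rightarrow> complex poly" where
  "rows E D v j = (\<Sum>i\<le>D. monom (if (i, j) \<in> E then v (i, j) else 0) i)"

lemma stair_subset_box: "t \<le> D \<Longrightarrow> stair D t \<subseteq> {..D} \<times> {..D}"
  by (auto simp: stair_def)

lemma coeff_rows: "t \<le> D \<Longrightarrow> coeff (rows (stair D t) D v j) i = (if (i, j) \<in> stair D t then v (i, j) else 0)"
  using stair_subset_box[of t D] by (auto simp: rows_def coeff_sum)

lemma row_taylor_rows:
  assumes "t \<le> D"
  shows "row_taylor D a b \<alpha> \<beta> (rows (stair D t) D v) = (\<Sum>f\<in>stair D t. taylor a b (\<alpha>, \<beta>) f * v f)"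
proof -
  let ?u = "\<lambda>f. if f \<in> stair D t then v f else 0"
  have "row_taylor D a b \<alpha> \<beta> (rows (stair D t) D v) = (\<Sum>j\<le>D. \<Sum>i\<le>D. taylor a b (\<alpha>, \<beta>) (i, j) * ?u (i, j))"
    unfolding row_taylor_def rows_def pcompose_sum coeff_sum coeff_monom_pcompose sum_distrib_right
    by (intro sum.cong refl) (simp add: taylor_def mult_ac)
  also have "\<dots> = (\<Sum>f\<in>{..D} \<times> {..D}. taylor a b (\<alpha>, \<beta>) f * ?u f)"
    by (subst sum.swap) (simp add: sum.cartesian_product)
  also have "\<dots> = (\<Sum>f\<in>stair D t. taylor a b (\<alpha>, \<beta>) f * v f)"
    using stair_subset_box[OF assms] by (intro sum.mono_neutral_cong_right) auto
  finally show ?thesis .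
qed

lemma unisolventI:
  fixes pts :: "(complex \<times> complex) list"
  assumes "t \<le> D"
    and "\<And>p. (\<And>j i. coeff (p j) i \<noteq> 0 \<Longrightarrow> (i, j) \<in> stair D t) \<Longrightarrow> (\<And>j. j > D \<Longrightarrow> p j = 0) \<Longrightarrow>
      (\<And>a b. (a, b) \<in> set pts \<Longrightarrow> row_order D m a b p) \<Longrightarrow> \<forall>j. p j = 0"
  shows "unisolvent (length pts) (stair D t) m"
  unfolding unisolvent_def
proof (intro exI allI impI ballI)
  fix v f
  assume z: "\<forall>j<length pts. \<forall>e\<in>fat m. (\<Sum>f\<in>stair D t. taylor (fst (pts ! j)) (snd (pts ! j)) e f * v f) = 0"
    and f: "f \<in> stair D t"
  have "\<forall>j. rows (stair D t) D v j = 0"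
  proof (rule assms(2))
    fix j i assume "coeff (rows (stair D t) D v j) i \<noteq> 0"
    then show "(i, j) \<in> stair D t" by (simp add: coeff_rows[OF assms(1)] split: if_splits)
  next
    fix j assume "j > D"
    then show "rows (stair D t) D v j = 0"
      using stair_subset_box[OF assms(1)] by (auto simp: rows_def intro!: sum.neutral)
  next
    fix a b assume "(a, b) \<in> set pts"
    then obtain j where "j < length pts" "pts ! j = (a, b)" by (auto simp: in_set_conv_nth)
    then show "row_order D m a b (rows (stair D t) D v)"
      using z unfolding row_order_def row_taylor_rows[OF assms(1)] by (force simp: fat_def)
  qed
  then have "coeff (rows (stair D t) D v (snd f)) (fst f) = 0" by simp
  then show "v f = 0" using f by (simp add: coeff_rows[OF assms(1)])
qed

lemma max_rank_times_4: assumes "max_rank n" shows "max_rank (n * 4)"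
proof (rule max_rank_mult[OF assms, of "\<lambda>m. m" "\<lambda>m. 2 * m"])
  fix m
  have "unisolvent (length [(1, 0), (2, 0), (0, 1), (0, 2) :: complex \<times> complex]) (stair (2 * m) m) m"
    (is "unisolvent (length ?pts) _ _")
    by (rule unisolventI) (use four_points_rows[of _ m "2 * m"] in auto)
  moreover have "length ?pts = 4" by simp
  ultimately show "unisolvent 4 (stair (2 * m) m) m" by (simp only:)
  have "2 * card (fat (2 * m)) = 2 * m * (2 * m + 1)" "2 * card (fat m) = m * (m + 1)" by (rule card_fat)+
  then show "card (stair (2 * m) m) = 4 * card (fat m)" by (simp add: card_stair algebra_simps)
qed simp

lemma max_rank_times_9: assumes "max_rank n" shows "max_rank (n * 9)"
proof (rule max_rank_mult[OF assms, of "\<lambda>m. 3 * m" "\<lambda>m. 3 * m"])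
  fix m
  have "unisolvent (length [(0, 0), (0, 1), (0, 2), (1, 0), (1, 1), (1, 2), (2, 0), (2, 1), (2, 3) :: complex \<times> complex])
      (stair (3 * m) (3 * m)) m"
    (is "unisolvent (length ?pts) _ _")
  proof (rule unisolventI, simp, rule allI)
    fix p and j :: nat
    assume p: "\<And>j i. coeff (p j) i \<noteq> 0 \<Longrightarrow> (i, j) \<in> stair (3 * m) (3 * m)" "\<And>j. j > 3 * m \<Longrightarrow> p j = 0"
      and ord: "\<And>a b. (a, b) \<in> set ?pts \<Longrightarrow> row_order (3 * m) m a b p"
    show "p j = 0"
    proof (rule nine_points_rows[OF p])
      show "row_order (3 * m) m 0 b p" if "b \<in> {0, 1, 2}" for b by (rule ord) (use that in auto)
      show "row_order (3 * m) m 1 b p" if "b \<in> {0, 1, 2}" for b by (rule ord) (use that in auto)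
      show "row_order (3 * m) m 2 b p" if "b \<in> {0, 1, 3}" for b by (rule ord) (use that in auto)
    qed
  qed
  moreover have "length ?pts = 9" by simp
  ultimately show "unisolvent 9 (stair (3 * m) (3 * m)) m" by (simp only:)
  have "2 * card (fat (3 * m)) = 3 * m * (3 * m + 1)" "2 * card (fat m) = m * (m + 1)" by (rule card_fat)+
  then show "card (stair (3 * m) (3 * m)) = 9 * card (fat m)" by (simp add: card_stair algebra_simps)
qed simp

theorem max_rank_4_9: "max_rank (4 ^ h * 9 ^ k)"
proof (induction h)
  case 0
  show ?case
  proof (induction k)
    case 0
    then show ?case using max_rank_1 by simp
  next
    case (Suc k)
    then show ?case using max_rank_times_9 by (fastforce simp: mult_ac)
  qed
next
  case (Suc h)
  then show ?case using max_rank_times_4 by (fastforce simp: mult_ac)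
qed

section \<open>Ternary forms and change of chart\<close>

text \<open>Ternary forms are compared through their values; evaluation turns substitution into composition.\<close>

definition eval3 :: "(3 \<Rightarrow> complex) \<Rightarrow> mpoly3 \<Rightarrow> complex" where
  "eval3 X F = (\<Sum>a\<in>Poly_Mapping.keys F. Poly_Mapping.lookup F a * (\<Prod>i\<in>UNIV. X i ^ (a $ i)))"

lemma eval3_superset:
  assumes "finite A" "Poly_Mapping.keys F \<subseteq> A"
  shows "eval3 X F = (\<Sum>a\<in>A. Poly_Mapping.lookup F a * (\<Prod>i\<in>UNIV. X i ^ (a $ i)))"
  unfolding eval3_def using assms by (intro sum.mono_neutral_left) (auto simp: in_keys_iff)

lemma eval3_add: "eval3 X (F + G) = eval3 X F + eval3 X G"
proof -
  let ?A = "Poly_Mapping.keys F \<union> Poly_Mapping.keys G"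
  have "Poly_Mapping.keys (F + G) \<subseteq> ?A" by (rule Poly_Mapping.keys_add)
  then show ?thesis
    by (simp add: eval3_superset[of ?A] lookup_add distrib_right sum.distrib)
qed

lemma eval3_single: "eval3 X (Poly_Mapping.single a c) = c * (\<Prod>i\<in>UNIV. X i ^ (a $ i))"
  by (subst eval3_superset[of "{a}"]) auto

lemma eval3_0 [simp]: "eval3 X 0 = 0"
  by (simp add: eval3_def)

lemma eval3_sum: "eval3 X (\<Sum>s\<in>S. f s) = (\<Sum>s\<in>S. eval3 X (f s))"
  by (induction S rule: infinite_finite_induct) (simp_all add: eval3_add)

lemma mpoly3_as_sum:
  fixes F :: mpoly3
  assumes "finite A" "Poly_Mapping.keys F \<subseteq> A"
  shows "F = (\<Sum>a\<in>A. Poly_Mapping.single a (Poly_Mapping.lookup F a))"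
proof (rule poly_mapping_eqI)
  fix b
  have "(\<Sum>a\<in>A. Poly_Mapping.lookup (Poly_Mapping.single a (Poly_Mapping.lookup F a)) b) = (\<Sum>a\<in>A. if a = b then Poly_Mapping.lookup F b else 0)"
    by (rule sum.cong) (auto simp: lookup_single when_def)
  then show "Poly_Mapping.lookup F b = Poly_Mapping.lookup (\<Sum>a\<in>A. Poly_Mapping.single a (Poly_Mapping.lookup F a)) b"
    using assms by (auto simp: lookup_sum in_keys_iff subset_iff)
qed

lemma eval3_mult: "eval3 X (F * G) = eval3 X F * eval3 X G"
proof -
  have F: "F = (\<Sum>a\<in>Poly_Mapping.keys F. Poly_Mapping.single a (Poly_Mapping.lookup F a))" by (rule mpoly3_as_sum) simp_all
  have G: "G = (\<Sum>a\<in>Poly_Mapping.keys G. Poly_Mapping.single a (Poly_Mapping.lookup G a))" by (rule mpoly3_as_sum) simp_all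
  have "eval3 X (F * G) = eval3 X ((\<Sum>a\<in>Poly_Mapping.keys F. Poly_Mapping.single a (Poly_Mapping.lookup F a)) *
      (\<Sum>a\<in>Poly_Mapping.keys G. Poly_Mapping.single a (Poly_Mapping.lookup G a)))"
    using F G by simp
  also have "\<dots> = eval3 X F * eval3 X G"
    unfolding eval3_def[of X F] eval3_def[of X G]
    by (simp add: sum_product eval3_sum mult_single eval3_single power_add prod.distrib mult_ac)
  finally show ?thesis .
qed

lemma eval3_const3 [simp]: "eval3 X (const3 c) = c"
  by (simp add: const3_def eval3_single)

lemma eval3_1 [simp]: "eval3 X 1 = 1"
  using eval3_const3[of X 1] by (simp add: const3_def)

lemma eval3_var3 [simp]: "eval3 X (var3 i) = X i"
proof -
  have "(\<Prod>j\<in>UNIV. X j ^ (if j = i then 1 else 0)) = (\<Prod>j\<in>UNIV. if j = i then X j else 1)"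
    by (rule prod.cong) auto
  then show ?thesis by (simp add: var3_def eval3_single)
qed

lemma eval3_power: "eval3 X (F ^ n) = eval3 X F ^ n"
  by (induction n) (simp_all add: eval3_mult)

lemma eval3_prod: "eval3 X (\<Prod>s\<in>S. f s) = (\<Prod>s\<in>S. eval3 X (f s))"
  by (induction S rule: infinite_finite_induct) (simp_all add: eval3_mult)

lemma eval3_msubst: "eval3 X (msubst g F) = eval3 (\<lambda>i. eval3 X (g i)) F"
  by (simp add: msubst_def eval3_sum eval3_mult eval3_prod eval3_power) (simp add: eval3_def)

lemma eval3_local_expansion:
  "eval3 X (local_expansion i q F) = eval3 (\<lambda>j. if j = i then 1 else X j + q $ j / q $ i) F"
  unfolding local_expansion_def eval3_msubst
  by (rule arg_cong[of _ _ "\<lambda>Y. eval3 Y F"]) (auto simp: eval3_add)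

lemma eval3_homogeneous:
  assumes "homogeneous d F"
  shows "eval3 (\<lambda>i. c * X i) F = c ^ d * eval3 X F"
proof -
  have "(\<Prod>i\<in>UNIV. (c * X i) ^ (a $ i)) = c ^ d * (\<Prod>i\<in>UNIV. X i ^ (a $ i))" if "a \<in> Poly_Mapping.keys F" for a
  proof -
    have "mdeg a = d" using assms that by (simp add: homogeneous_def)
    then show ?thesis by (simp add: power_mult_distrib prod.distrib power_sum[symmetric] mdeg_def)
  qed
  then show ?thesis by (simp add: eval3_def sum_distrib_left mult_ac)
qed

text \<open>Polynomials without the variable of index \<open>i\<close> form a subring that contains all the substituted
polynomials.\<close>

lemma keys_local_expansion:
  assumes "a \<in> Poly_Mapping.keys (local_expansion i q F)"
  shows "a $ i = 0"
proof -
  define good :: "mpoly3 \<Rightarrow> bool" where "good G \<longleftrightarrow> (\<forall>a\<in>Poly_Mapping.keys G. a $ i = 0)" for G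
  have add: "good (G + H)" if "good G" "good H" for G H
    using that Poly_Mapping.keys_add[of G H] by (auto simp: good_def)
  have mult: "good (G * H)" if "good G" "good H" for G H
    using that keys_mult[of G H] by (force simp: good_def)
  have zero: "good 0" by (simp add: good_def)
  have const: "good (const3 c)" for c by (auto simp: good_def const3_def)
  have one: "good 1" using const[of 1] by (simp add: const3_def)
  have var: "good (var3 j)" if "j \<noteq> i" for j using that by (auto simp: good_def var3_def)
  have power: "good (G ^ n)" if "good G" for G n by (induction n) (simp_all add: one mult that)
  have prod: "good (\<Prod>s\<in>S. f s)" if "\<And>s. s \<in> S \<Longrightarrow> good (f s)" for f :: "3 \<Rightarrow> mpoly3" and S
    using that by (induction S rule: infinite_finite_induct) (simp_all add: one mult)
  have sum: "good (\<Sum>s\<in>S. f s)" if "\<And>s. s \<in> S \<Longrightarrow> good (f s)" for f :: "nat ^ 3 \<Rightarrow> mpoly3" and S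
    using that by (induction S rule: infinite_finite_induct) (simp_all add: zero add)
  have "good (local_expansion i q F)"
    unfolding local_expansion_def msubst_def
    by (intro sum mult const prod power) (auto intro: one add var const)
  then show ?thesis using assms by (simp add: good_def)
qed

text \<open>The order of vanishing of a polynomial at \<open>0\<close> is visible from its growth, which survives the
rational change of variables between two charts.\<close>

lemma X_power_dvd_if_small:
  fixes Q :: "complex poly"
  assumes "\<forall>\<^sub>F t in at 0. poly Q t = t ^ m * h t" "(h \<longlongrightarrow> L) (at 0)"
  shows "[:0, 1:] ^ m dvd Q"
  using assms(1)
proof (induction m arbitrary: Q)
  case 0
  then show ?case by simp
next
  case (Suc m)
  have "((\<lambda>t. t ^ Suc m * h t) \<longlongrightarrow> 0 ^ Suc m * L) (at 0)"
    by (intro tendsto_intros assms(2))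
  then have "(poly Q \<longlongrightarrow> 0) (at 0)"
    using Suc.prems by (simp add: filterlim_cong)
  moreover have "(poly Q \<longlongrightarrow> poly Q 0) (at 0)"
    using poly_isCont[of 0 Q] by (simp add: isCont_def)
  ultimately have "poly Q 0 = 0" using tendsto_unique[OF trivial_limit_at] by blast
  then obtain R where R: "Q = [:0, 1:] * R" by (auto simp: poly_eq_0_iff_dvd)
  have "\<forall>\<^sub>F t in at 0. poly R t = t ^ m * h t"
    using Suc.prems eventually_neq_at_within[of 0 0 UNIV]
  proof eventually_elim
    case (elim t)
    then have "t * poly R t = t * (t ^ m * h t)" by (simp add: R mult.assoc)
    then show ?case using elim(2) by simp
  qed
  from Suc.IH[OF this] show ?case unfolding R power_Suc by (rule mult_dvd_mono[OF dvd_refl])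
qed

text \<open>Restriction of \<open>G\<close> to the line through the origin in direction \<open>v\<close>; its coefficient of \<open>t^k\<close> is the value
at \<open>v\<close> of the homogeneous part of degree \<open>k\<close>.\<close>

definition line_poly :: "mpoly3 \<Rightarrow> (3 \<Rightarrow> complex) \<Rightarrow> complex poly" where
  "line_poly G v = (\<Sum>a\<in>Poly_Mapping.keys G. monom (Poly_Mapping.lookup G a * (\<Prod>i\<in>UNIV. v i ^ (a $ i))) (mdeg a))"

lemma poly_line_poly: "poly (line_poly G v) t = eval3 (\<lambda>i. t * v i) G"
  by (simp add: line_poly_def eval3_def poly_sum poly_monom power_mult_distrib prod.distrib
      power_sum[symmetric] mdeg_def mult_ac)

lemma other_indices: "\<exists>j l :: 3. j \<noteq> k \<and> l \<noteq> k \<and> j \<noteq> l \<and> UNIV = {k, j, l}"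
proof -
  have d: "(1::3) \<noteq> 2" "(1::3) \<noteq> 3" "(2::3) \<noteq> 3" by simp_all
  have perm: "{1, 2, 3 :: 3} = {2, 1, 3}" "{1, 2, 3 :: 3} = {3, 1, 2}" by blast+
  consider "k = 1" | "k = 2" | "k = 3" using exhaust_3[of k] by blast
  then show ?thesis
  proof cases
    case 1
    show ?thesis unfolding 1 UNIV_3
      by (rule exI[of _ 2], rule exI[of _ 3], intro conjI d d[symmetric] refl)
  next
    case 2
    show ?thesis unfolding 2 UNIV_3
      by (rule exI[of _ 1], rule exI[of _ 3], intro conjI d d[symmetric] perm)
  next
    case 3
    show ?thesis unfolding 3 UNIV_3
      by (rule exI[of _ 1], rule exI[of _ 2], intro conjI d d[symmetric] perm)
  qed
qed

lemma vec3_eq_iff_others: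
  assumes "UNIV = {k, j, l :: 3}"
  shows "a = b \<longleftrightarrow> a $ k = b $ k \<and> a $ j = b $ j \<and> a $ l = b $ l"
  using assms unfolding vec_eq_iff by (metis UNIV_I insertE singletonD)

lemma mdeg_others:
  assumes "j \<noteq> k" "l \<noteq> k" "j \<noteq> l" "UNIV = {k, j, l :: 3}"
  shows "mdeg a = a $ k + a $ j + a $ l"
  unfolding mdeg_def assms(4) using assms(1-3) by simp

lemma form_coeffs_eq_0:
  assumes jl: "j \<noteq> k" "l \<noteq> k" "j \<noteq> l" "UNIV = {k, j, l :: 3}"
    and A: "finite A" "\<And>a. a \<in> A \<Longrightarrow> a $ k = 0"
    and z: "\<And>v. (\<Sum>a\<in>A. g a * (\<Prod>i\<in>UNIV. v i ^ (a $ i))) = (0::complex)" and b: "b \<in> A"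
  shows "g b = 0"
proof -
  define pr where "pr a = (a $ j, a $ l)" for a :: "nat ^ 3"
  have inj: "inj_on pr A" using A(2) by (auto simp: inj_on_def pr_def vec3_eq_iff_others[OF jl(4)])
  define h where "h e = g (the_inv_into A pr e)" for e
  have hp: "h (pr a) = g a" if "a \<in> A" for a using that inj by (simp add: h_def the_inv_into_f_f)
  have "h (pr b) = 0"
  proof (rule bivariate_coeffs_eq_0[of "pr ` A"])
    fix u w :: complex
    define v where "v i = (if i = j then u else if i = l then w else 0)" for i
    have pv: "(\<Prod>i\<in>UNIV. v i ^ (a $ i)) = u ^ (a $ j) * w ^ (a $ l)" if "a \<in> A" for a
      unfolding jl(4) using jl(1-3) A(2)[OF that] by (auto simp: v_def)
    have "(\<Sum>e\<in>pr ` A. h e * (u ^ fst e * w ^ snd e)) = (\<Sum>a\<in>A. g a * (\<Prod>i\<in>UNIV. v i ^ (a $ i)))"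
      unfolding sum.reindex[OF inj] comp_def by (rule sum.cong) (simp_all add: hp pv, simp add: pr_def)
    then show "(\<Sum>e\<in>pr ` A. h e * (u ^ fst e * w ^ snd e)) = 0" using z by simp
  qed (use A b in auto)
  then show ?thesis using hp b by simp
qed

text \<open>Let \<open>c\<close> be the quotient of the coordinates \<open>i\<close> and \<open>k\<close> of \<open>q\<close>. A line through the point in chart \<open>k\<close> with direction
\<open>v\<close> is carried to chart \<open>i\<close> by dividing by \<open>\<rho> = c (1 + t \<mu>)\<close>, where it becomes a line with direction \<open>u\<close> and
parameter \<open>s t = t / \<rho>\<close>. By homogeneity the two restrictions differ by the factor \<open>\<rho> ^ d\<close>. As \<open>\<rho>\<close> tends
to \<open>c \<noteq> 0\<close>, the restriction vanishes at \<open>t = 0\<close> to order \<open>m\<close> in one chart if it does so in the other.\<close>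

lemma chart_independence:
  assumes F: "homogeneous d F" and i: "q $ i \<noteq> 0"
    and ord: "\<And>a. a \<in> Poly_Mapping.keys (local_expansion i q F) \<Longrightarrow> m \<le> mdeg a"
  shows "vanishes_to_order m q F"
  unfolding vanishes_to_order_def
proof (intro allI impI ballI)
  fix k a assume k: "q $ k \<noteq> 0" and a: "a \<in> Poly_Mapping.keys (local_expansion k q F)"
  let ?G = "local_expansion k q F"
  have dvd: "[:0, 1:] ^ m dvd line_poly ?G w" for w
  proof -
    define v where "v j = (if j = k then 0 else w j)" for j
    define c where "c = q $ i / q $ k"
    define \<mu> where "\<mu> = v i / c"
    define u where "u j = v j - v i * (q $ j / q $ i)" for j
    have c0: "c \<noteq> 0" using i k by (simp add: c_def)
    have G_eval: "poly (line_poly ?G w) t = eval3 (\<lambda>j. q $ j / q $ k + t * v j) F" for t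
      unfolding poly_line_poly eval3_local_expansion
      by (rule arg_cong[of _ _ "\<lambda>Y. eval3 Y F"]) (use k in \<open>auto simp: v_def\<close>)
    have E_eval: "poly (line_poly (local_expansion i q F) u) s = eval3 (\<lambda>j. q $ j / q $ i + s * u j) F" for s
      unfolding poly_line_poly eval3_local_expansion
      by (rule arg_cong[of _ _ "\<lambda>Y. eval3 Y F"]) (use i in \<open>auto simp: u_def\<close>)
    have "[:0, 1:] ^ m dvd line_poly (local_expansion i q F) u"
      unfolding line_poly_def
    proof (rule dvd_sum)
      fix a assume "a \<in> Poly_Mapping.keys (local_expansion i q F)"
      from ord[OF this] have "monom 1 m dvd monom x (mdeg a)" for x :: complex
        by (simp add: monom_1_dvd_iff')
      then show "[:0, 1:] ^ m dvd monom (Poly_Mapping.lookup (local_expansion i q F) a * (\<Prod>i\<in>UNIV. u i ^ (a $ i))) (mdeg a)"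
        by (simp add: monom_altdef)
    qed
    then obtain R where R: "line_poly (local_expansion i q F) u = [:0, 1:] ^ m * R" by blast
    define s where "s t = t / (c * (1 + t * \<mu>))" for t
    define h where "h t = (c * (1 + t * \<mu>)) ^ d * (1 / (c * (1 + t * \<mu>))) ^ m * poly R (s t)" for t
    have "(s \<longlongrightarrow> 0 / (c * (1 + 0 * \<mu>))) (at 0)"
      unfolding s_def by (intro tendsto_intros) (use c0 in simp)
    then have s0: "(s \<longlongrightarrow> 0) (at 0)" by simp
    have "((\<lambda>t. poly R (s t)) \<longlongrightarrow> poly R 0) (at 0)"
      by (rule isCont_tendsto_compose[OF poly_isCont s0])
    then have h0: "(h \<longlongrightarrow> (c * (1 + 0 * \<mu>)) ^ d * (1 / (c * (1 + 0 * \<mu>))) ^ m * poly R 0) (at 0)"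
      unfolding h_def by (intro tendsto_intros s0) (use c0 in simp_all)
    have "((\<lambda>t. 1 + t * \<mu>) \<longlongrightarrow> 1 + 0 * \<mu>) (at 0)" by (intro tendsto_intros)
    then have "\<forall>\<^sub>F t in at 0. 1 + t * \<mu> \<noteq> 0"
      by (rule tendsto_imp_eventually_ne) simp
    then have "\<forall>\<^sub>F t in at 0. poly (line_poly ?G w) t = t ^ m * h t"
    proof eventually_elim
      case (elim t)
      define \<rho> where "\<rho> = c * (1 + t * \<mu>)"
      have \<rho>: "\<rho> \<noteq> 0" "\<rho> = c + t * v i"
        using elim c0 by (simp add: \<rho>_def, simp add: \<rho>_def \<mu>_def distrib_left)
      have st: "s t = t / \<rho>" by (simp only: s_def \<rho>_def)
      have "q $ j / q $ k + t * v j = \<rho> * (q $ j / q $ i + s t * u j)" for j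
      proof -
        have "\<rho> * (q $ j / q $ i + s t * u j) = \<rho> * (q $ j / q $ i) + t * u j"
          using \<rho>(1) by (simp add: st distrib_left)
        also have "\<dots> = c * (q $ j / q $ i) + t * v j"
          by (simp add: \<rho>(2) u_def algebra_simps add_divide_distrib)
        also have "c * (q $ j / q $ i) = q $ j / q $ k" using i by (simp add: c_def)
        finally show ?thesis by simp
      qed
      then have "poly (line_poly ?G w) t = \<rho> ^ d * poly (line_poly (local_expansion i q F) u) (s t)"
        unfolding G_eval E_eval by (simp add: eval3_homogeneous[OF F])
      also have "\<dots> = \<rho> ^ d * ((t / \<rho>) ^ m * poly R (s t))"
        by (simp add: R st)
      also have "\<dots> = t ^ m * h t"
        by (simp only: h_def \<rho>_def[symmetric]) (simp add: power_divide)
      finally show ?case .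
    qed
    then show ?thesis using h0 by (rule X_power_dvd_if_small)
  qed
  obtain j l where jl: "j \<noteq> k" "l \<noteq> k" "j \<noteq> l" "UNIV = {k, j, l :: 3}"
    using other_indices[of k] by blast
  show "m \<le> mdeg a"
  proof (rule ccontr)
    assume less: "\<not> m \<le> mdeg a"
    let ?A = "{b \<in> Poly_Mapping.keys ?G. mdeg b = mdeg a}"
    have "Poly_Mapping.lookup ?G a = 0"
    proof (rule form_coeffs_eq_0[OF jl, of ?A])
      fix v
      have "monom 1 m dvd line_poly ?G v" using dvd[of v] by (simp add: monom_altdef)
      then have "coeff (line_poly ?G v) (mdeg a) = 0" using less by (simp add: monom_1_dvd_iff')
      moreover have "coeff (line_poly ?G v) (mdeg a) = (\<Sum>b\<in>?A. Poly_Mapping.lookup ?G b * (\<Prod>i\<in>UNIV. v i ^ (b $ i)))"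
        by (simp add: line_poly_def coeff_sum sum.inter_filter[symmetric] if_distrib)
      ultimately show "(\<Sum>b\<in>?A. Poly_Mapping.lookup ?G b * (\<Prod>i\<in>UNIV. v i ^ (b $ i))) = 0" by simp
    qed (use a keys_local_expansion in auto)
    then show False using a by (simp add: in_keys_iff)
  qed
qed

section \<open>Dimensions of systems of plane curves\<close>

lemma lin_subspace_lookup:
  assumes "mpoly3.subspace V"
  shows "lin_subspace (Poly_Mapping.lookup ` V)"
  unfolding lin_subspace_def
proof (intro conjI ballI allI)
  have "0 \<in> V" using assms by (rule mpoly3.subspace_0)
  then show "(\<lambda>i. 0) \<in> Poly_Mapping.lookup ` V" by (rule rev_image_eqI) (simp add: fun_eq_iff)
next
  fix u v a b assume "u \<in> Poly_Mapping.lookup ` V" "v \<in> Poly_Mapping.lookup ` V"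
  then obtain F G where FG: "F \<in> V" "G \<in> V" "u = Poly_Mapping.lookup F" "v = Poly_Mapping.lookup G" by blast
  have "mscale a F + mscale b G \<in> V"
    using assms FG by (intro mpoly3.subspace_add mpoly3.subspace_scale)
  then show "(\<lambda>i. a * u i + b * v i) \<in> Poly_Mapping.lookup ` V"
    by (rule rev_image_eqI) (simp add: fun_eq_iff lookup_add lookup_mscale FG)
qed

text \<open>This identifies the dimension of a space of forms with the number of coordinates of a dual
basis, so that upper and lower bounds can be proved on coefficient vectors.\<close>

lemma dim_eq_card_coordinates:
  assumes V: "mpoly3.subspace V" and K: "finite K" "separates K (Poly_Mapping.lookup ` V)"
  shows "\<exists>K'\<subseteq>K. separates K' (Poly_Mapping.lookup ` V) \<and> mpoly3_dim V = card K'"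
proof -
  from dual_basis[OF lin_subspace_lookup[OF V] K] obtain K' w where K': "K' \<subseteq> K"
    "separates K' (Poly_Mapping.lookup ` V)" "\<forall>k\<in>K'. w k \<in> Poly_Mapping.lookup ` V"
    "\<forall>k\<in>K'. \<forall>l\<in>K'. w k l = (if l = k then 1 else 0)"
    "\<forall>v\<in>Poly_Mapping.lookup ` V. \<forall>i. v i = (\<Sum>k\<in>K'. v k * w k i)"
    by blast
  have fin: "finite K'" using K'(1) K(1) finite_subset by blast
  have "\<forall>k\<in>K'. \<exists>F. F \<in> V \<and> w k = Poly_Mapping.lookup F" using K'(3) by blast
  then obtain W where W: "\<And>k. k \<in> K' \<Longrightarrow> W k \<in> V" "\<And>k. k \<in> K' \<Longrightarrow> w k = Poly_Mapping.lookup (W k)" by metis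
  have Wl: "Poly_Mapping.lookup (W k) l = (if l = k then 1 else 0)" if "k \<in> K'" "l \<in> K'" for k l
    using K'(4) W(2) that by metis
  have inj: "inj_on W K'"
  proof (rule inj_onI)
    fix k l assume kl: "k \<in> K'" "l \<in> K'" "W k = W l"
    then have "Poly_Mapping.lookup (W l) k = 1" using Wl[of k k] by simp
    then show "k = l" using Wl[of l k] kl by (auto split: if_splits)
  qed
  have span: "V \<subseteq> mpoly3.span (W ` K')"
  proof
    fix F assume F: "F \<in> V"
    have "F = (\<Sum>k\<in>K'. mscale (Poly_Mapping.lookup F k) (W k))"
    proof (rule poly_mapping_eqI)
      fix i
      have "Poly_Mapping.lookup F i = (\<Sum>k\<in>K'. Poly_Mapping.lookup F k * w k i)" using K'(5) F by blast
      also have "\<dots> = (\<Sum>k\<in>K'. Poly_Mapping.lookup F k * Poly_Mapping.lookup (W k) i)"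
        by (rule sum.cong) (simp_all add: W(2))
      finally show "Poly_Mapping.lookup F i = Poly_Mapping.lookup (\<Sum>k\<in>K'. mscale (Poly_Mapping.lookup F k) (W k)) i"
        by (simp add: lookup_sum lookup_mscale)
    qed
    moreover have "(\<Sum>k\<in>K'. mscale (Poly_Mapping.lookup F k) (W k)) \<in> mpoly3.span (W ` K')"
      by (intro mpoly3.span_sum mpoly3.span_scale mpoly3.span_base) blast
    ultimately show "F \<in> mpoly3.span (W ` K')" by (simp only:)
  qed
  have indep: "mpoly3.independent (W ` K')"
  proof (rule mpoly3.independent_if_scalars_zero)
    show "finite (W ` K')" using fin by blast
    fix f F assume s: "(\<Sum>x\<in>W ` K'. mscale (f x) x) = 0" and "F \<in> W ` K'"
    then obtain k where k: "k \<in> K'" "F = W k" by blast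
    have "(\<Sum>l\<in>K'. mscale (f (W l)) (W l)) = 0" using s by (simp add: sum.reindex[OF inj])
    then have "Poly_Mapping.lookup (\<Sum>l\<in>K'. mscale (f (W l)) (W l)) k = 0" by simp
    then have "(\<Sum>l\<in>K'. f (W l) * Poly_Mapping.lookup (W l) k) = 0" by (simp add: lookup_sum lookup_mscale)
    moreover have "(\<Sum>l\<in>K'. f (W l) * Poly_Mapping.lookup (W l) k) = (\<Sum>l\<in>K'. if l = k then f (W k) else 0)"
      by (rule sum.cong) (auto simp: Wl k)
    ultimately show "f F = 0" using fin k by simp
  qed
  have "W ` K' \<subseteq> V" using W(1) by blast
  from mpoly3.dim_unique[OF this span indep] have "mpoly3_dim V = card K'" by (simp add: card_image[OF inj])
  then show ?thesis using K'(1,2) by blast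
qed

definition exponent :: "nat \<Rightarrow> nat \<times> nat \<Rightarrow> nat ^ 3" where
  "exponent d e = vector [fst e, snd e, d - (fst e + snd e)]"

lemma exponent_simps [simp]:
  "exponent d e $ 1 = fst e" "exponent d e $ 2 = snd e" "exponent d e $ 3 = d - (fst e + snd e)"
  by (simp_all add: exponent_def vector_3)

lemma prod_UNIV_3: "(\<Prod>i\<in>(UNIV :: 3 set). f i) = f 1 * f 2 * (f 3 :: complex)"
proof -
  have "(1::3) \<noteq> 2" "(1::3) \<noteq> 3" "(2::3) \<noteq> 3" by simp_all
  then show ?thesis unfolding UNIV_3 by (simp add: mult.assoc)
qed

lemma mdeg_3: "mdeg a = a $ 1 + a $ 2 + a $ 3"
  by (simp add: mdeg_def sum_3)

lemma inj_exponent: "inj (exponent d)"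
  by (rule injI) (auto simp: vec_eq_iff forall_3 prod_eq_iff)

lemma exponents_eq: "{a. mdeg a = d} = exponent d ` monomials d"
proof
  show "{a. mdeg a = d} \<subseteq> exponent d ` monomials d"
  proof
    fix a assume "a \<in> {a. mdeg a = d}"
    then show "a \<in> exponent d ` monomials d"
      by (intro rev_image_eqI[of "(a $ 1, a $ 2)"]) (auto simp: monomials_def mdeg_3 vec_eq_iff forall_3)
  qed
qed (auto simp: monomials_def mdeg_3)

lemma finite_exponents: "finite {a. mdeg a = d}"
  unfolding exponents_eq by blast

lemma card_exponents: "card {a. mdeg a = d} = card (monomials d)"
  unfolding exponents_eq by (rule card_image[OF inj_on_subset[OF inj_exponent]]) simp

lemma card_monomials: "2 * card (monomials d) = (d + 1) * (d + 2)"
proof -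
  have "monomials d = fat (Suc d)" by (auto simp: monomials_def fat_def)
  then show ?thesis using card_fat[of "Suc d"] by (simp add: algebra_simps)
qed

text \<open>The coefficients of the dehomogenization in the chart in which the third coordinate is \<open>1\<close>.\<close>

definition affine_coeffs :: "nat \<Rightarrow> mpoly3 \<Rightarrow> nat \<times> nat \<Rightarrow> complex" where
  "affine_coeffs d F e = (if e \<in> monomials d then Poly_Mapping.lookup F (exponent d e) else 0)"

lemma eval3_affine:
  assumes "homogeneous d F"
  shows "eval3 X F = (\<Sum>e\<in>monomials d. affine_coeffs d F e * (X 1 ^ fst e * X 2 ^ snd e * X 3 ^ (d - (fst e + snd e))))"
proof -
  have "eval3 X F = (\<Sum>a\<in>{a. mdeg a = d}. Poly_Mapping.lookup F a * (\<Prod>i\<in>UNIV. X i ^ (a $ i)))"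
    by (rule eval3_superset[OF finite_exponents]) (use assms in \<open>auto simp: homogeneous_def\<close>)
  also have "\<dots> = (\<Sum>e\<in>monomials d. Poly_Mapping.lookup F (exponent d e) * (\<Prod>i\<in>UNIV. X i ^ (exponent d e $ i)))"
    unfolding exponents_eq by (subst sum.reindex[OF inj_on_subset[OF inj_exponent]]) simp_all
  also have "\<dots> = (\<Sum>e\<in>monomials d. affine_coeffs d F e * (X 1 ^ fst e * X 2 ^ snd e * X 3 ^ (d - (fst e + snd e))))"
    by (rule sum.cong[OF refl]) (simp only: prod_UNIV_3 affine_coeffs_def exponent_simps if_True)
  finally show ?thesis .
qed

text \<open>Both sides are coefficients of the same polynomial function in the two local coordinates.\<close>

lemma local_coeff_eq_local_expansion:
  assumes F: "homogeneous d F" and q: "q = vector [p 0, p 1, 1]" "p 2 = 0"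
  shows "local_coeff d p e (affine_coeffs d F) = Poly_Mapping.lookup (local_expansion 3 q F) (exponent (fst e + snd e) e)"
proof -
  let ?G = "local_expansion 3 q F"
  define pr where "pr a = (a $ 1, a $ 2)" for a :: "nat ^ 3"
  have k3: "a $ 3 = 0" if "a \<in> Poly_Mapping.keys ?G" for a using keys_local_expansion that by blast
  have inj: "inj_on pr (Poly_Mapping.keys ?G)"
    by (auto simp: inj_on_def pr_def vec_eq_iff forall_3 k3)
  define L where "L e = Poly_Mapping.lookup ?G (exponent (fst e + snd e) e)" for e
  have Lpr: "L (pr a) = Poly_Mapping.lookup ?G a" if "a \<in> Poly_Mapping.keys ?G" for a
  proof -
    have "exponent (fst (pr a) + snd (pr a)) (pr a) = a"
      by (simp add: vec_eq_iff forall_3 pr_def k3[OF that])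
    then show ?thesis by (simp add: L_def)
  qed
  let ?M = "monomials d \<union> pr ` Poly_Mapping.keys ?G \<union> {e}"
  have M: "finite ?M" by simp
  have "local_coeff d p e (affine_coeffs d F) - L e = 0"
  proof (rule bivariate_coeffs_eq_0[OF M])
    fix u w :: complex
    have "(\<Sum>e\<in>?M. local_coeff d p e (affine_coeffs d F) * (u ^ fst e * w ^ snd e)) =
        (\<Sum>e\<in>monomials d. local_coeff d p e (affine_coeffs d F) * (u ^ fst e * w ^ snd e))"
      by (rule sum.mono_neutral_right[OF M]) (auto simp: local_coeff_outside)
    also have "\<dots> = (\<Sum>f\<in>monomials d. affine_coeffs d F f * ((p 0 + u) ^ fst f * (p 1 + w) ^ snd f))"
      by (simp add: twisted_expansion q(2))
    also have "\<dots> = eval3 (\<lambda>j. if j = 1 then u else if j = 2 then w else 0) ?G"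
      unfolding eval3_local_expansion eval3_affine[OF F] by (simp add: q(1) vector_3 add.commute)
    also have "\<dots> = (\<Sum>a\<in>Poly_Mapping.keys ?G. L (pr a) * (u ^ fst (pr a) * w ^ snd (pr a)))"
      unfolding eval3_def
    proof (rule sum.cong[OF refl])
      fix a assume a: "a \<in> Poly_Mapping.keys ?G"
      have "(\<Prod>i\<in>UNIV. (if i = 1 then u else if i = 2 then w else 0) ^ (a $ i)) = u ^ (a $ 1) * w ^ (a $ 2)"
        by (simp add: prod_UNIV_3 k3[OF a])
      then show "Poly_Mapping.lookup ?G a * (\<Prod>i\<in>UNIV. (if i = 1 then u else if i = 2 then w else 0) ^ (a $ i)) =
          L (pr a) * (u ^ fst (pr a) * w ^ snd (pr a))"
        by (simp only: Lpr[OF a]) (simp add: pr_def)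
    qed
    also have "\<dots> = (\<Sum>e\<in>pr ` Poly_Mapping.keys ?G. L e * (u ^ fst e * w ^ snd e))"
      by (simp add: sum.reindex[OF inj])
    also have "\<dots> = (\<Sum>e\<in>?M. L e * (u ^ fst e * w ^ snd e))"
    proof (rule sum.mono_neutral_left[OF M])
      show "\<forall>e\<in>?M - pr ` Poly_Mapping.keys ?G. L e * (u ^ fst e * w ^ snd e) = 0"
      proof
        fix e assume e: "e \<in> ?M - pr ` Poly_Mapping.keys ?G"
        have "exponent (fst e + snd e) e \<notin> Poly_Mapping.keys ?G"
        proof
          assume "exponent (fst e + snd e) e \<in> Poly_Mapping.keys ?G"
          then have "pr (exponent (fst e + snd e) e) \<in> pr ` Poly_Mapping.keys ?G" by (rule imageI)
          then show False using e by (simp add: pr_def)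
        qed
        then show "L e * (u ^ fst e * w ^ snd e) = 0" by (simp add: L_def in_keys_iff)
      qed
    qed auto
    finally show "(\<Sum>e\<in>?M. (local_coeff d p e (affine_coeffs d F) - L e) * (u ^ fst e * w ^ snd e)) = 0"
      by (simp only: left_diff_distrib sum_subtractf) simp
  qed simp
  then show ?thesis by (simp add: L_def)
qed

lemma affine_coeffs_in_solutions:
  assumes F: "F \<in> curve_space d m n q" and q: "\<And>i. i < n \<Longrightarrow> q i = vector [x i 0, x i 1, 1]"
  shows "affine_coeffs d F \<in> solutions d n (\<lambda>_. fat m) x"
  unfolding mem_solutions
proof (intro conjI allI impI)
  fix f assume "f \<notin> monomials d"
  then show "affine_coeffs d F f = 0" by (simp add: affine_coeffs_def)
next
  fix i assume i: "i < n"
  have hom: "homogeneous d F" and van: "vanishes_to_order m (q i) F"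
    using F i by (auto simp: curve_space_def)
  define p where "p = (x i)(2 := 0)"
  have p: "p 0 = x i 0" "p 1 = x i 1" "p 2 = 0" by (simp_all add: p_def)
  have qp: "q i = vector [p 0, p 1, 1]" using q[OF i] p by simp
  have q3: "q i $ 3 \<noteq> 0" by (simp add: qp vector_3)
  have "\<forall>e\<in>fat m. local_coeff d p e (affine_coeffs d F) = 0"
  proof
    fix e assume e: "e \<in> fat m"
    have "exponent (fst e + snd e) e \<notin> Poly_Mapping.keys (local_expansion 3 (q i) F)"
    proof
      assume "exponent (fst e + snd e) e \<in> Poly_Mapping.keys (local_expansion 3 (q i) F)"
      then have "m \<le> mdeg (exponent (fst e + snd e) e)"
        using van q3 unfolding vanishes_to_order_def by blast
      then show False using e by (simp add: mdeg_3 fat_def)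
    qed
    then show "local_coeff d p e (affine_coeffs d F) = 0"
      by (simp add: local_coeff_eq_local_expansion[OF hom qp p(3)] in_keys_iff)
  qed
  then show "\<forall>e\<in>fat m. local_coeff d (x i) e (affine_coeffs d F) = 0"
    using fat_conditions_cong[of p "x i"] p by simp
qed

text \<open>For points in the chart in which the third coordinate is \<open>1\<close>, a form is determined by its
dehomogenization, which satisfies the affine conditions.\<close>

lemma curve_space_dim_le:
  assumes "dim_at_most (solutions d n (\<lambda>_. fat m) x) b" and q: "\<And>i. i < n \<Longrightarrow> q i = vector [x i 0, x i 1, 1]"
  shows "mpoly3_dim (curve_space d m n q) \<le> b"
proof -
  obtain K where K: "finite K" "card K \<le> b" "separates K (solutions d n (\<lambda>_. fat m) x)"
    using assms(1) unfolding dim_at_most_def by blast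
  have sep: "separates (exponent d ` K) (Poly_Mapping.lookup ` curve_space d m n q)"
    unfolding separates_def
  proof (intro ballI impI allI)
    fix v a assume "v \<in> Poly_Mapping.lookup ` curve_space d m n q" and z: "\<forall>k\<in>exponent d ` K. v k = 0"
    then obtain F where F: "F \<in> curve_space d m n q" "v = Poly_Mapping.lookup F" by blast
    have "affine_coeffs d F f = 0" for f
      by (rule separatesD[OF K(3) affine_coeffs_in_solutions[OF F(1) q]]) (use z F(2) in \<open>auto simp: affine_coeffs_def\<close>)
    then have l0: "Poly_Mapping.lookup F (exponent d f) = 0" if "f \<in> monomials d" for f
      using that by (metis affine_coeffs_def)
    show "v a = 0"
    proof (cases "mdeg a = d")
      case True
      then have "a \<in> exponent d ` monomials d" using exponents_eq by blast
      then show ?thesis using l0 F(2) by auto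
    next
      case False
      then have "a \<notin> Poly_Mapping.keys F" using F(1) by (auto simp: curve_space_def homogeneous_def)
      then show ?thesis using F(2) by (simp add: in_keys_iff)
    qed
  qed
  obtain K' where "K' \<subseteq> exponent d ` K" "mpoly3_dim (curve_space d m n q) = card K'"
    using dim_eq_card_coordinates[OF subspace_curve_space _ sep] K(1) by blast
  moreover from this have "card K' \<le> card K"
    using K(1) by (meson card_image_le card_mono finite_imageI le_trans)
  ultimately show ?thesis using K(2) by simp
qed

lemma card_local_monomials: 
  "finite {a :: nat ^ 3. a $ k = 0 \<and> mdeg a < m} \<and> card {a :: nat ^ 3. a $ k = 0 \<and> mdeg a < m} \<le> card (fat m)"
proof -
  obtain j l where jl: "j \<noteq> k" "l \<noteq> k" "j \<noteq> l" "UNIV = {k, j, l :: 3}"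
    using other_indices[of k] by blast
  let ?A = "{a :: nat ^ 3. a $ k = 0 \<and> mdeg a < m}"
  have inj: "inj_on (\<lambda>a. (a $ j, a $ l)) ?A" by (auto simp: inj_on_def vec3_eq_iff_others[OF jl(4)])
  moreover have sub: "(\<lambda>a. (a $ j, a $ l)) ` ?A \<subseteq> fat m" by (auto simp: fat_def mdeg_others[OF jl])
  ultimately show ?thesis
    using inj_on_finite[OF inj sub finite_fat] card_inj_on_le[OF inj sub finite_fat] by blast
qed

lemma local_expansion_sum:
  assumes "finite A" "Poly_Mapping.keys F \<subseteq> A"
  shows "Poly_Mapping.lookup (local_expansion i q F) e =
    (\<Sum>a\<in>A. Poly_Mapping.lookup (local_expansion i q (Poly_Mapping.single a 1)) e * Poly_Mapping.lookup F a)"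
proof -
  have lsum: "local_expansion i q (\<Sum>a\<in>B. f a) = (\<Sum>a\<in>B. local_expansion i q (f a))" for f and B :: "(nat ^ 3) set"
    by (induction B rule: infinite_finite_induct) (simp_all add: local_expansion_def msubst_add, simp_all add: msubst_def)
  have s: "Poly_Mapping.single a (Poly_Mapping.lookup F a) = mscale (Poly_Mapping.lookup F a) (Poly_Mapping.single a 1)" for a
    by (rule poly_mapping_eqI) (simp add: lookup_mscale lookup_single when_def)
  have "local_expansion i q F = (\<Sum>a\<in>A. mscale (Poly_Mapping.lookup F a) (local_expansion i q (Poly_Mapping.single a 1)))"
    by (subst mpoly3_as_sum[OF assms]) (simp add: lsum s, simp add: local_expansion_def msubst_mscale)
  then show ?thesis by (simp add: lookup_sum lookup_mscale mult.commute)
qed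

text \<open>At each point choose one chart. Multiplicity \<open>m\<close> in that chart is given by as many linear conditions
as \<open>fat m\<close> has elements, and by independence of the chart it implies the conditions in the other charts.\<close>

lemma curve_space_dim_ge:
  assumes q: "\<And>i. i < n \<Longrightarrow> q i \<noteq> 0"
  shows "card (monomials d) \<le> mpoly3_dim (curve_space d m n q) + n * card (fat m)"
proof -
  let ?I = "{a. mdeg a = d}" and ?V = "curve_space d m n q"
  have "\<exists>k. q i $ k \<noteq> 0" if "i < n" for i using q[OF that] by (simp add: vec_eq_iff)
  then obtain c where c: "\<And>i. i < n \<Longrightarrow> q i $ c i \<noteq> 0" by metis
  define \<Lambda> where "\<Lambda> = (\<lambda>(i, e) a. Poly_Mapping.lookup (local_expansion (c i) (q i) (Poly_Mapping.single a 1)) e)"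
  let ?P = "SIGMA i:{..<n}. {e :: nat ^ 3. e $ c i = 0 \<and> mdeg e < m}"
  have sub: "common_kernel ?I (\<Lambda> ` ?P) \<subseteq> Poly_Mapping.lookup ` ?V"
  proof
    fix v assume v: "v \<in> common_kernel ?I (\<Lambda> ` ?P)"
    define F where "F = (\<Sum>a\<in>?I. Poly_Mapping.single a (v a))"
    have lF: "Poly_Mapping.lookup F = v"
    proof
      fix b
      have "Poly_Mapping.lookup F b = (\<Sum>a\<in>?I. if a = b then v b else 0)"
        unfolding F_def lookup_sum by (rule sum.cong) (auto simp: lookup_single when_def)
      then show "Poly_Mapping.lookup F b = v b"
        using v finite_exponents[of d] by (auto simp: common_kernel_def)
    qed
    have keys: "Poly_Mapping.keys F \<subseteq> ?I"
      using v by (auto simp: in_keys_iff lF common_kernel_def)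
    then have hom: "homogeneous d F" by (auto simp: homogeneous_def)
    have "vanishes_to_order m (q i) F" if i: "i < n" for i
    proof (rule chart_independence[OF hom c[OF i]], rule ccontr)
      fix e assume e: "e \<in> Poly_Mapping.keys (local_expansion (c i) (q i) F)" "\<not> m \<le> mdeg e"
      have "(i, e) \<in> ?P" using i e keys_local_expansion[OF e(1)] by simp
      then have "(\<Sum>a\<in>?I. \<Lambda> (i, e) a * v a) = 0" using v unfolding common_kernel_def by blast
      then have "Poly_Mapping.lookup (local_expansion (c i) (q i) F) e = 0"
        by (subst local_expansion_sum[OF finite_exponents keys]) (simp add: \<Lambda>_def lF)
      then show False using e(1) by (simp add: in_keys_iff)
    qed
    then have "F \<in> ?V" using hom by (simp add: curve_space_def)
    then show "v \<in> Poly_Mapping.lookup ` ?V" using lF by blast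
  qed
  have "separates ?I (Poly_Mapping.lookup ` ?V)"
    unfolding separates_def
  proof (intro ballI impI allI)
    fix v a assume "v \<in> Poly_Mapping.lookup ` ?V" and z: "\<forall>k\<in>?I. v k = 0"
    then obtain F where F: "F \<in> ?V" "v = Poly_Mapping.lookup F" by blast
    show "v a = 0"
    proof (cases "mdeg a = d")
      case True
      then show ?thesis using z by simp
    next
      case False
      then have "a \<notin> Poly_Mapping.keys F" using F(1) by (auto simp: curve_space_def homogeneous_def)
      then show ?thesis using F(2) by (simp add: in_keys_iff)
    qed
  qed
  from dim_eq_card_coordinates[OF subspace_curve_space finite_exponents this]
  obtain K where K: "K \<subseteq> ?I" "separates K (Poly_Mapping.lookup ` ?V)" "mpoly3_dim ?V = card K" by blast
  have finP: "finite ?P" using card_local_monomials by blast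
  have "separates K (common_kernel ?I ({} \<union> \<Lambda> ` ?P))"
    using K(2) sub unfolding separates_def by auto
  then have "dim_at_most (common_kernel ?I ({} \<union> \<Lambda> ` ?P)) (card K)"
    unfolding dim_at_most_def using finite_subset[OF K(1) finite_exponents] by blast
  then have "dim_at_most (common_kernel ?I {}) (card K + card (\<Lambda> ` ?P))"
    using finP by (intro dim_at_most_drop_conditions finite_exponents) auto
  then have "card ?I \<le> card K + card (\<Lambda> ` ?P)" by (rule dim_at_most_full[OF finite_exponents])
  moreover have "card (\<Lambda> ` ?P) \<le> card ?P" by (rule card_image_le[OF finP])
  moreover have "card ?P = (\<Sum>i<n. card {e :: nat ^ 3. e $ c i = 0 \<and> mdeg e < m})"
    using card_local_monomials by (intro card_SigmaI) blast+
  moreover have "\<dots> \<le> (\<Sum>i<n. card (fat m))" by (intro sum_mono) (use card_local_monomials in blast)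
  ultimately show ?thesis by (simp add: card_exponents K(3))
qed

text \<open>It suffices to separate the points by their first coordinates.\<close>

lemma line_generic_distinct: "line_generic {x :: nat \<Rightarrow> nat \<Rightarrow> complex. \<forall>i<n. \<forall>j<n. i \<noteq> j \<longrightarrow> x i 0 \<noteq> x j 0}"
  (is "line_generic ?U")
  unfolding line_generic_def
proof (intro conjI ballI allI)
  have "(\<lambda>i k. of_nat i) \<in> ?U" by simp
  from exI[of "\<lambda>x. x \<in> ?U", OF this] show "?U \<noteq> {}" by (simp only: ex_in_conv simp_thms)
next
  fix x y :: "nat \<Rightarrow> nat \<Rightarrow> complex" assume x: "x \<in> ?U"
  have "finite {t. x i 0 + t * y i 0 = x j 0 + t * y j 0}" if "i < n" "j < n" "i \<noteq> j" for i j
  proof (rule finite_subset)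
    let ?p = "[:x i 0 - x j 0, y i 0 - y j 0:]"
    show "{t. x i 0 + t * y i 0 = x j 0 + t * y j 0} \<subseteq> {t. poly ?p t = 0}" by (auto simp: algebra_simps)
    have "?p \<noteq> 0" using x that by auto
    then show "finite {t. poly ?p t = 0}" by (rule poly_roots_finite)
  qed
  then have "finite (\<Union>P\<in>{P \<in> {..<n} \<times> {..<n}. fst P \<noteq> snd P}. {t. x (fst P) 0 + t * y (fst P) 0 = x (snd P) 0 + t * y (snd P) 0})"
    by (intro finite_UN_I) auto
  then show "finite {t. on_line x y t \<notin> ?U}"
    by (rule finite_subset[rotated]) (force simp: on_line_def)
qed

text \<open>The lower bound holds for all tuples. For the upper bound choose points that are both of minimal
dimension and distinct, which is possible because both conditions are generic.\<close>

lemma non_special_if_max_rank: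
  assumes "max_rank n"
  shows "non_special d m n"
proof -
  let ?N = "card (monomials d)" and ?c = "card (fat m)"
  obtain x0 where "dim_at_most (solutions d n (\<lambda>_. fat m) x0) (?N - n * ?c)"
    using assms unfolding max_rank_def by blast
  then have "line_generic ({x. dim_at_most (solutions d n (\<lambda>_. fat m) x) (?N - n * ?c)} \<inter>
      {x. \<forall>i<n. \<forall>j<n. i \<noteq> j \<longrightarrow> x i 0 \<noteq> x j 0})"
    by (intro line_generic_Int line_generic_dim_at_most line_generic_distinct)
  then obtain x where x: "dim_at_most (solutions d n (\<lambda>_. fat m) x) (?N - n * ?c)"
    "\<forall>i<n. \<forall>j<n. i \<noteq> j \<longrightarrow> x i 0 \<noteq> x j 0"
    unfolding line_generic_def by blast
  define q :: "nat \<Rightarrow> complex ^ 3" where "q i = vector [x i 0, x i 1, 1]" for i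
  have q: "q \<in> distinct_points n"
    using x(2) by (auto simp: distinct_points_def q_def vec_eq_iff forall_3 vector_3)
  have N: "2 * int ?N = (int d + 1) * (int d + 2)"
    using arg_cong[OF card_monomials[of d], of int] by (simp add: algebra_simps)
  have c: "2 * int ?c = int m * (int m + 1)"
    using arg_cong[OF card_fat[of m], of int] by (simp add: algebra_simps)
  have "int d * (int d + 3) = 2 * (int ?N - 1)" using N by (simp add: algebra_simps)
  then have v: "virtual_dim d m n = int ?N - 1 - int n * int ?c"
    unfolding virtual_dim_def c[symmetric] by simp
  have lower: "expected_dim d m n \<le> system_dim d m n r" if "r \<in> distinct_points n" for r
  proof -
    have "?N \<le> mpoly3_dim (curve_space d m n r) + n * ?c"
      by (rule curve_space_dim_ge) (use that in \<open>auto simp: distinct_points_def\<close>)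
    then have "int ?N \<le> int (mpoly3_dim (curve_space d m n r)) + int n * int ?c"
      by (metis of_nat_add of_nat_le_iff of_nat_mult)
    then show ?thesis by (simp add: expected_dim_def v system_dim_def)
  qed
  have "mpoly3_dim (curve_space d m n q) \<le> ?N - n * ?c"
    by (rule curve_space_dim_le[OF x(1)]) (simp add: q_def)
  then have "int (mpoly3_dim (curve_space d m n q)) \<le> max 0 (int ?N - int n * int ?c)"
    by (simp add: of_nat_diff max_def flip: of_nat_mult of_nat_diff) linarith
  then have upper: "system_dim d m n q \<le> expected_dim d m n"
    by (simp add: expected_dim_def v system_dim_def max_def split: if_splits)
  have "general_dim d m n = expected_dim d m n"
    unfolding general_dim_def
  proof (rule antisym)
    have "bdd_below (system_dim d m n ` distinct_points n)"
      using lower by (intro bdd_belowI2) auto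
    then show "(INF r\<in>distinct_points n. system_dim d m n r) \<le> expected_dim d m n"
      using upper by (rule cINF_lower2[OF _ q])
    show "expected_dim d m n \<le> (INF r\<in>distinct_points n. system_dim d m n r)"
      by (rule cINF_greatest[OF distinct_points_nonempty lower])
  qed
  then show ?thesis by (simp add: non_special_def)
qed

theorem theorem4:
  fixes d m h k :: nat
  assumes "m \<ge> 1"
  shows "non_special d m (4 ^ h * 9 ^ k)"
  by (rule non_special_if_max_rank[OF max_rank_4_9])

end
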